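(* Let $\mathbf{d}$ be a Turing degree. Let $F$ be a computable field and $V_\infty$ the canonical computable $\aleph_0$-dimensional vector space over $F$ with a computable basis; let $GSL_{\mathbf{d}}$ be the group (under composition) of pairs $\langle\mu,\sigma\rangle$ where $\sigma$ is an automorphism of $F$ with $\deg(\sigma)\le\mathbf{d}$ and $\mu:V_\infty\to V_\infty$ is a bijective semilinear transformation with respect to $\sigma$ with $\deg(\mu)\le\mathbf{d}$. Let $\mathcal{B}_\eta$ be the interval Boolean algebra of the rationals (fixed computable presentation) and $Aut_{\mathbf{d}}(\mathcal{B}_\eta)$ the group of automorphisms of $\mathcal{B}_\eta$ of Turing degree $\leq\mathbf{d}$. Then the Turing degree of the isomorphism type of each of the groups $GSL_{\mathbf{d}}$ and $Aut_{\mathbf{d}}(\mathcal{B}_\eta)$ exists and equals $\mathbf{d}''$.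
   Context: A map $\mu:V_\infty\to V_\infty$ is semilinear with respect to an automorphism $\sigma$ of $F$ if $\mu(\alpha u+\beta v)=\sigma(\alpha)\mu(u)+\sigma(\beta)\mu(v)$ for all $u,v\in V_\infty$, $\alpha,\beta\in F$. $\mathcal{B}_\eta$ is the Boolean algebra of finite unions of left-closed right-open intervals of a standard computable copy of $(\mathbb{Q},<)$. The Turing degree of the isomorphism type of a countable structure $\mathcal{A}$ is, if it exists, the least element of $\{\deg(\mathcal{B}):\mathcal{B}\cong\mathcal{A}\}$, where $\deg(\mathcal{B})$ is the Turing degree of the atomic diagram of a copy with domain $\subseteq\omega$. $\mathbf{d}''$ is the second Turing jump of $\mathbf{d}$. *)

theory Defs
  imports
    "HOL-Library.Nat_Bijection"
    "HOL-Library.Countable"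
    "HOL-Algebra.Bij"
    "HOL-Algebra.Module"
    "HOL-Algebra.QuotRing"
begin

section \<open>Oracle computability and Turing degrees\<close>

text \<open>Kleene's schemes for the partial recursive functions relative to an oracle
  \<open>A \<subseteq> \<omega>\<close>, as a syntax of programs with an evaluation relation. The function
  computed is partial; primitive recursion and minimisation act on the first
  argument.\<close>

datatype recf =
    Zero
  | Succ
  | Proj nat
  | Oracle
  | Comp recf "recf list"
  | PrimRec recf recf
  | Minim recf

inductive eval :: "nat set \<Rightarrow> recf \<Rightarrow> nat list \<Rightarrow> nat \<Rightarrow> bool" for A where
  Zero: "eval A Zero xs 0"
| Succ: "eval A Succ [x] (Suc x)"
| Proj: "i < length xs \<Longrightarrow> eval A (Proj i) xs (xs ! i)"
| Oracle: "eval A Oracle [x] (if x \<in> A then 1 else 0)"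
| Comp: "list_all2 (\<lambda>g y. eval A g xs y) gs ys \<Longrightarrow> eval A f ys z \<Longrightarrow> eval A (Comp f gs) xs z"
| PrimRec_0: "eval A f xs y \<Longrightarrow> eval A (PrimRec f g) (0 # xs) y"
| PrimRec_Suc: "eval A (PrimRec f g) (n # xs) r \<Longrightarrow> eval A g (n # r # xs) y \<Longrightarrow>
    eval A (PrimRec f g) (Suc n # xs) y"
| Minim: "eval A f (n # xs) 0 \<Longrightarrow> \<forall>m<n. \<exists>k. eval A f (m # xs) (Suc k) \<Longrightarrow>
    eval A (Minim f) xs n"

inductive_cases eval_elims:
  "eval A Zero xs y"
  "eval A Succ xs y"
  "eval A (Proj i) xs y"
  "eval A Oracle xs y"
  "eval A (Comp f gs) xs y"
  "eval A (PrimRec f g) (0 # xs) y"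
  "eval A (PrimRec f g) (Suc n # xs) y"
  "eval A (Minim f) xs y"

lemma eval_deterministic: "eval A f xs y \<Longrightarrow> eval A f xs z \<Longrightarrow> y = z"
proof (induction arbitrary: z rule: eval.induct)
  case (Zero xs)
  from Zero.prems show ?case by (rule eval_elims(1)) simp
next
  case (Succ x)
  from Succ.prems show ?case by (rule eval_elims(2)) simp
next
  case (Proj i xs)
  from Proj.prems show ?case by (rule eval_elims(3)) simp
next
  case (Oracle x)
  from Oracle.prems show ?case by (rule eval_elims(4)) simp
next
  case (Comp xs gs ys f y)
  from Comp.prems obtain ys' where ys': "list_all2 (\<lambda>g y. eval A g xs y) gs ys'" "eval A f ys' z"
    by (rule eval_elims(5))
  have "ys = ys'"
  proof (rule nth_equalityI)
    show "length ys = length ys'"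
      using Comp.IH(1)[THEN list_all2_lengthD] ys'(1)[THEN list_all2_lengthD] by (rule trans[OF sym])
    fix i assume i: "i < length ys"
    then have "i < length gs" by (subst Comp.IH(1)[THEN list_all2_lengthD])
    with Comp.IH(1) ys'(1) have "eval A (gs ! i) xs (ys' ! i)"
      "\<forall>z. eval A (gs ! i) xs z \<longrightarrow> ys ! i = z"
      unfolding list_all2_conv_all_nth by blast+
    then show "ys ! i = ys' ! i" by blast
  qed
  with ys'(2) have "eval A f ys z" by simp
  then show ?case by (rule Comp.IH(2))
next
  case (PrimRec_0 f xs y g)
  from PrimRec_0.prems have "eval A f xs z" by (rule eval_elims(6))
  then show ?case by (rule PrimRec_0.IH)
next
  case (PrimRec_Suc f g n xs r y)
  from PrimRec_Suc.prems obtain r' where r': "eval A (PrimRec f g) (n # xs) r'" "eval A g (n # r' # xs) z"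
    by (rule eval_elims(7))
  from PrimRec_Suc.IH(1)[OF r'(1)] r'(2) have "eval A g (n # r # xs) z" by simp
  then show ?case by (rule PrimRec_Suc.IH(2))
next
  case (Minim f n xs)
  from Minim.prems have z: "eval A f (z # xs) 0" "\<forall>m<z. \<exists>k. eval A f (m # xs) (Suc k)"
    by (blast elim: eval_elims(8))+
  show ?case
  proof (rule linorder_cases[of n z])
    assume "n < z"
    with z(2) obtain k where "eval A f (n # xs) (Suc k)" by blast
    from Minim.IH(1)[OF this] show ?thesis by simp
  next
    assume "z < n"
    with Minim.IH(2) obtain k where "\<forall>y. eval A f (z # xs) y \<longrightarrow> Suc k = y" by blast
    with z(1) show ?thesis by blast
  qed
qed

primrec recf_code :: "recf \<Rightarrow> nat" where
  "recf_code Zero = prod_encode (0, 0)"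
| "recf_code Succ = prod_encode (1, 0)"
| "recf_code (Proj i) = prod_encode (2, i)"
| "recf_code Oracle = prod_encode (3, 0)"
| "recf_code (Comp f gs) = prod_encode (4, prod_encode (recf_code f, list_encode (map recf_code gs)))"
| "recf_code (PrimRec f g) = prod_encode (5, prod_encode (recf_code f, recf_code g))"
| "recf_code (Minim f) = prod_encode (6, recf_code f)"

lemma recf_code_inject: "recf_code f = recf_code g \<Longrightarrow> f = g"
proof (induction f arbitrary: g)
  case (Comp f fs)
  then obtain h hs where g: "g = Comp h hs" by (cases g) auto
  with Comp.prems have eq: "recf_code f = recf_code h" "map recf_code fs = map recf_code hs"
    by (simp_all add: list_encode_eq)
  have "fs = hs"
    by (rule list.inj_map_strong[OF _ eq(2)]) (rule Comp.IH(2))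
  with Comp.IH(1)[OF eq(1)] g show ?case by simp
next
  case (PrimRec f1 f2) then show ?case by (cases g) auto
next
  case (Minim f) then show ?case by (cases g) auto
next
  case (Proj i) then show ?case by (cases g) auto
next
  case Zero then show ?case by (cases g) auto
next
  case Succ then show ?case by (cases g) auto
next
  case Oracle then show ?case by (cases g) auto
qed

definition turing_le :: "nat set \<Rightarrow> nat set \<Rightarrow> bool" where
  "turing_le A B \<longleftrightarrow> (\<exists>f. \<forall>x. eval B f [x] (if x \<in> A then 1 else 0))"

lemma turing_le_refl: "turing_le A A"
  unfolding turing_le_def using eval.Oracle by blast

primrec subst_oracle :: "recf \<Rightarrow> recf \<Rightarrow> recf" where
  "subst_oracle p Zero = Zero"
| "subst_oracle p Succ = Succ"
| "subst_oracle p (Proj i) = Proj i"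
| "subst_oracle p Oracle = p"
| "subst_oracle p (Comp f gs) = Comp (subst_oracle p f) (map (subst_oracle p) gs)"
| "subst_oracle p (PrimRec f g) = PrimRec (subst_oracle p f) (subst_oracle p g)"
| "subst_oracle p (Minim f) = Minim (subst_oracle p f)"

lemma eval_subst_oracle:
  assumes p: "\<forall>x. eval B p [x] (if x \<in> A then 1 else 0)"
  shows "eval A f xs y \<Longrightarrow> eval B (subst_oracle p f) xs y"
proof (induction rule: eval.induct)
  case (Oracle x)
  then show ?case using p by simp
next
  case (Comp xs gs ys f z)
  have "list_all2 (\<lambda>g y. eval B g xs y) (map (subst_oracle p) gs) ys"
    using Comp.IH(1) by (auto simp: list_all2_conv_all_nth)
  with Comp show ?case by (auto intro: eval.Comp)
next
  case (Minim f n xs)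
  then show ?case by (auto intro!: eval.Minim)
qed (auto intro: eval.intros)

lemma turing_le_trans: "turing_le A B \<Longrightarrow> turing_le B C \<Longrightarrow> turing_le A C"
  unfolding turing_le_def using eval_subst_oracle by blast

quotient_type turing_degree = "nat set" / "\<lambda>A B. turing_le A B \<and> turing_le B A"
  by (rule equivpI) (auto simp: reflp_def symp_def transp_def intro: turing_le_refl turing_le_trans)

lift_definition degree_of :: "nat set \<Rightarrow> turing_degree" is "\<lambda>A. A" .

instantiation turing_degree :: order
begin

lift_definition less_eq_turing_degree :: "turing_degree \<Rightarrow> turing_degree \<Rightarrow> bool" is turing_le
  using turing_le_trans by blast

definition less_turing_degree :: "turing_degree \<Rightarrow> turing_degree \<Rightarrow> bool" where
  "less_turing_degree d e \<longleftrightarrow> d \<le> e \<and> \<not> e \<le> d"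

instance
proof
  fix a b c :: turing_degree
  show "a < b \<longleftrightarrow> a \<le> b \<and> \<not> b \<le> a" by (simp add: less_turing_degree_def)
  show "a \<le> a" by transfer (rule turing_le_refl)
  show "a \<le> c" if "a \<le> b" "b \<le> c" using that by transfer (rule turing_le_trans)
  show "a = b" if "a \<le> b" "b \<le> a" using that by transfer blast
qed

end

lemma degree_of_le_iff: "degree_of A \<le> degree_of B \<longleftrightarrow> turing_le A B"
  by transfer simp

text \<open>The diagonal halting problem \<open>A' = {e. \<phi>\<^sub>e\<^sup>A(e) is defined}\<close>, where the index \<open>e\<close>
  of a program is its code; a number that is not a code indexes the empty function.\<close>

definition turing_jump :: "nat set \<Rightarrow> nat set" where
  "turing_jump A = {e. \<exists>f y. recf_code f = e \<and> eval A f [e] y}"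

definition decidable :: "nat set \<Rightarrow> bool" where
  "decidable A \<longleftrightarrow> turing_le A {}"

text \<open>The degree of a function \<open>f : S \<rightarrow> S\<close>, where the elements of \<open>S\<close> are represented by
  natural numbers through an injective coding \<open>c\<close>, is the degree of its coded graph.\<close>

definition fun_degree :: "('a \<Rightarrow> nat) \<Rightarrow> 'a set \<Rightarrow> ('a \<Rightarrow> 'a) \<Rightarrow> turing_degree" where
  "fun_degree c S f = degree_of ((\<lambda>x. prod_encode (c x, c (f x))) ` S)"


section \<open>The degree of the isomorphism type of a group\<close>

text \<open>Closed terms of the language of groups with a constant for every natural number.\<close>

datatype gterm = Elt nat | One | Inv gterm | Mult gterm gterm

primrec gterm_consts :: "gterm \<Rightarrow> nat set" where
  "gterm_consts (Elt a) = {a}"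
| "gterm_consts One = {}"
| "gterm_consts (Inv s) = gterm_consts s"
| "gterm_consts (Mult s t) = gterm_consts s \<union> gterm_consts t"

primrec gterm_value :: "nat monoid \<Rightarrow> gterm \<Rightarrow> nat" where
  "gterm_value H (Elt a) = a"
| "gterm_value H One = \<one>\<^bsub>H\<^esub>"
| "gterm_value H (Inv s) = inv\<^bsub>H\<^esub> (gterm_value H s)"
| "gterm_value H (Mult s t) = gterm_value H s \<otimes>\<^bsub>H\<^esub> gterm_value H t"

primrec gterm_code :: "gterm \<Rightarrow> nat" where
  "gterm_code (Elt a) = prod_encode (0, a)"
| "gterm_code One = prod_encode (1, 0)"
| "gterm_code (Inv s) = prod_encode (2, gterm_code s)"
| "gterm_code (Mult s t) = prod_encode (3, prod_encode (gterm_code s, gterm_code t))"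

lemma gterm_code_inject: "gterm_code s = gterm_code t \<Longrightarrow> s = t"
proof (induction s arbitrary: t)
  case (Elt a) then show ?case by (cases t) auto
next
  case One then show ?case by (cases t) auto
next
  case (Inv s) then show ?case by (cases t) auto
next
  case (Mult s1 s2) then show ?case by (cases t) auto
qed

text \<open>The first component of a code is \<open>1\<close> for an equation and \<open>0\<close> for a negated one.\<close>

definition atomic_diagram :: "nat monoid \<Rightarrow> nat set" where
  "atomic_diagram H =
    {prod_encode (if gterm_value H s = gterm_value H t then 1 else 0,
                  prod_encode (gterm_code s, gterm_code t)) | s t.
       gterm_consts s \<union> gterm_consts t \<subseteq> carrier H}"

definition copy_degrees :: "('a, 'b) monoid_scheme \<Rightarrow> turing_degree set" where
  "copy_degrees G = {degree_of (atomic_diagram H) | H :: nat monoid. group H \<and> H \<cong> G}"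

definition iso_type_has_degree :: "('a, 'b) monoid_scheme \<Rightarrow> turing_degree \<Rightarrow> bool" where
  "iso_type_has_degree G e \<longleftrightarrow> e \<in> copy_degrees G \<and> (\<forall>e' \<in> copy_degrees G. e \<le> e')"


section \<open>The group of semilinear transformations of \<open>V\<^sub>\<infinity>\<close>\<close>

definition computable_op_on :: "nat set \<Rightarrow> (nat \<Rightarrow> nat \<Rightarrow> nat) \<Rightarrow> bool" where
  "computable_op_on C h \<longleftrightarrow> (\<exists>f. \<forall>x\<in>C. \<forall>y\<in>C. eval {} f [x, y] (h x y))"

definition computable_field :: "nat ring \<Rightarrow> bool" where
  "computable_field F \<longleftrightarrow> field F \<and> decidable (carrier F) \<and>
     computable_op_on (carrier F) (\<lambda>x y. x \<oplus>\<^bsub>F\<^esub> y) \<and>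
     computable_op_on (carrier F) (\<lambda>x y. x \<otimes>\<^bsub>F\<^esub> y)"

text \<open>\<open>V\<^sub>\<infinity>\<close> consists of the finitely supported sequences over \<open>F\<close> with pointwise operations;
  the unit sequences are a basis. The \<open>mult\<close> and \<open>one\<close> fields, which the \<open>module\<close> record
  inherits from rings, carry no meaning.\<close>

definition V_inf :: "nat ring \<Rightarrow> (nat, nat \<Rightarrow> nat) module" where
  "V_inf F =
    \<lparr>carrier = {v. (\<forall>i. v i \<in> carrier F) \<and> finite {i. v i \<noteq> \<zero>\<^bsub>F\<^esub>}},
     monoid.mult = undefined, one = undefined,
     ring.zero = (\<lambda>i. \<zero>\<^bsub>F\<^esub>),
     add = (\<lambda>u v i. u i \<oplus>\<^bsub>F\<^esub> v i),
     smult = (\<lambda>a v i. a \<otimes>\<^bsub>F\<^esub> v i)\<rparr>"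

lemma module_V_inf:
  assumes "field F"
  shows "module F (V_inf F)"
proof -
  interpret F: field F by fact
  have add_fin: "finite {i. u i \<oplus>\<^bsub>F\<^esub> v i \<noteq> \<zero>\<^bsub>F\<^esub>}"
    if "finite {i. u i \<noteq> \<zero>\<^bsub>F\<^esub>}" "finite {i. v i \<noteq> \<zero>\<^bsub>F\<^esub>}" for u v :: "nat \<Rightarrow> nat"
    by (rule finite_subset[OF _ finite_UnI[OF that]]) auto
  have smult_fin: "finite {i. a \<otimes>\<^bsub>F\<^esub> v i \<noteq> \<zero>\<^bsub>F\<^esub>}"
    if "finite {i. v i \<noteq> \<zero>\<^bsub>F\<^esub>}" "a \<in> carrier F" for a and v :: "nat \<Rightarrow> nat"
    by (rule finite_subset[OF _ that(1)]) (use that in auto)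
  show ?thesis
  proof (rule moduleI)
    show "cring F" by (rule F.is_cring)
    show "abelian_group (V_inf F)"
    proof (rule abelian_groupI)
      fix x assume x: "x \<in> carrier (V_inf F)"
      have "{i. \<ominus>\<^bsub>F\<^esub> x i \<noteq> \<zero>\<^bsub>F\<^esub>} \<subseteq> {i. x i \<noteq> \<zero>\<^bsub>F\<^esub>}" by auto
      with x have "(\<lambda>i. \<ominus>\<^bsub>F\<^esub> x i) \<in> carrier (V_inf F)"
        by (auto simp: V_inf_def intro: finite_subset)
      with x show "\<exists>y\<in>carrier (V_inf F). y \<oplus>\<^bsub>V_inf F\<^esub> x = \<zero>\<^bsub>V_inf F\<^esub>"
        by (intro bexI[where x = "\<lambda>i. \<ominus>\<^bsub>F\<^esub> x i"]) (auto simp: V_inf_def F.l_neg)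
    qed (auto simp: V_inf_def add_fin F.add.m_ac)
  qed (auto simp: V_inf_def smult_fin F.l_distr F.r_distr F.m_assoc)
qed

text \<open>A vector is coded by the list of its entries up to the last nonzero one.\<close>

definition vec_code :: "nat ring \<Rightarrow> (nat \<Rightarrow> nat) \<Rightarrow> nat" where
  "vec_code F v = list_encode (map v [0..<(LEAST n. \<forall>i\<ge>n. v i = \<zero>\<^bsub>F\<^esub>)])"

lemma inj_on_vec_code: "inj_on (vec_code F) (carrier (V_inf F))"
proof (rule inj_onI)
  fix u v assume uv: "u \<in> carrier (V_inf F)" "v \<in> carrier (V_inf F)" "vec_code F u = vec_code F v"
  define N where "N w = (LEAST n. \<forall>i\<ge>n. w i = \<zero>\<^bsub>F\<^esub>)" for w :: "nat \<Rightarrow> nat"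
  have N: "\<forall>i\<ge>N w. w i = \<zero>\<^bsub>F\<^esub>" if "w \<in> carrier (V_inf F)" for w
  proof -
    from that obtain m where "\<forall>i\<in>{i. w i \<noteq> \<zero>\<^bsub>F\<^esub>}. i < m"
      by (auto simp: V_inf_def finite_nat_set_iff_bounded)
    then have "\<forall>i\<ge>m. w i = \<zero>\<^bsub>F\<^esub>" by force
    then show ?thesis unfolding N_def by (rule LeastI)
  qed
  from uv(3) have eq: "map u [0..<N u] = map v [0..<N v]"
    by (simp add: vec_code_def N_def list_encode_eq)
  from map_eq_imp_length_eq[OF this] have len: "N u = N v" by simp
  show "u = v"
  proof
    fix i
    show "u i = v i"
    proof (cases "i < N u")
      case True
      then show ?thesis using eq unfolding len by (simp add: map_eq_conv)
    next
      case False
      then show ?thesis using len N[OF uv(1)] N[OF uv(2)] by (metis not_less)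
    qed
  qed
qed

definition semilinear :: "nat ring \<Rightarrow> (nat \<Rightarrow> nat) \<Rightarrow> ((nat \<Rightarrow> nat) \<Rightarrow> (nat \<Rightarrow> nat)) \<Rightarrow> bool" where
  "semilinear F \<sigma> \<mu> \<longleftrightarrow>
    (\<forall>u \<in> carrier (V_inf F). \<forall>v \<in> carrier (V_inf F). \<forall>\<alpha> \<in> carrier F. \<forall>\<beta> \<in> carrier F.
       \<mu> (\<alpha> \<odot>\<^bsub>V_inf F\<^esub> u \<oplus>\<^bsub>V_inf F\<^esub> \<beta> \<odot>\<^bsub>V_inf F\<^esub> v)
         = \<sigma> \<alpha> \<odot>\<^bsub>V_inf F\<^esub> \<mu> u \<oplus>\<^bsub>V_inf F\<^esub> \<sigma> \<beta> \<odot>\<^bsub>V_inf F\<^esub> \<mu> v)"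

definition GSL ::
  "nat ring \<Rightarrow> turing_degree \<Rightarrow> (((nat \<Rightarrow> nat) \<Rightarrow> (nat \<Rightarrow> nat)) \<times> (nat \<Rightarrow> nat)) monoid" where
  "GSL F d = (BijGroup (carrier (V_inf F)) \<times>\<times> BijGroup (carrier F))
     \<lparr>carrier := {(\<mu>, \<sigma>).
        \<sigma> \<in> Bij (carrier F) \<and> \<sigma> \<in> ring_iso F F \<and>
        \<mu> \<in> Bij (carrier (V_inf F)) \<and> semilinear F \<sigma> \<mu> \<and>
        fun_degree (\<lambda>a. a) (carrier F) \<sigma> \<le> d \<and>
        fun_degree (vec_code F) (carrier (V_inf F)) \<mu> \<le> d}\<rparr>"


section \<open>The interval algebra of the rationals\<close>

text \<open>The ends \<open>-\<infinity>\<close> and \<open>\<infinity>\<close> are allowed, since otherwise there is no top element.\<close>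

definition half_open_intervals :: "rat set set" where
  "half_open_intervals =
    {{a..<b} | a b. True} \<union> {{a..} | a. True} \<union> {{..<b} | b. True} \<union> {UNIV}"

definition B_eta :: "rat set set" where
  "B_eta = {\<Union>\<I> | \<I>. finite \<I> \<and> \<I> \<subseteq> half_open_intervals}"

text \<open>The computable presentation: \<open>Q\<close> is enumerated by the standard numbering
  \<open>nat_to_rat_surj\<close>, an interval is given by a pair of end points, where \<open>0\<close> stands for an
  infinite one, and a natural number denotes the union of a finite list of intervals. As equality
  of the denoted sets is decidable, coding each set by its least notation gives a computable
  copy.\<close>

definition interval_of :: "nat \<Rightarrow> rat set" where
  "interval_of k = (case prod_decode k of (l, r) \<Rightarrow>
     (case l of 0 \<Rightarrow> UNIV | Suc m \<Rightarrow> {nat_to_rat_surj m..}) \<inter>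
     (case r of 0 \<Rightarrow> UNIV | Suc n \<Rightarrow> {..<nat_to_rat_surj n}))"

definition B_eta_elem :: "nat \<Rightarrow> rat set" where
  "B_eta_elem n = \<Union>(interval_of ` set (list_decode n))"

definition B_eta_code :: "rat set \<Rightarrow> nat" where
  "B_eta_code X = (LEAST n. B_eta_elem n = X)"

lemma range_interval_of: "range interval_of = half_open_intervals"
proof
  show "range interval_of \<subseteq> half_open_intervals"
  proof clarify
    fix k
    obtain l r where "prod_decode k = (l, r)" by (cases "prod_decode k")
    then have "interval_of k =
      (case l of 0 \<Rightarrow> (case r of 0 \<Rightarrow> UNIV | Suc n \<Rightarrow> {..<nat_to_rat_surj n})
        | Suc m \<Rightarrow> (case r of 0 \<Rightarrow> {nat_to_rat_surj m..}
             | Suc n \<Rightarrow> {nat_to_rat_surj m..<nat_to_rat_surj n}))" (is "_ = ?I")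
      by (simp add: interval_of_def atLeastLessThan_def split: nat.split)
    moreover have "?I \<in> half_open_intervals"
      unfolding half_open_intervals_def by (cases l; cases r) auto
    ultimately show "interval_of k \<in> half_open_intervals" by simp
  qed
  have code: "\<exists>n. q = nat_to_rat_surj n" for q
    using surj_nat_to_rat_surj by (auto simp: surj_def)
  show "half_open_intervals \<subseteq> range interval_of"
  proof
    fix I assume "I \<in> half_open_intervals"
    then consider (1) a b where "I = {a..<b}" | (2) a where "I = {a..}" | (3) b where "I = {..<b}"
      | (4) "I = UNIV"
      by (auto simp: half_open_intervals_def)
    then show "I \<in> range interval_of"
    proof cases
      case 1
      from code obtain m n where "a = nat_to_rat_surj m" "b = nat_to_rat_surj n" by metis
      with 1 show ?thesis
        by (intro range_eqI[of _ _ "prod_encode (Suc m, Suc n)"]) (auto simp: interval_of_def)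
    next
      case 2
      from code obtain m where "a = nat_to_rat_surj m" by metis
      with 2 show ?thesis
        by (intro range_eqI[of _ _ "prod_encode (Suc m, 0)"]) (auto simp: interval_of_def)
    next
      case 3
      from code obtain n where "b = nat_to_rat_surj n" by metis
      with 3 show ?thesis
        by (intro range_eqI[of _ _ "prod_encode (0, Suc n)"]) (auto simp: interval_of_def)
    next
      case 4
      then show ?thesis
        by (intro range_eqI[of _ _ "prod_encode (0, 0)"]) (auto simp: interval_of_def)
    qed
  qed
qed

lemma range_B_eta_elem: "range B_eta_elem = B_eta"
proof
  show "range B_eta_elem \<subseteq> B_eta"
    unfolding B_eta_elem_def B_eta_def range_interval_of[symmetric] by blast
  show "B_eta \<subseteq> range B_eta_elem"
  proof
    fix X assume "X \<in> B_eta"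
    then obtain \<I> where X: "X = \<Union>\<I>" "finite \<I>" "\<I> \<subseteq> range interval_of"
      unfolding B_eta_def range_interval_of by blast
    then obtain K where "finite K" "\<I> = interval_of ` K"
      by (meson finite_subset_image)
    moreover from \<open>finite K\<close> obtain ks where "set ks = K" by (meson finite_list)
    ultimately have "X = B_eta_elem (list_encode ks)"
      using X by (simp add: B_eta_elem_def)
    then show "X \<in> range B_eta_elem" by blast
  qed
qed

lemma inj_on_B_eta_code: "inj_on B_eta_code B_eta"
proof (rule inj_on_inverseI[where g = B_eta_elem])
  fix X assume "X \<in> B_eta"
  then obtain n where "B_eta_elem n = X"
    unfolding range_B_eta_elem[symmetric] by (auto elim: rangeE)
  then show "B_eta_elem (B_eta_code X) = X"
    unfolding B_eta_code_def by (rule LeastI)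
qed

definition boolean_hom_on :: "'a set set \<Rightarrow> ('a set \<Rightarrow> 'a set) \<Rightarrow> bool" where
  "boolean_hom_on B f \<longleftrightarrow> f {} = {} \<and> f UNIV = UNIV \<and> (\<forall>X\<in>B. f (- X) = - f X) \<and>
     (\<forall>X\<in>B. \<forall>Y\<in>B. f (X \<union> Y) = f X \<union> f Y \<and> f (X \<inter> Y) = f X \<inter> f Y)"

definition Aut_B_eta :: "turing_degree \<Rightarrow> (rat set \<Rightarrow> rat set) monoid" where
  "Aut_B_eta d = (BijGroup B_eta)
     \<lparr>carrier := {f \<in> Bij B_eta. boolean_hom_on B_eta f \<and> fun_degree B_eta_code B_eta f \<le> d}\<rparr>"

end

(*
  Let D have degree d and let G be one of the two groups.

  Upper bound. An element of G acts faithfully on natural numbers by a D-computable function.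
  Whether e is a D-index of an element of G, whether two such indices name the same element, and
  whether one names the product of two others are Boolean combinations of Pi_2 statements over D.
  The least indices of the elements therefore form a copy of G computable in D''.

  Lower bound. The D-computable permutations of the natural numbers embed into G: they permute the
  standard basis, respectively the intervals [n, n+1). Membership of e in D'' amounts to finiteness
  of a D-computable set S_e. From three fixed permutations, group words produce, uniformly in e
  and N, a product of disjoint 3-cycles indexed by the elements of S_e above N. S_e is finite iff
  such a word has the value 1 for some N. It is infinite iff the word with N = 0 is conjugate in G
  to a fixed product r of infinitely many 3-cycles that also has infinitely many fixed points,
  because G conjugates no permutation of finite support to r. So D'' and its complement are
  existentially definable in every copy of G.
*)

theory Submission
  imports Defs "HOL-Library.Infinite_Set"
begin

section \<open>Functions computable relative to an oracle\<close>

text \<open>An isomorphism onto a copy need not be effective, so a procedure that uses the copy can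
  have only finitely many elements built in. One permutation \<open>p\<close> must therefore store
  the sets \<open>S_e\<close>, cut off at every \<open>N\<close>. It consists of transpositions in
  blocks of three points. The blocks form columns indexed by the integers, with a column for each
  pair of \<open>e\<close> and \<open>N\<close>; a shift of columns, bijective because there are
  negative columns too, brings any of them to column 0 by conjugation. The commutator with
  \<open>r\<close>, a product of 3-cycles in the blocks of column 0, erases all other columns, since
  permutations acting in different blocks commute. In the symmetric group on three points the
  commutator of a transposition and a 3-cycle is a 3-cycle: this is why blocks have three points,
  and why the result can have the cycle type of \<open>r\<close>. For the upper bound both groups
  are brought into one form: all \<open>D\<close>-computable bijections of a decidable set of
  numbers that preserve a relation \<open>K\<close> on finite tuples. Checking an index then takes
  universal quantifiers over conditions that the jump of \<open>D\<close> decides.\<close>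

definition comp_in :: "nat set \<Rightarrow> (nat \<Rightarrow> nat) \<Rightarrow> bool" where
  "comp_in A f \<longleftrightarrow> (\<exists>p. \<forall>x. eval A p [x] (f x))"

definition comp2_in :: "nat set \<Rightarrow> (nat \<Rightarrow> nat \<Rightarrow> nat) \<Rightarrow> bool" where
  "comp2_in A h \<longleftrightarrow> (\<exists>p. \<forall>x y. eval A p [x, y] (h x y))"

definition dec_in :: "nat set \<Rightarrow> (nat \<Rightarrow> bool) \<Rightarrow> bool" where
  "dec_in A P \<longleftrightarrow> comp_in A (\<lambda>x. of_bool (P x))"

abbreviation pfst :: "nat \<Rightarrow> nat" where "pfst z \<equiv> fst (prod_decode z)"
abbreviation psnd :: "nat \<Rightarrow> nat" where "psnd z \<equiv> snd (prod_decode z)"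

lemma turing_le_iff_dec: "turing_le B A \<longleftrightarrow> dec_in A (\<lambda>x. x \<in> B)"
  unfolding turing_le_def dec_in_def comp_in_def of_bool_def ..

lemma eval_Comp1: "eval A g xs y \<Longrightarrow> eval A f [y] z \<Longrightarrow> eval A (Comp f [g]) xs z"
  by (rule eval.Comp[where ys = "[y]"]) simp_all

lemma eval_Comp2: "eval A g xs y \<Longrightarrow> eval A h xs z \<Longrightarrow> eval A f [y, z] w \<Longrightarrow> eval A (Comp f [g, h]) xs w"
  by (rule eval.Comp[where ys = "[y, z]"]) simp_all

lemma eval_Proj: "i < length xs \<Longrightarrow> y = xs ! i \<Longrightarrow> eval A (Proj i) xs y"
  by (auto intro: eval.Proj)

lemma eval_PrimRec:
  assumes "eval A f xs (F 0)" "\<And>n. eval A g (n # F n # xs) (F (Suc n))"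
  shows "eval A (PrimRec f g) (n # xs) (F n)"
  by (induction n) (auto intro: eval.intros assms)

text \<open>Minimisation succeeds at a zero and demands positive values before it, so the program
  searched has to compute the negation of \<open>P\<close>.\<close>

lemma eval_Minim:
  assumes "\<And>n. eval A f (n # xs) (of_bool (\<not> P n))" "\<exists>n. P n"
  shows "eval A (Minim f) xs (LEAST n. P n)"
proof (rule eval.Minim)
  from assms(2) have "P (LEAST n. P n)" by (rule LeastI_ex)
  with assms(1)[of "LEAST n. P n"] show "eval A f ((LEAST n. P n) # xs) 0" by simp
  show "\<forall>m<LEAST n. P n. \<exists>k. eval A f (m # xs) (Suc k)"
  proof (intro allI impI)
    fix m assume "m < (LEAST n. P n)"
    then have "\<not> P m" by (rule not_less_Least)
    with assms(1)[of m] show "\<exists>k. eval A f (m # xs) (Suc k)" by auto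
  qed
qed

lemma comp_in_id: "comp_in A (\<lambda>x. x)"
  unfolding comp_in_def by (rule exI[of _ "Proj 0"]) (auto intro: eval_Proj)

lemma comp_in_comp:
  assumes "comp_in A f" "comp_in A g" shows "comp_in A (\<lambda>x. f (g x))"
proof -
  from assms obtain p q where "\<forall>x. eval A p [x] (f x)" "\<forall>x. eval A q [x] (g x)"
    unfolding comp_in_def by blast
  then have "eval A (Comp p [q]) [x] (f (g x))" for x by (blast intro: eval_Comp1)
  then show ?thesis unfolding comp_in_def by blast
qed

lemma comp2_in_comp:
  assumes "comp2_in A h" "comp_in A f" "comp_in A g" shows "comp_in A (\<lambda>x. h (f x) (g x))"
proof -
  from assms obtain p q r where "\<forall>x y. eval A p [x, y] (h x y)" "\<forall>x. eval A q [x] (f x)" "\<forall>x. eval A r [x] (g x)"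
    unfolding comp_in_def comp2_in_def by blast
  then have "eval A (Comp p [q, r]) [x] (h (f x) (g x))" for x by (blast intro: eval_Comp2)
  then show ?thesis unfolding comp_in_def by blast
qed

lemma comp_in_Suc0: "comp_in A Suc"
  unfolding comp_in_def by (rule exI[of _ "Succ"]) (auto intro: eval.Succ)

lemmas comp_in_Suc = comp_in_comp[OF comp_in_Suc0]

lemma comp_in_const: "comp_in A (\<lambda>x. c)"
proof (induction c)
  case 0
  show ?case unfolding comp_in_def by (rule exI[of _ "Zero"]) (auto intro: eval.Zero)
next
  case (Suc c)
  then show ?case by (rule comp_in_Suc)
qed

lemma comp2_in_add: "comp2_in A (+)"
proof -
  have "eval A (PrimRec (Proj 0) (Comp Succ [Proj 1])) [x, y] (x + y)" for x y
    by (rule eval_PrimRec[where F = "\<lambda>n. n + y"]) (auto intro!: eval_Proj eval_Comp1 eval.Succ)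
  then show ?thesis unfolding comp2_in_def by blast
qed

lemma comp2_in_mult: "comp2_in A (*)"
proof -
  obtain p where p: "\<forall>x y. eval A p [x, y] (x + y)" using comp2_in_add unfolding comp2_in_def by blast
  have "eval A (PrimRec Zero (Comp p [Proj 2, Proj 1])) [x, y] (x * y)" for x y
    by (rule eval_PrimRec[where F = "\<lambda>n. n * y"]) (auto intro!: eval_Proj eval_Comp2 eval.Zero p[rule_format])
  then show ?thesis unfolding comp2_in_def by blast
qed

lemma comp2_in_diff: "comp2_in A (-)"
proof -
  have pr: "eval A (PrimRec Zero (Proj 0)) [n] (n - 1)" for n
    by (rule eval_PrimRec) (auto intro!: eval_Proj eval.Zero)
  have "eval A (PrimRec (Proj 0) (Comp (PrimRec Zero (Proj 0)) [Proj 1])) [n, x] (x - n)" for x n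
  proof (rule eval_PrimRec[where F = "\<lambda>n. x - n"])
    fix n
    show "eval A (Comp (PrimRec Zero (Proj 0)) [Proj 1]) (n # (x - n) # [x]) (x - Suc n)"
      using pr[of "x - n"] by (auto intro!: eval_Comp1 eval_Proj)
  qed (auto intro: eval_Proj)
  \<comment> \<open>Recursion runs on the first argument, so the subtrahend had to come first; the
    outer composition restores the order.\<close>
  then have "eval A (Comp (PrimRec (Proj 0) (Comp (PrimRec Zero (Proj 0)) [Proj 1])) [Proj 1, Proj 0]) [x, n] (x - n)" for x n
    by (auto intro!: eval_Comp2 eval_Proj)
  then show ?thesis unfolding comp2_in_def by blast
qed

lemmas comp_in_add = comp2_in_comp[OF comp2_in_add]
lemmas comp_in_mult = comp2_in_comp[OF comp2_in_mult]
lemmas comp_in_diff = comp2_in_comp[OF comp2_in_diff]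

lemma comp_in_nat_rec:
  assumes "comp2_in A h" shows "comp_in A (rec_nat c h)"
proof -
  obtain p where p: "\<forall>x y. eval A p [x, y] (h x y)" using assms unfolding comp2_in_def by blast
  obtain q where q: "\<forall>x. eval A q [x] c" using comp_in_const[of A c] unfolding comp_in_def by blast
  \<comment> \<open>The base program receives the parameter list, which is empty here, so the
    constant must be available without arguments.\<close>
  have q': "eval A (Comp q [Zero]) [] c" using q by (auto intro!: eval_Comp1 eval.Zero)
  have "eval A (PrimRec (Comp q [Zero]) p) [n] (rec_nat c h n)" for n
    by (rule eval_PrimRec[where F = "rec_nat c h"]) (auto intro!: q' p[rule_format])
  then show ?thesis unfolding comp_in_def by blast
qed

lemma comp_in_triangle: "comp_in A triangle"
proof -
  obtain p where p: "\<forall>x y. eval A p [x, y] (x + y)" using comp2_in_add unfolding comp2_in_def by blast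
  have t: "eval A p [triangle n, Suc n] (triangle (Suc n))" for n
    using p[rule_format, of "triangle n" "Suc n"] by simp
  have "eval A (PrimRec Zero (Comp p [Proj 1, Comp Succ [Proj 0]])) [n] (triangle n)" for n
    by (rule eval_PrimRec[where F = triangle])
      (auto intro!: eval_Proj eval_Comp2 eval_Comp1 eval.Zero eval.Succ t simp del: triangle_Suc)
  then show ?thesis unfolding comp_in_def by blast
qed

lemma comp2_in_pair: "comp2_in A (\<lambda>x y. prod_encode (x, y))"
proof -
  obtain p where p: "\<forall>x y. eval A p [x, y] (x + y)" using comp2_in_add unfolding comp2_in_def by blast
  obtain t where t: "\<forall>x. eval A t [x] (triangle x)" using comp_in_triangle unfolding comp_in_def by blast
  have "eval A (Comp p [Comp t [p], Proj 0]) [x, y] (prod_encode (x, y))" for x y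
    by (auto simp: prod_encode_def intro!: eval_Proj eval_Comp2 eval_Comp1 p[rule_format] t[rule_format])
  then show ?thesis unfolding comp2_in_def by blast
qed

lemmas comp_in_pair = comp2_in_comp[OF comp2_in_pair]

lemma dec_in_le: "comp_in A f \<Longrightarrow> comp_in A g \<Longrightarrow> dec_in A (\<lambda>x. f x \<le> g x)"
proof -
  assume "comp_in A f" "comp_in A g"
  then have "comp_in A (\<lambda>x. 1 - (f x - g x))" by (intro comp_in_diff comp_in_const)
  moreover have "(\<lambda>x. 1 - (f x - g x)) = (\<lambda>x. of_bool (f x \<le> g x))" by (auto simp: fun_eq_iff)
  ultimately show ?thesis unfolding dec_in_def by simp
qed

lemma dec_in_not: "dec_in A P \<Longrightarrow> dec_in A (\<lambda>x. \<not> P x)"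
proof -
  assume "dec_in A P"
  then have "comp_in A (\<lambda>x. 1 - of_bool (P x))" unfolding dec_in_def by (intro comp_in_diff comp_in_const)
  moreover have "(\<lambda>x. 1 - of_bool (P x) :: nat) = (\<lambda>x. of_bool (\<not> P x))" by (auto simp: fun_eq_iff)
  ultimately show ?thesis unfolding dec_in_def by simp
qed

lemma dec_in_conj: "dec_in A P \<Longrightarrow> dec_in A Q \<Longrightarrow> dec_in A (\<lambda>x. P x \<and> Q x)"
proof -
  assume "dec_in A P" "dec_in A Q"
  then have "comp_in A (\<lambda>x. of_bool (P x) * of_bool (Q x))" unfolding dec_in_def by (intro comp_in_mult)
  then show ?thesis unfolding dec_in_def of_bool_conj by simp
qed

lemma dec_in_disj: "dec_in A P \<Longrightarrow> dec_in A Q \<Longrightarrow> dec_in A (\<lambda>x. P x \<or> Q x)"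
  using dec_in_not[OF dec_in_conj[OF dec_in_not dec_in_not], of A P Q] by simp

lemma dec_in_imp: "dec_in A P \<Longrightarrow> dec_in A Q \<Longrightarrow> dec_in A (\<lambda>x. P x \<longrightarrow> Q x)"
  unfolding imp_conv_disj by (intro dec_in_disj dec_in_not)

lemma dec_in_iff: "dec_in A P \<Longrightarrow> dec_in A Q \<Longrightarrow> dec_in A (\<lambda>x. P x \<longleftrightarrow> Q x)"
  unfolding iff_conv_conj_imp by (intro dec_in_conj dec_in_imp)

lemma dec_in_eq: "comp_in A f \<Longrightarrow> comp_in A g \<Longrightarrow> dec_in A (\<lambda>x. f x = g x)"
  unfolding eq_iff by (intro dec_in_conj dec_in_le)

lemma dec_in_less: "comp_in A f \<Longrightarrow> comp_in A g \<Longrightarrow> dec_in A (\<lambda>x. f x < g x)"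
  unfolding not_le[symmetric] by (intro dec_in_not dec_in_le)

lemma dec_in_const: "dec_in A (\<lambda>x. c)"
  unfolding dec_in_def by (rule comp_in_const)

lemma comp_in_of_bool: "dec_in A P \<Longrightarrow> comp_in A (\<lambda>x. of_bool (P x))"
  unfolding dec_in_def .

lemma comp_in_if: "dec_in A P \<Longrightarrow> comp_in A f \<Longrightarrow> comp_in A g \<Longrightarrow> comp_in A (\<lambda>x. if P x then f x else g x)"
proof -
  assume "dec_in A P" "comp_in A f" "comp_in A g"
  then have "comp_in A (\<lambda>x. of_bool (P x) * f x + of_bool (\<not> P x) * g x)"
    by (intro comp_in_add comp_in_mult comp_in_of_bool dec_in_not)
  moreover have "(\<lambda>x. of_bool (P x) * f x + of_bool (\<not> P x) * g x) = (\<lambda>x. if P x then f x else g x)"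
    by (auto simp: fun_eq_iff)
  ultimately show ?thesis by simp
qed

lemma dec_in_if: "dec_in A P \<Longrightarrow> dec_in A Q \<Longrightarrow> dec_in A R \<Longrightarrow> dec_in A (\<lambda>x. if P x then Q x else R x)"
  unfolding if_bool_eq_conj by (intro dec_in_conj dec_in_imp dec_in_not)

section \<open>The inverse of the pairing function\<close>

definition diag_index :: "nat \<Rightarrow> nat" where
  "diag_index = rec_nat 0 (\<lambda>n s. if triangle (Suc s) \<le> Suc n then Suc s else s)"

text \<open>Passing from \<open>z\<close> to \<open>Suc z\<close> either stays on the same diagonal
  of Cantor's pairing or enters the next one, so a counter that is raised whenever the next
  triangular number is reached stays correct.\<close>

lemma diag_index_less: "triangle (diag_index z) \<le> z \<and> z < triangle (Suc (diag_index z))"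
  by (induction z) (auto simp: diag_index_def)

lemma triangle_mono: "m \<le> n \<Longrightarrow> triangle m \<le> triangle n"
  by (induction n) (auto simp: le_Suc_eq)

lemma diag_index_prod_encode: "diag_index (prod_encode (a, b)) = a + b"
proof -
  have 1: "triangle (a + b) \<le> prod_encode (a, b)" "prod_encode (a, b) < triangle (Suc (a + b))"
    by (auto simp: prod_encode_def)
  note 2 = diag_index_less[of "prod_encode (a, b)"]
  show ?thesis
  proof (rule linorder_cases)
    assume "diag_index (prod_encode (a, b)) < a + b"
    then show ?thesis using triangle_mono[of "Suc (diag_index (prod_encode (a, b)))" "a + b"] 1 2 by linarith
  next
    assume "a + b < diag_index (prod_encode (a, b))"
    then show ?thesis using triangle_mono[of "Suc (a + b)" "diag_index (prod_encode (a, b))"] 1 2 by linarith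
  qed
qed

lemma pfst_psnd_diag_index:
  "pfst z = z - triangle (diag_index z)" "psnd z = diag_index z - pfst z"
proof -
  obtain a b where "prod_decode z = (a, b)" by (cases "prod_decode z")
  then have z: "z = prod_encode (a, b)" by (metis prod_decode_inverse)
  have "z = triangle (a + b) + a" unfolding z by (simp add: prod_encode_def)
  moreover have "diag_index z = a + b" unfolding z by (rule diag_index_prod_encode)
  moreover have "prod_decode z = (a, b)" unfolding z by simp
  ultimately show "pfst z = z - triangle (diag_index z)" "psnd z = diag_index z - pfst z"
    by (metis fst_conv diff_add_inverse, metis fst_conv snd_conv diff_add_inverse)
qed

lemma comp2_in_comp1:
  assumes "comp_in A f" "comp2_in A h" shows "comp2_in A (\<lambda>x y. f (h x y))"
proof -
  from assms obtain p q where "\<forall>x. eval A p [x] (f x)" "\<forall>x y. eval A q [x, y] (h x y)"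
    unfolding comp_in_def comp2_in_def by blast
  then have "eval A (Comp p [q]) [x, y] (f (h x y))" for x y by (auto intro: eval_Comp1)
  then show ?thesis unfolding comp2_in_def by blast
qed

lemma comp2_in_comp2:
  assumes "comp2_in A f" "comp2_in A g" "comp2_in A h" shows "comp2_in A (\<lambda>x y. f (g x y) (h x y))"
proof -
  from assms obtain p q r where "\<forall>x y. eval A p [x, y] (f x y)" "\<forall>x y. eval A q [x, y] (g x y)"
    "\<forall>x y. eval A r [x, y] (h x y)"
    unfolding comp2_in_def by metis
  then have "eval A (Comp p [q, r]) [x, y] (f (g x y) (h x y))" for x y
    by (intro eval_Comp2[of A q _ "g x y" r "h x y"]) auto
  then show ?thesis unfolding comp2_in_def by blast
qed

lemma comp2_in_proj: "comp2_in A (\<lambda>x y. x)" "comp2_in A (\<lambda>x y. y)"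
  unfolding comp2_in_def by (rule exI[of _ "Proj 0"] exI[of _ "Proj 1"], auto intro: eval_Proj)+

lemma comp2_in_const: "comp2_in A (\<lambda>x y. c)"
  using comp2_in_comp1[OF comp_in_const comp2_in_proj(1)] .

lemma comp_in_diag_index: "comp_in A diag_index"
proof -
  have "comp2_in A (\<lambda>n s. s + (1 - (triangle (Suc s) - Suc n)))"
    by (intro comp2_in_comp2[OF comp2_in_add] comp2_in_comp2[OF comp2_in_diff] comp2_in_comp1[OF comp_in_Suc0]
        comp2_in_comp1[OF comp_in_triangle] comp2_in_const comp2_in_proj)
  moreover have "(\<lambda>n s. s + (1 - (triangle (Suc s) - Suc n))) = (\<lambda>n s. if triangle (Suc s) \<le> Suc n then Suc s else s)"
    by (auto simp: fun_eq_iff simp del: triangle_Suc)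
  ultimately show ?thesis unfolding diag_index_def by (auto intro: comp_in_nat_rec)
qed

lemma comp_in_pfst: "comp_in A f \<Longrightarrow> comp_in A (\<lambda>x. pfst (f x))"
  unfolding pfst_psnd_diag_index(1)
  by (intro comp_in_diff comp_in_comp[OF comp_in_triangle] comp_in_comp[OF comp_in_diag_index])

lemma comp_in_psnd: "comp_in A f \<Longrightarrow> comp_in A (\<lambda>x. psnd (f x))"
  unfolding pfst_psnd_diag_index(2)
  by (intro comp_in_diff comp_in_pfst comp_in_comp[OF comp_in_diag_index])

text \<open>From here on functions and predicates are mostly unary and carry several arguments
  packed into pairs; the step function of a recursion receives parameter, counter and previous value
  as one nested pair.\<close>

lemma comp_in_rec:
  assumes "comp_in A g" "comp_in A (\<lambda>z. h (pfst z) (pfst (psnd z)) (psnd (psnd z)))" "comp_in A f"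
  shows "comp_in A (\<lambda>x. rec_nat (g x) (h x) (f x))"
proof -
  from assms obtain p q r where p: "\<forall>x. eval A p [x] (g x)" and r: "\<forall>x. eval A r [x] (f x)"
    and q: "\<forall>z. eval A q [z] (h (pfst z) (pfst (psnd z)) (psnd (psnd z)))"
    unfolding comp_in_def by blast
  obtain e where e: "\<forall>x y. eval A e [x, y] (prod_encode (x, y))"
    using comp2_in_pair unfolding comp2_in_def by blast
  have "eval A (PrimRec p (Comp q [Comp e [Proj 2, Comp e [Proj 0, Proj 1]]])) (n # [x]) (rec_nat (g x) (h x) n)" for n x
  proof (rule eval_PrimRec)
    show "eval A p [x] (rec_nat (g x) (h x) 0)" using p by simp
    fix n
    have "eval A (Comp e [Proj 2, Comp e [Proj 0, Proj 1]]) [n, r, x] (prod_encode (x, prod_encode (n, r)))" for r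
      by (auto intro!: eval_Proj eval_Comp2 e[rule_format])
    from eval_Comp1[OF this q[rule_format]]
    show "eval A (Comp q [Comp e [Proj 2, Comp e [Proj 0, Proj 1]]]) (n # rec_nat (g x) (h x) n # [x]) (rec_nat (g x) (h x) (Suc n))"
      by simp
  qed
  then have "eval A (Comp (PrimRec p (Comp q [Comp e [Proj 2, Comp e [Proj 0, Proj 1]]])) [r, Proj 0]) [x] (rec_nat (g x) (h x) (f x))" for x
    by (auto intro!: eval_Comp2 eval_Proj r[rule_format])
  then show ?thesis unfolding comp_in_def by blast
qed

lemma dec_in_program:
  "dec_in A P \<Longrightarrow> \<exists>p. \<forall>x. eval A p [x] (of_bool (P x))"
  unfolding dec_in_def comp_in_def .

lemma search_program:
  assumes "dec_in A (\<lambda>z. P (pfst z) (psnd z))"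
  shows "\<exists>q. \<forall>n x. eval A q [n, x] (of_bool (\<not> P x n))"
proof -
  from dec_in_program[OF dec_in_not[OF assms]] obtain p where p: "\<forall>z. eval A p [z] (of_bool (\<not> P (pfst z) (psnd z)))" by blast
  obtain e where e: "\<forall>x y. eval A e [x, y] (prod_encode (x, y))"
    using comp2_in_pair unfolding comp2_in_def by blast
  have "eval A (Comp p [Comp e [Proj 1, Proj 0]]) [n, x] (of_bool (\<not> P x n))" for x n
  proof -
    have "eval A (Comp e [Proj 1, Proj 0]) [n, x] (prod_encode (x, n))"
      by (auto intro!: eval_Proj eval_Comp2 e[rule_format])
    from eval_Comp1[OF this p[rule_format]] show ?thesis by simp
  qed
  then show ?thesis by blast
qed

lemma comp_in_Least:
  assumes "dec_in A (\<lambda>z. P (pfst z) (psnd z))" "\<And>x. \<exists>y. P x y"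
  shows "comp_in A (\<lambda>x. LEAST y. P x y)"
proof -
  from search_program[where P = P, OF assms(1)] obtain q where "\<forall>n x. eval A q [n, x] (of_bool (\<not> P x n))" by blast
  then have "eval A (Minim q) [x] (LEAST y. P x y)" for x
    using assms(2) by (intro eval_Minim) auto
  then show ?thesis unfolding comp_in_def by blast
qed

lemma dec_in_comp: "dec_in A P \<Longrightarrow> comp_in A f \<Longrightarrow> dec_in A (\<lambda>x. P (f x))"
  unfolding dec_in_def by (rule comp_in_comp)

lemma rec_nat_bex: "rec_nat 0 (\<lambda>n r. if P n then 1 else r) k = of_bool (\<exists>i<k. P i)" for P :: "nat \<Rightarrow> bool"
  by (induction k) (auto simp: less_Suc_eq)

lemma dec_in_bex:
  assumes "dec_in A (\<lambda>z. P (pfst z) (psnd z))" "comp_in A f"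
  shows "dec_in A (\<lambda>x. \<exists>i<f x. P x i)"
  unfolding dec_in_def rec_nat_bex[symmetric]
  using dec_in_comp[OF assms(1), of "\<lambda>z. prod_encode (pfst z, pfst (psnd z))"]
  by (intro comp_in_rec comp_in_const assms(2) comp_in_if)
    (simp_all add: comp_in_pair comp_in_pfst comp_in_psnd comp_in_id)

lemma dec_in_ball:
  assumes "dec_in A (\<lambda>z. P (pfst z) (psnd z))" "comp_in A f"
  shows "dec_in A (\<lambda>x. \<forall>i<f x. P x i)"
  using dec_in_not[OF dec_in_bex[where P = "\<lambda>x i. \<not> P x i", OF dec_in_not]] assms by simp

section \<open>Closure rules, bounded quantifiers, decision by a double search\<close>

named_theorems computable

lemmas [computable] = comp_in_const comp_in_id dec_in_const comp_in_Suc comp_in_add comp_in_mult comp_in_diff comp_in_pair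
  comp_in_pfst comp_in_psnd comp_in_of_bool comp_in_if dec_in_if dec_in_le dec_in_less dec_in_eq
  dec_in_not dec_in_conj dec_in_disj dec_in_imp dec_in_iff dec_in_bex dec_in_ball

lemma dec_in_le_bex [computable]:
  "dec_in A (\<lambda>z. P (pfst z) (psnd z)) \<Longrightarrow> comp_in A f \<Longrightarrow> dec_in A (\<lambda>x. \<exists>i\<le>f x. P x i)"
  unfolding less_Suc_eq_le[symmetric] by (intro computable)

lemma dec_in_le_ball [computable]:
  "dec_in A (\<lambda>z. P (pfst z) (psnd z)) \<Longrightarrow> comp_in A f \<Longrightarrow> dec_in A (\<lambda>x. \<forall>i\<le>f x. P x i)"
  unfolding less_Suc_eq_le[symmetric] by (intro computable)

text \<open>Post's theorem: a single search finds a witness for \<open>P\<close> or for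
  \<open>Q\<close>, and it must terminate. A witness for \<open>Q\<close> excludes \<open>R\<close>,
  hence testing \<open>P\<close> on the number found decides \<open>R\<close>.\<close>

lemma dec_in_Post:
  assumes "dec_in A (\<lambda>z. P (pfst z) (psnd z))" "dec_in A (\<lambda>z. Q (pfst z) (psnd z))"
    and "\<And>x. R x \<longleftrightarrow> (\<exists>y. P x y)" "\<And>x. \<not> R x \<longleftrightarrow> (\<exists>y. Q x y)"
  shows "dec_in A R"
proof -
  let ?L = "\<lambda>x. LEAST y. P x y \<or> Q x y"
  have ex: "\<exists>y. P x y \<or> Q x y" for x using assms(3,4)[of x] by blast
  have L: "comp_in A ?L"
    by (rule comp_in_Least) (use assms(1,2) ex in \<open>auto intro: computable\<close>)
  have "R x \<longleftrightarrow> P x (?L x)" for x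
    using LeastI_ex[OF ex, of x] assms(3,4)[of x] by blast
  then have eq: "R = (\<lambda>x. P x (?L x))" by (rule ext)
  have "dec_in A (\<lambda>x. P x (?L x))"
    using dec_in_comp[OF assms(1), of "\<lambda>x. prod_encode (x, ?L x)"] L by (simp add: computable)
  then show ?thesis by (subst eq)
qed

section \<open>Lists coded by numbers, with entry 0 read beyond the end\<close>

definition nthd :: "nat list \<Rightarrow> nat \<Rightarrow> nat" where
  "nthd xs i = (if i < length xs then xs ! i else 0)"

abbreviation compl_in :: "nat set \<Rightarrow> (nat \<Rightarrow> nat list) \<Rightarrow> bool" where
  "compl_in A L \<equiv> comp_in A (\<lambda>x. list_encode (L x))"

lemma compl_in_list_decode [computable]: "comp_in A f \<Longrightarrow> compl_in A (\<lambda>x. list_decode (f x))"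
  by simp

lemma compl_in_Cons [computable]: "comp_in A f \<Longrightarrow> compl_in A L \<Longrightarrow> compl_in A (\<lambda>x. f x # L x)"
  by (simp add: computable)

text \<open>A nonempty list has the code \<open>Suc\<close> of a pair. The formula also covers the
  empty list, because truncated subtraction leaves 0 and 0 decodes to the pair of zeros.\<close>

lemma list_encode_tl: "list_encode (tl xs) = psnd (list_encode xs - 1)"
proof (cases xs)
  case Nil
  have "prod_decode 0 = (0, 0)" by (simp add: prod_decode_def prod_decode_aux.simps)
  then show ?thesis using Nil by simp
qed simp

lemma compl_in_tl [computable]: "compl_in A L \<Longrightarrow> compl_in A (\<lambda>x. tl (L x))"
  unfolding list_encode_tl by (intro computable)

lemma list_encode_drop: "list_encode (drop n xs) = rec_nat (list_encode xs) (\<lambda>i c. psnd (c - 1)) n"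
proof (induction n)
  case (Suc n)
  have "drop (Suc n) xs = tl (drop n xs)" by (simp add: drop_Suc tl_drop)
  then show ?case using Suc by (simp add: list_encode_tl)
qed simp

lemma compl_in_drop [computable]: "comp_in A f \<Longrightarrow> compl_in A L \<Longrightarrow> compl_in A (\<lambda>x. drop (f x) (L x))"
  unfolding list_encode_drop by (intro comp_in_rec computable)

lemma list_encode_0_iff: "list_encode xs = 0 \<longleftrightarrow> xs = []"
  by (cases xs) auto

lemma length_eq_Least: "length xs = (LEAST n. list_encode (drop n xs) = 0)"
  by (rule Least_equality[symmetric]) (auto simp: list_encode_0_iff)

lemma comp_in_length [computable]:
  assumes "compl_in A L" shows "comp_in A (\<lambda>x. length (L x))"
  unfolding length_eq_Least
proof (rule comp_in_Least)
  have "compl_in A (\<lambda>x. L (pfst x))"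
    using comp_in_comp[OF assms, of pfst] by (simp add: computable)
  then show "dec_in A (\<lambda>z. list_encode (drop (psnd z) (L (pfst z))) = 0)"
    by (intro computable)
  show "\<exists>n. list_encode (drop n (L x)) = 0" for x by (rule exI[of _ "length (L x)"]) simp
qed

lemma nthd_eq: "nthd xs i = (if i < length xs then pfst (list_encode (drop i xs) - 1) else 0)"
  by (auto simp: nthd_def Cons_nth_drop_Suc[symmetric])

lemma comp_in_nthd [computable]: "compl_in A L \<Longrightarrow> comp_in A f \<Longrightarrow> comp_in A (\<lambda>x. nthd (L x) (f x))"
  unfolding nthd_eq by (intro computable)

lemma bex_set_nthd: "(\<exists>y\<in>set xs. P y) \<longleftrightarrow> (\<exists>i<length xs. P (nthd xs i))"
  by (metis in_set_conv_nth nthd_def)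

lemma compl_in_comp: "compl_in A L \<Longrightarrow> comp_in A f \<Longrightarrow> compl_in A (\<lambda>x. L (f x))"
  by (rule comp_in_comp)

lemma dec_in_bex_set [computable]:
  assumes "dec_in A (\<lambda>z. P (pfst z) (psnd z))" and L: "compl_in A L"
  shows "dec_in A (\<lambda>x. \<exists>y\<in>set (L x). P x y)"
proof -
  have L': "compl_in A (\<lambda>z. L (pfst z))" by (rule compl_in_comp[OF L]) (intro computable)
  have "dec_in A (\<lambda>z. P (pfst z) (nthd (L (pfst z)) (psnd z)))"
    using dec_in_comp[OF assms(1), of "\<lambda>z. prod_encode (pfst z, nthd (L (pfst z)) (psnd z))"] L'
    by (simp add: computable)
  then show ?thesis unfolding bex_set_nthd by (intro computable L)
qed

lemma dec_in_ball_set [computable]: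
  "dec_in A (\<lambda>z. P (pfst z) (psnd z)) \<Longrightarrow> compl_in A L \<Longrightarrow> dec_in A (\<lambda>x. \<forall>y\<in>set (L x). P x y)"
  using dec_in_not[OF dec_in_bex_set[where P = "\<lambda>x i. \<not> P x i", OF dec_in_not]] by simp

lemma dec_in_mem [computable]:
  assumes "comp_in A f" "compl_in A L" shows "dec_in A (\<lambda>x. f x \<in> set (L x))"
proof -
  have "dec_in A (\<lambda>x. \<exists>y\<in>set (L x). f x = y)"
    using comp_in_comp[OF assms(1), of pfst] assms(2) by (intro computable) (simp_all add: computable)
  then show ?thesis by simp
qed

text \<open>The recursion carries along the code of the list of all previous values, newest first;
  the value at \<open>y < x\<close> then sits at position \<open>x - Suc y\<close>.\<close>

lemma comp_in_course_of_values:
  assumes G: "comp_in A (\<lambda>z. G (pfst z) (list_decode (psnd z)))"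
    and f: "\<And>x. f x = G x (map f (rev [0..<x]))"
  shows "comp_in A f"
proof -
  let ?H = "\<lambda>x. rec_nat 0 (\<lambda>n r. Suc (prod_encode (G n (list_decode r), r))) x"
  have H: "?H x = list_encode (map f (rev [0..<x]))" for x
    by (induction x) (simp_all flip: f)
  have "comp_in A ?H"
    using comp_in_comp[OF G, of psnd]
    by (intro comp_in_rec computable) (simp_all add: computable)
  then have "comp_in A (\<lambda>x. G x (list_decode (?H x)))"
    using comp_in_comp[OF G, of "\<lambda>x. prod_encode (x, ?H x)"] by (simp add: computable)
  moreover have "G x (list_decode (?H x)) = f x" for x
    unfolding H using f by simp
  ultimately show ?thesis by simp
qed

lemma nthd_course: "y < x \<Longrightarrow> nthd (map f (rev [0..<x])) (x - Suc y) = f y"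
  by (simp add: nthd_def rev_nth)

section \<open>Certificates of computations\<close>

lemma prod_encode_ge: "b \<le> prod_encode (a, b)" "a \<le> prod_encode (a, b)"
  by (rule le_prod_encode_2 le_prod_encode_1)+

lemma prod_encode_gt: "0 < a \<Longrightarrow> b < prod_encode (a, b)"
  unfolding prod_encode_def using triangle_mono[of "Suc b" "a + b"] by (cases b) auto

lemma mem_list_encode: "x \<in> set xs \<Longrightarrow> x \<le> list_encode xs"
proof (induction xs)
  case (Cons y ys)
  show ?case using Cons prod_encode_ge[where a = y and b = "list_encode ys"] by auto
qed simp

section \<open>Recognising the codes of programs\<close>

definition is_recf_code :: "nat \<Rightarrow> bool" where
  "is_recf_code e \<longleftrightarrow> (\<exists>f. recf_code f = e)"

lemma prod_encode_eq_iff: "prod_encode (a, b) = e \<longleftrightarrow> a = pfst e \<and> b = psnd e"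
  by (metis fst_conv prod.collapse prod_decode_inverse prod_encode_inverse snd_conv)

lemma ex_map_recf_code: "(\<exists>gs. map recf_code gs = cs) \<longleftrightarrow> (\<forall>c\<in>set cs. is_recf_code c)"
  using ex_map_conv[of cs recf_code] by (auto simp: is_recf_code_def)

text \<open>In this unfolding every recursive call concerns a component of \<open>e\<close>, which
  opens the way to course-of-values recursion. The tags 0, 1 and 3 also require the dummy second
  component 0.\<close>

lemma is_recf_code_iff:
  "is_recf_code e \<longleftrightarrow> (let t = pfst e; b = psnd e in
     (t = 0 \<or> t = 1 \<or> t = 3) \<and> b = 0 \<or> t = 2 \<or>
     t = 4 \<and> is_recf_code (pfst b) \<and> (\<forall>c\<in>set (list_decode (psnd b)). is_recf_code c) \<or>
     t = 5 \<and> is_recf_code (pfst b) \<and> is_recf_code (psnd b) \<or> t = 6 \<and> is_recf_code b)"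
  (is "_ \<longleftrightarrow> ?R")
proof
  assume "is_recf_code e"
  then obtain f where f: "recf_code f = e" unfolding is_recf_code_def by blast
  show ?R
    unfolding f[symmetric] Let_def by (cases f) (auto simp: is_recf_code_def)
next
  have list: "\<exists>gs. map recf_code gs = list_decode c" if "\<forall>c\<in>set (list_decode c). is_recf_code c" for c
    using that ex_map_recf_code by blast
  let ?t = "pfst e" and ?b = "psnd e"
  assume ?R
  then consider "?t = 0" "?b = 0" | "?t = 1" "?b = 0" | "?t = 3" "?b = 0" | "?t = 2"
    | "?t = 4" "is_recf_code (pfst ?b)" "\<forall>c\<in>set (list_decode (psnd ?b)). is_recf_code c"
    | "?t = 5" "is_recf_code (pfst ?b)" "is_recf_code (psnd ?b)" | "?t = 6" "is_recf_code ?b"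
    by (auto simp: Let_def)
  then show "is_recf_code e"
  proof cases
    case 1 then have "recf_code Zero = e" by (simp add: prod_encode_eq_iff)
    then show ?thesis unfolding is_recf_code_def by blast
  next
    case 2 then have "recf_code Succ = e" by (simp add: prod_encode_eq_iff)
    then show ?thesis unfolding is_recf_code_def by blast
  next
    case 3 then have "recf_code Oracle = e" by (simp add: prod_encode_eq_iff)
    then show ?thesis unfolding is_recf_code_def by blast
  next
    case 4 then have "recf_code (Proj ?b) = e" by (simp add: prod_encode_eq_iff)
    then show ?thesis unfolding is_recf_code_def by blast
  next
    case 5
    from list[OF 5(3)] obtain gs where gs: "map recf_code gs = list_decode (psnd ?b)" by blast
    from 5(2) obtain f where "recf_code f = pfst ?b" unfolding is_recf_code_def by blast
    with 5(1) gs have "recf_code (Comp f gs) = e" by (simp add: prod_encode_eq_iff)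
    then show ?thesis unfolding is_recf_code_def by blast
  next
    case 6
    then obtain f g where "recf_code f = pfst ?b" "recf_code g = psnd ?b" unfolding is_recf_code_def by blast
    with 6(1) have "recf_code (PrimRec f g) = e" by (simp add: prod_encode_eq_iff)
    then show ?thesis unfolding is_recf_code_def by blast
  next
    case 7
    then obtain f where "recf_code f = ?b" unfolding is_recf_code_def by blast
    with 7(1) have "recf_code (Minim f) = e" by (simp add: prod_encode_eq_iff)
    then show ?thesis unfolding is_recf_code_def by blast
  qed
qed

text \<open>Tag 0 must be excluded, since \<open>prod_encode (0, 1) = 1\<close>. This is harmless in
  the recursions below, whose clauses for tag 0 make no recursive call.\<close>

lemma psnd_less: "0 < pfst e \<Longrightarrow> psnd e < e"
  using prod_encode_gt[of "pfst e" "psnd e"] by simp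

lemma pfst_le: "pfst e \<le> e"
  using prod_encode_ge(2)[of "pfst e" "psnd e"] by simp

lemma psnd_le: "psnd e \<le> e"
  using prod_encode_ge(1)[of "psnd e" "pfst e"] by simp

lemma mem_list_decode: "c \<in> set (list_decode n) \<Longrightarrow> c \<le> n"
  using mem_list_encode[of c "list_decode n"] by simp

lemma dec_in_is_recf_code0: "dec_in A is_recf_code"
proof -
  \<comment> \<open>Without the guard \<open>y < x\<close>, truncated subtraction would read
    position 0 for every \<open>y \<ge> x\<close>.\<close>
  define lk :: "nat list \<Rightarrow> nat \<Rightarrow> nat \<Rightarrow> bool" where "lk H x y \<longleftrightarrow> y < x \<and> nthd H (x - Suc y) = 1" for H x y
  define G where "G x H = (let t = pfst x; b = psnd x in
     (t = 0 \<or> t = 1 \<or> t = 3) \<and> b = 0 \<or> t = 2 \<or>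
     t = 4 \<and> lk H x (pfst b) \<and> (\<forall>c\<in>set (list_decode (psnd b)). lk H x c) \<or>
     t = 5 \<and> lk H x (pfst b) \<and> lk H x (psnd b) \<or> t = 6 \<and> lk H x b)" for x H
  have lk: "lk (map (\<lambda>x. of_bool (is_recf_code x)) (rev [0..<x])) x y \<longleftrightarrow> y < x \<and> is_recf_code y" for x y
    unfolding lk_def by (auto simp: nthd_course of_bool_def split: if_splits)
  show ?thesis unfolding dec_in_def
  proof (rule comp_in_course_of_values[where G = "\<lambda>x H. of_bool (G x H)"])
    show "comp_in A (\<lambda>z. of_bool (G (pfst z) (list_decode (psnd z))))"
      unfolding G_def Let_def lk_def by (intro computable)
    fix e
    have b: "0 < pfst e \<Longrightarrow> psnd e < e" "0 < pfst e \<Longrightarrow> pfst (psnd e) < e" "0 < pfst e \<Longrightarrow> psnd (psnd e) < e"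
      "0 < pfst e \<Longrightarrow> c \<in> set (list_decode (psnd (psnd e))) \<Longrightarrow> c < e" for c
      using psnd_less[of e] pfst_le[of "psnd e"] psnd_le[of "psnd e"] mem_list_decode[of c "psnd (psnd e)"]
      by linarith+
    have "is_recf_code e \<longleftrightarrow> G e (map (\<lambda>x. of_bool (is_recf_code x)) (rev [0..<e]))"
    proof (cases "pfst e = 0")
      case True
      show ?thesis unfolding G_def lk is_recf_code_iff[of e] Let_def True by simp
    next
      case False
      have "(\<forall>c\<in>set (list_decode (psnd (psnd e))). is_recf_code c) \<longleftrightarrow>
        (\<forall>c\<in>set (list_decode (psnd (psnd e))). c < e \<and> is_recf_code c)"
        using b(4) False by blast
      moreover have "lk (map (\<lambda>x. of_bool (is_recf_code x)) (rev [0..<e])) e = (\<lambda>y. y < e \<and> is_recf_code y)"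
        using lk by blast
      ultimately show ?thesis unfolding G_def is_recf_code_iff[of e] Let_def
        using b(1-3) False by (simp only: neq0_conv simp_thms)
    qed
    then show "of_bool (is_recf_code e) = of_bool (G e (map (\<lambda>x. of_bool (is_recf_code x)) (rev [0..<e])))"
      by (rule arg_cong)
  qed
qed

lemmas dec_in_is_recf_code [computable] = dec_in_comp[OF dec_in_is_recf_code0]

text \<open>A judgement states that the program with code \<open>e\<close> computes \<open>y\<close> from \<open>xs\<close>. The predicate
  \<open>Q\<close> says which oracle answers are accepted.\<close>

definition judgement :: "nat \<Rightarrow> nat list \<Rightarrow> nat \<Rightarrow> nat" where
  "judgement e xs y = prod_encode (e, prod_encode (list_encode xs, y))"

lemma comp_in_judgement [computable]:
  "comp_in A f \<Longrightarrow> compl_in A L \<Longrightarrow> comp_in A g \<Longrightarrow> comp_in A (\<lambda>x. judgement (f x) (L x) (g x))"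
  unfolding judgement_def by (intro computable)

text \<open>The intermediate results are not searched for among all lists: they are the arguments of
  a judgement \<open>k\<close> on the outer program that itself belongs to \<open>C\<close>. So the
  quantifier is bounded and the predicate decidable.\<close>

definition justified_Comp :: "nat \<Rightarrow> nat list \<Rightarrow> nat \<Rightarrow> nat list \<Rightarrow> bool" where
  "justified_Comp b xs y C \<longleftrightarrow> (\<exists>k\<in>set C. pfst k = pfst b \<and> psnd (psnd k) = y \<and>
     length (list_decode (pfst (psnd k))) = length (list_decode (psnd b)) \<and>
     (\<forall>i<length (list_decode (psnd b)).
        judgement (nthd (list_decode (psnd b)) i) xs (nthd (list_decode (pfst (psnd k))) i) \<in> set C))"

text \<open>The number \<open>prod_encode (5, b)\<close> is the code of the recursion itself; its
  value one step earlier is taken from a judgement in \<open>C\<close>.\<close>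

definition justified_PrimRec :: "nat \<Rightarrow> nat list \<Rightarrow> nat \<Rightarrow> nat list \<Rightarrow> bool" where
  "justified_PrimRec b xs y C \<longleftrightarrow> 0 < length xs \<and>
     (if nthd xs 0 = 0 then judgement (pfst b) (tl xs) y \<in> set C
      else \<exists>k\<in>set C. k = judgement (prod_encode (5, b)) ((nthd xs 0 - 1) # tl xs) (psnd (psnd k)) \<and>
          judgement (psnd b) ((nthd xs 0 - 1) # psnd (psnd k) # tl xs) y \<in> set C)"

definition justified_Minim :: "nat \<Rightarrow> nat list \<Rightarrow> nat \<Rightarrow> nat list \<Rightarrow> bool" where
  "justified_Minim b xs y C \<longleftrightarrow> judgement b (y # xs) 0 \<in> set C \<and>
     (\<forall>m<y. \<exists>k\<in>set C. k = judgement b (m # xs) (psnd (psnd k)) \<and> 0 < psnd (psnd k))"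

text \<open>\<open>Q\<close> is a relation instead of an oracle set, so that certificates can also
  be checked against a finite stage of the jump. Only tag 3, the oracle call, refers to it.\<close>

definition justified :: "(nat \<Rightarrow> nat \<Rightarrow> bool) \<Rightarrow> nat list \<Rightarrow> nat \<Rightarrow> bool" where
  "justified Q C j = (let t = pfst (pfst j); b = psnd (pfst j);
       xs = list_decode (pfst (psnd j)); y = psnd (psnd j) in
     t = 0 \<and> b = 0 \<and> y = 0 \<or>
     t = 1 \<and> b = 0 \<and> length xs = 1 \<and> y = Suc (nthd xs 0) \<or>
     t = 2 \<and> b < length xs \<and> y = nthd xs b \<or>
     t = 3 \<and> b = 0 \<and> length xs = 1 \<and> Q (nthd xs 0) y \<or>
     t = 4 \<and> justified_Comp b xs y C \<or>
     t = 5 \<and> justified_PrimRec b xs y C \<or>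
     t = 6 \<and> justified_Minim b xs y C)"

lemma dec_in_tuple4:
  assumes "dec_in A (\<lambda>z. R (pfst z) (list_decode (pfst (psnd z))) (pfst (psnd (psnd z))) (list_decode (psnd (psnd (psnd z)))))"
    "comp_in A b" "compl_in A xs" "comp_in A y" "compl_in A C"
  shows "dec_in A (\<lambda>z. R (b z) (xs z) (y z) (C z))"
  using dec_in_comp[OF assms(1), of "\<lambda>z. prod_encode (b z, prod_encode (list_encode (xs z), prod_encode (y z, list_encode (C z))))"]
    assms(2-) by (simp add: comp_in_pair)

lemma dec_in_justified_Comp0:
  "dec_in A (\<lambda>z. justified_Comp (pfst z) (list_decode (pfst (psnd z))) (pfst (psnd (psnd z))) (list_decode (psnd (psnd (psnd z)))))"
  unfolding justified_Comp_def by (intro computable)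

lemma dec_in_justified_PrimRec0:
  "dec_in A (\<lambda>z. justified_PrimRec (pfst z) (list_decode (pfst (psnd z))) (pfst (psnd (psnd z))) (list_decode (psnd (psnd (psnd z)))))"
  unfolding justified_PrimRec_def by (intro computable)

lemma dec_in_justified_Minim0:
  "dec_in A (\<lambda>z. justified_Minim (pfst z) (list_decode (pfst (psnd z))) (pfst (psnd (psnd z))) (list_decode (psnd (psnd (psnd z)))))"
  unfolding justified_Minim_def by (intro computable)

lemmas [computable] = dec_in_tuple4[OF dec_in_justified_Comp0] dec_in_tuple4[OF dec_in_justified_PrimRec0]
  dec_in_tuple4[OF dec_in_justified_Minim0]

text \<open>Each entry may rest only on entries behind it in the list. This excludes circular
  justifications and lets certificates be concatenated.\<close>

primrec certificate :: "(nat \<Rightarrow> nat \<Rightarrow> bool) \<Rightarrow> nat list \<Rightarrow> bool" where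
  "certificate Q [] \<longleftrightarrow> True"
| "certificate Q (j # C) \<longleftrightarrow> justified Q C j \<and> certificate Q C"

lemma certificate_nthd: "certificate Q C \<longleftrightarrow> (\<forall>i<length C. justified Q (drop (Suc i) C) (nthd C i))"
proof (induction C)
  case (Cons j C)
  have "(\<forall>i<length (j # C). justified Q (drop (Suc i) (j # C)) (nthd (j # C) i)) \<longleftrightarrow>
    justified Q C j \<and> (\<forall>i<length C. justified Q (drop (Suc i) C) (nthd C i))"
    by (auto simp: less_Suc_eq_0_disj nthd_def)
  with Cons show ?case by simp
qed simp

text \<open>\<open>Q\<close> takes a parameter computed from the input, because the stage at which
  the jump is approximated varies with it.\<close>

lemma dec_in_certificate:
  assumes Q: "dec_in A (\<lambda>w. Q (pfst w) (pfst (psnd w)) (psnd (psnd w)))"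
    and "comp_in A q" "compl_in A C"
  shows "dec_in A (\<lambda>x. certificate (Q (q x)) (C x))"
proof -
  have Q': "dec_in A (\<lambda>x. Q (f x) (g x) (h x))" if "comp_in A f" "comp_in A g" "comp_in A h" for f g h
    using dec_in_comp[OF Q, of "\<lambda>x. prod_encode (f x, prod_encode (g x, h x))"] that
    by (simp add: comp_in_pair)
  have "dec_in A (\<lambda>z. justified (Q (pfst z)) (list_decode (pfst (psnd z))) (psnd (psnd z)))"
    unfolding justified_def Let_def by (intro computable Q')
  then have J: "dec_in A (\<lambda>z. justified (Q (f z)) (L z) (g z))" if "comp_in A f" "compl_in A L" "comp_in A g" for f g L
    using dec_in_comp[of A _ "\<lambda>z. prod_encode (f z, prod_encode (list_encode (L z), g z))"] that
    by (fastforce simp: comp_in_pair)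
  have "dec_in A (\<lambda>z. certificate (Q (pfst z)) (list_decode (psnd z)))"
    unfolding certificate_nthd by (intro computable J)
  from dec_in_comp[OF this, of "\<lambda>x. prod_encode (q x, list_encode (C x))"] assms
  show ?thesis by (simp add: comp_in_pair)
qed

text \<open>The list occurs only positively in the clauses.\<close>

lemma justified_mono: "set C \<subseteq> set C' \<Longrightarrow> justified Q C j \<Longrightarrow> justified Q C' j"
  unfolding justified_def Let_def justified_Comp_def justified_PrimRec_def justified_Minim_def
  by (elim disjE) (auto split: if_splits, (blast+)?)

lemma certificate_append: "certificate Q C \<Longrightarrow> certificate Q C' \<Longrightarrow> certificate Q (C @ C')"
  by (induction C) (auto intro: justified_mono[rotated])

lemma certificate_family:
  fixes n :: nat
  assumes "\<forall>i<n. \<exists>C. certificate Q C \<and> J i \<in> set C"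
  shows "\<exists>C. certificate Q C \<and> (\<forall>i<n. J i \<in> set C)"
  using assms
proof (induction n)
  case 0
  show ?case by (rule exI[of _ "[]"]) simp
next
  case (Suc n)
  then obtain C C' where "certificate Q C" "\<forall>i<n. J i \<in> set C" "certificate Q C'" "J n \<in> set C'" by auto
  then show ?case by (intro exI[of _ "C @ C'"]) (auto simp: certificate_append less_Suc_eq)
qed

abbreviation oracle_answer :: "nat set \<Rightarrow> nat \<Rightarrow> nat \<Rightarrow> bool" where
  "oracle_answer A x y \<equiv> y = of_bool (x \<in> A)"

lemma judgement_sel [simp]: "pfst (judgement e xs y) = e" "pfst (psnd (judgement e xs y)) = list_encode xs" "psnd (psnd (judgement e xs y)) = y"
  by (simp_all add: judgement_def)

lemma judgement_collapse: "judgement (pfst k) (list_decode (pfst (psnd k))) (psnd (psnd k)) = k"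
  by (simp add: judgement_def)

text \<open>The clauses of \<open>justified\<close> mirror the rules of \<open>eval\<close>, so
  induction on the list turns each entry into a derivation.\<close>

lemma certificate_sound:
  "certificate (oracle_answer A) C \<Longrightarrow> judgement (recf_code f) xs y \<in> set C \<Longrightarrow> eval A f xs y"
proof (induction C arbitrary: f xs y)
  case (Cons j C)
  have C: "eval A f xs y" if "judgement (recf_code f) xs y \<in> set C" for f xs y
    using Cons that by simp
  show ?case
  proof (cases "judgement (recf_code f) xs y \<in> set C")
    case False
    then have j: "j = judgement (recf_code f) xs y" using Cons.prems by simp
    have J: "justified (oracle_answer A) C j" using Cons.prems by simp
    show ?thesis
    proof (cases f)
      case Zero
      then show ?thesis using J unfolding j justified_def Let_def by (auto intro: eval.Zero)
    next
      case Succ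
      then show ?thesis using J unfolding j justified_def Let_def
        by (auto intro: eval.Succ simp: length_Suc_conv nthd_def)
    next
      case (Proj i)
      then show ?thesis using J unfolding j justified_def Let_def
        by (auto intro: eval.Proj simp: nthd_def)
    next
      case Oracle
      have "x \<in> A \<Longrightarrow> eval A Oracle [x] (Suc 0)" "x \<notin> A \<Longrightarrow> eval A Oracle [x] 0" for x
        using eval.Oracle[of A x] by simp_all
      then show ?thesis using Oracle J unfolding j justified_def Let_def
        by (auto simp: length_Suc_conv nthd_def)
    next
      case (Comp g gs)
      with J obtain k where k: "k \<in> set C" "pfst k = recf_code g" "psnd (psnd k) = y"
        "length (list_decode (pfst (psnd k))) = length gs"
        "\<forall>i<length gs. judgement (recf_code (gs ! i)) xs (nthd (list_decode (pfst (psnd k))) i) \<in> set C"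
        unfolding j justified_def justified_Comp_def Let_def by (auto simp: nthd_def)
      show ?thesis unfolding Comp
      proof (rule eval.Comp)
        show "list_all2 (\<lambda>g. eval A g xs) gs (list_decode (pfst (psnd k)))"
          unfolding list_all2_conv_all_nth using k(4,5) C by (auto simp: nthd_def)
        show "eval A g (list_decode (pfst (psnd k))) y"
          by (rule C) (use k(1-3) judgement_collapse[of k] in simp)
      qed
    next
      case (PrimRec g h)
      with J consider ys where "xs = 0 # ys" "judgement (recf_code g) ys y \<in> set C"
        | n ys r where "xs = Suc n # ys" "judgement (recf_code (PrimRec g h)) (n # ys) r \<in> set C"
           "judgement (recf_code h) (n # r # ys) y \<in> set C"
        unfolding j justified_def justified_PrimRec_def Let_def by (cases xs; cases "hd xs") (auto simp: nthd_def, metis)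
      then show ?thesis unfolding PrimRec
      proof cases
        case base: (1 ys)
        then show "eval A (PrimRec g h) xs y" by (auto intro: eval.PrimRec_0 C)
      next
        case step: (2 n ys r)
        from C[OF step(2)] C[OF step(3)] show "eval A (PrimRec g h) xs y"
          unfolding step(1) by (rule eval.PrimRec_Suc)
      qed
    next
      case (Minim g)
      with J have "judgement (recf_code g) (y # xs) 0 \<in> set C"
        "\<forall>m<y. \<exists>k. judgement (recf_code g) (m # xs) (Suc k) \<in> set C"
        unfolding j justified_def justified_Minim_def Let_def by (auto, metis gr0_implies_Suc)
      then show ?thesis unfolding Minim using C by (intro eval.Minim) blast+
    qed
  qed (rule C)
qed simp

lemma certificate_step:
  assumes "certificate Q C" "justified Q C j"
  shows "\<exists>C. certificate Q C \<and> j \<in> set C"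
  by (rule exI[of _ "j # C"]) (use assms in simp)

text \<open>Certificates for the premises of a rule are concatenated and the conclusion is put in
  front. For minimisation the premises form a family indexed by \<open>m < n\<close>, whose values
  are chosen first.\<close>

lemma certificate_complete:
  "eval A f xs y \<Longrightarrow> \<exists>C. certificate (oracle_answer A) C \<and> judgement (recf_code f) xs y \<in> set C"
proof (induction rule: eval.induct)
  case (Zero xs)
  show ?case by (rule certificate_step[of _ "[]"]) (simp_all add: justified_def)
next
  case (Succ x)
  show ?case by (rule certificate_step[of _ "[]"]) (simp_all add: justified_def nthd_def)
next
  case (Proj i xs)
  then show ?case by (intro certificate_step[of _ "[]"]) (simp_all add: justified_def nthd_def)
next
  case (Oracle x)
  show ?case by (rule certificate_step[of _ "[]"]) (simp_all add: justified_def nthd_def)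
next
  case (Comp xs gs ys f z)
  have len: "length gs = length ys" using Comp.IH(1) by (rule list_all2_lengthD)
  have "\<forall>i<length gs. \<exists>C. certificate (oracle_answer A) C \<and> judgement (recf_code (gs ! i)) xs (ys ! i) \<in> set C"
    using Comp.IH(1) unfolding list_all2_conv_all_nth by blast
  from certificate_family[OF this] obtain C where C: "certificate (oracle_answer A) C"
    "\<forall>i<length gs. judgement (recf_code (gs ! i)) xs (ys ! i) \<in> set C" by blast
  from Comp.IH(2) obtain C' where C': "certificate (oracle_answer A) C'" "judgement (recf_code f) ys z \<in> set C'" by blast
  show ?case
    by (rule certificate_step[OF certificate_append[OF C(1) C'(1)]])
      (use C(2) C'(2) len in \<open>auto simp: justified_def justified_Comp_def nthd_def intro!: bexI[of _ "judgement (recf_code f) ys z"]\<close>)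
next
  case (PrimRec_0 f xs y g)
  then obtain C where "certificate (oracle_answer A) C" "judgement (recf_code f) xs y \<in> set C" by blast
  then show ?case by (intro certificate_step) (auto simp: justified_def justified_PrimRec_def nthd_def)
next
  case (PrimRec_Suc f g n xs r y)
  then obtain C C' where C: "certificate (oracle_answer A) C" "judgement (recf_code (PrimRec f g)) (n # xs) r \<in> set C"
    "certificate (oracle_answer A) C'" "judgement (recf_code g) (n # r # xs) y \<in> set C'" by blast
  show ?case
    by (rule certificate_step[OF certificate_append[OF C(1,3)]])
      (use C(2,4) in \<open>auto simp: justified_def justified_PrimRec_def nthd_def intro!: bexI[of _ "judgement (recf_code (PrimRec f g)) (n # xs) r"]\<close>)
next
  case (Minim f n xs)
  have "\<forall>m<n. \<exists>k. \<exists>C. certificate (oracle_answer A) C \<and> judgement (recf_code f) (m # xs) (Suc k) \<in> set C"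
    using Minim.IH(2) by blast
  then obtain k where "\<forall>m<n. \<exists>C. certificate (oracle_answer A) C \<and> judgement (recf_code f) (m # xs) (Suc (k m)) \<in> set C"
    by metis
  from certificate_family[OF this] obtain C where C: "certificate (oracle_answer A) C"
    "\<forall>m<n. judgement (recf_code f) (m # xs) (Suc (k m)) \<in> set C" by blast
  from Minim.IH(1) obtain C' where C': "certificate (oracle_answer A) C'" "judgement (recf_code f) (n # xs) 0 \<in> set C'" by blast
  have "\<exists>j\<in>set (C @ C'). j = judgement (recf_code f) (m # xs) (psnd (psnd j)) \<and> 0 < psnd (psnd j)" if "m < n" for m
    by (rule bexI[of _ "judgement (recf_code f) (m # xs) (Suc (k m))"]) (use C(2) that in auto)
  then show ?case
    by (intro certificate_step[OF certificate_append[OF C(1) C'(1)]])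
      (use C'(2) in \<open>auto simp: justified_def justified_Minim_def\<close>)
qed

section \<open>Kleene's normal form for indexed computations\<close>

definition app :: "nat set \<Rightarrow> nat \<Rightarrow> nat \<Rightarrow> nat \<Rightarrow> bool" where
  "app A e x y \<longleftrightarrow> (\<exists>f. recf_code f = e \<and> eval A f [x] y)"

definition app_cert :: "(nat \<Rightarrow> nat \<Rightarrow> bool) \<Rightarrow> nat \<Rightarrow> nat \<Rightarrow> nat \<Rightarrow> nat \<Rightarrow> bool" where
  "app_cert Q e x y c \<longleftrightarrow> is_recf_code e \<and> certificate Q (list_decode c) \<and> judgement e [x] y \<in> set (list_decode c)"

lemma app_iff_cert: "app A e x y \<longleftrightarrow> (\<exists>c. app_cert (oracle_answer A) e x y c)"
proof
  assume "app A e x y"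
  then obtain f where f: "recf_code f = e" "eval A f [x] y" unfolding app_def by blast
  from certificate_complete[OF f(2)] obtain C where "certificate (oracle_answer A) C" "judgement e [x] y \<in> set C"
    using f(1) by blast
  then show "\<exists>c. app_cert (oracle_answer A) e x y c"
    using f(1) by (intro exI[of _ "list_encode C"]) (auto simp: app_cert_def is_recf_code_def)
next
  assume "\<exists>c. app_cert (oracle_answer A) e x y c"
  then show "app A e x y" unfolding app_cert_def app_def is_recf_code_def
    using certificate_sound by blast
qed

lemma dec_in_app_cert:
  assumes "dec_in A (\<lambda>w. Q (pfst w) (pfst (psnd w)) (psnd (psnd w)))"
    and "comp_in A q" "comp_in A f" "comp_in A g" "comp_in A h" "comp_in A c"
  shows "dec_in A (\<lambda>x. app_cert (Q (q x)) (f x) (g x) (h x) (c x))"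
  unfolding app_cert_def
  by (intro computable dec_in_certificate[OF assms(1)] assms)

section \<open>The jump\<close>

lemma turing_jump_iff_app: "e \<in> turing_jump A \<longleftrightarrow> (\<exists>y. app A e e y)"
  unfolding turing_jump_def app_def by auto

primrec const_program :: "nat \<Rightarrow> recf" where
  "const_program 0 = Zero"
| "const_program (Suc n) = Comp Succ [const_program n]"

lemma eval_const_program: "eval A (const_program n) xs n"
  by (induction n) (auto intro: eval.Zero eval_Comp1 eval.Succ)

lemma comp_in_const_program: "comp_in A (\<lambda>n. recf_code (const_program n))"
proof -
  let ?h = "\<lambda>n c. prod_encode (4, prod_encode (recf_code Succ, Suc (prod_encode (c, 0))))"
  have "comp_in A (\<lambda>n. rec_nat (recf_code Zero) ?h n)"
    by (intro comp_in_rec computable)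
  moreover have "rec_nat (recf_code Zero) ?h n = recf_code (const_program n)" for n
    by (induction n) simp_all
  ultimately show ?thesis by simp
qed

lemma dec_in_oracle: "comp_in A f \<Longrightarrow> dec_in A (\<lambda>x. f x \<in> A)"
  using turing_le_refl[of A] unfolding turing_le_iff_dec by (rule dec_in_comp)

text \<open>The program with code \<open>g x\<close> ignores its input and searches for a witness on
  the constant \<open>x\<close>. It halts on its own code iff it halts anywhere, which is what the
  diagonal form of the jump asks. Composition with a constant program takes the place of the s-m-n
  theorem.\<close>

lemma dec_in_jump_ex:
  assumes P: "dec_in A (\<lambda>z. P (pfst z) (psnd z))"
  shows "dec_in (turing_jump A) (\<lambda>x. \<exists>y. P x y)"
proof -
  from search_program[where P = P, OF P] obtain q where q: "\<forall>n x. eval A q [n, x] (of_bool (\<not> P x n))" by blast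
  define g where "g x = recf_code (Comp (Minim q) [const_program x])" for x
  have "comp_in (turing_jump A) g"
    unfolding g_def recf_code.simps list.map list_encode.simps
    by (intro computable comp_in_const_program)
  from dec_in_oracle[OF this] have "dec_in (turing_jump A) (\<lambda>x. g x \<in> turing_jump A)" .
  moreover have "g x \<in> turing_jump A \<longleftrightarrow> (\<exists>y. P x y)" for x
  proof
    assume "\<exists>y. P x y"
    then have "eval A (Minim q) [x] (LEAST y. P x y)" using q by (intro eval_Minim) auto
    then have "eval A (Comp (Minim q) [const_program x]) [g x] (LEAST y. P x y)"
      by (rule eval_Comp1[OF eval_const_program])
    then show "g x \<in> turing_jump A" unfolding turing_jump_def g_def by blast
  next
    assume "g x \<in> turing_jump A"
    then obtain f y where "recf_code f = g x" "eval A f [g x] y" unfolding turing_jump_def by blast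
    then have "eval A (Comp (Minim q) [const_program x]) [g x] y"
      using recf_code_inject unfolding g_def by metis
    then obtain z where "eval A (const_program x) [g x] z" "eval A (Minim q) [z] y"
      by (auto elim!: eval_elims(5) simp: list_all2_Cons1)
    with eval_deterministic[OF _ eval_const_program] have "eval A (Minim q) [x] y" by metis
    then have "eval A q [y, x] 0" by (rule eval_elims(8))
    from eval_deterministic[OF this q[rule_format]] have "P x y" by simp
    then show "\<exists>y. P x y" ..
  qed
  ultimately show ?thesis by simp
qed

lemma dec_in_jump_all:
  "dec_in A (\<lambda>z. P (pfst z) (psnd z)) \<Longrightarrow> dec_in (turing_jump A) (\<lambda>x. \<forall>y. P x y)"
  using dec_in_not[OF dec_in_jump_ex[where P = "\<lambda>x y. \<not> P x y", OF dec_in_not]] by simp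

lemma dec_in_jump: "dec_in A P \<Longrightarrow> dec_in (turing_jump A) P"
  using dec_in_jump_ex[where P = "\<lambda>x y. P x", of A, OF dec_in_comp[of A P pfst]] by (simp add: computable)

section \<open>Approximating computations from the jump by stages\<close>

lemma justified_all:
  assumes "\<forall>t. justified (Q t) C j" "\<And>a y. \<forall>t. Q t a y \<Longrightarrow> Q' a y"
  shows "justified Q' C j"
proof (cases "pfst (pfst j) = 3")
  case True
  with assms show ?thesis unfolding justified_def Let_def by simp
next
  case False
  \<comment> \<open>No other clause consults the oracle relation, so one arbitrary instance of
    \<open>t\<close> gives the claim.\<close>
  with assms(1)[rule_format, of undefined] show ?thesis unfolding justified_def Let_def by blast
qed

lemma certificate_all:
  assumes "\<forall>t. certificate (Q t) C" "\<And>a y. \<forall>t. Q t a y \<Longrightarrow> Q' a y"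
  shows "certificate Q' C"
  using assms(1) by (induction C) (auto intro!: justified_all[of Q, OF _ assms(2)])

lemma certificate_mono:
  assumes "certificate Q C" "\<And>j y. j \<in> set C \<Longrightarrow> Q (nthd (list_decode (pfst (psnd j))) 0) y \<Longrightarrow> Q' (nthd (list_decode (pfst (psnd j))) 0) y"
  shows "certificate Q' C"
  using assms by (induction C) (auto simp: justified_def Let_def)

lemma dec_in_oracle_answer:
  "dec_in A (\<lambda>w. oracle_answer A (pfst (psnd w)) (psnd (psnd w)))"
  by (intro computable dec_in_oracle)

lemma dec_in_app_cert_oracle [computable]:
  assumes "comp_in A f" "comp_in A g" "comp_in A h" "comp_in A c"
  shows "dec_in A (\<lambda>x. app_cert (oracle_answer A) (f x) (g x) (h x) (c x))"
  by (rule dec_in_app_cert[where Q = "\<lambda>w. oracle_answer A", OF dec_in_oracle_answer comp_in_const assms])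

text \<open>A halting computation asks its oracle, the jump of \<open>D\<close>, only finitely
  often. The number \<open>z\<close> holds its value, its certificate and a bound for halting
  witnesses of all positive answers; \<open>t\<close> ranges over bounds up to which negative
  answers must withstand refutation.\<close>

lemma double_jump_Sigma2:
  "\<exists>M. dec_in D (\<lambda>w. M (pfst w) (pfst (psnd w)) (psnd (psnd w))) \<and>
     (\<forall>e. e \<in> turing_jump (turing_jump D) \<longleftrightarrow> (\<exists>z. \<forall>t. M e z t))"
proof -
  define h where "h a w \<longleftrightarrow> app_cert (oracle_answer D) a a (pfst w) (psnd w)" for a w
  have h: "a \<in> turing_jump D \<longleftrightarrow> (\<exists>w. h a w)" for a
    unfolding turing_jump_iff_app app_iff_cert h_def by (metis fst_conv prod_encode_inverse snd_conv)
  \<comment> \<open>The two bounds in \<open>st\<close> play different parts: the first is guessed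
    once and for all, the second is quantified universally and pushes negative answers to the
    limit.\<close>
  define Q :: "nat \<Rightarrow> nat \<Rightarrow> nat \<Rightarrow> bool" where "Q st a y \<longleftrightarrow> y = 1 \<and> (\<exists>w\<le>pfst st. h a w) \<or> y = 0 \<and> (\<forall>w\<le>psnd st. \<not> h a w)" for st a y
  define M where "M e z t \<longleftrightarrow>
    app_cert (Q (prod_encode (psnd z, t))) e e (pfst (pfst z)) (psnd (pfst z))" for e z t
  have Q: "dec_in D (\<lambda>w. Q (pfst w) (pfst (psnd w)) (psnd (psnd w)))"
    unfolding Q_def h_def by (intro computable)
  have "dec_in D (\<lambda>w. M (pfst w) (pfst (psnd w)) (psnd (psnd w)))"
    unfolding M_def by (intro computable dec_in_app_cert[OF Q])
  moreover have "e \<in> turing_jump (turing_jump D) \<longleftrightarrow> (\<exists>z. \<forall>t. M e z t)" for e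
  proof
    assume "e \<in> turing_jump (turing_jump D)"
    then obtain y c where yc: "app_cert (oracle_answer (turing_jump D)) e e y c"
      unfolding turing_jump_iff_app[of e] app_iff_cert by blast
    let ?a = "\<lambda>j. nthd (list_decode (pfst (psnd j))) 0"
    let ?w = "\<lambda>j. SOME w. h (?a j) w"
    \<comment> \<open>For a question with negative answer the choice returns an arbitrary number;
      that can only enlarge the bound.\<close>
    define s where "s = Max (insert 0 (?w ` set (list_decode c)))"
    have s: "\<exists>w\<le>s. h (?a j) w" if "j \<in> set (list_decode c)" "?a j \<in> turing_jump D" for j
      using that someI_ex[of "h (?a j)"] unfolding h s_def by (intro exI[of _ "?w j"]) auto
    have "certificate (Q (prod_encode (s, t))) (list_decode c)" for t
    proof (rule certificate_mono)
      show "certificate (oracle_answer (turing_jump D)) (list_decode c)" using yc by (simp add: app_cert_def)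
      fix j y :: nat assume "j \<in> set (list_decode c)" "y = of_bool (?a j \<in> turing_jump D)"
      with s[of j] h[of "?a j"] show "Q (prod_encode (s, t)) (?a j) y" unfolding Q_def by auto
    qed
    then have "M e (prod_encode (prod_encode (y, c), s)) t" for t
      using yc unfolding M_def by (simp add: app_cert_def)
    then show "\<exists>z. \<forall>t. M e z t" by blast
  next
    assume "\<exists>z. \<forall>t. M e z t"
    then obtain z where z: "\<forall>t. M e z t" ..
    have "certificate (oracle_answer (turing_jump D)) (list_decode (psnd (pfst z)))"
    proof (rule certificate_all)
      show "\<forall>t. certificate (Q (prod_encode (psnd z, t))) (list_decode (psnd (pfst z)))"
        using z by (simp add: M_def app_cert_def)
      fix a y :: nat assume *: "\<forall>t. Q (prod_encode (psnd z, t)) a y"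
      show "oracle_answer (turing_jump D) a y"
      proof (cases "\<exists>w. h a w")
        case True
        then obtain w where "h a w" ..
        \<comment> \<open>At the stage \<open>t = w\<close> a negative answer is no longer
          tolerated.\<close>
        with *[rule_format, of w] show ?thesis using True unfolding Q_def h by auto
      next
        case False
        with * show ?thesis unfolding Q_def h by auto
      qed
    qed
    with z have "app_cert (oracle_answer (turing_jump D)) e e (pfst (pfst z)) (psnd (pfst z))"
      by (simp add: M_def app_cert_def)
    then show "e \<in> turing_jump (turing_jump D)"
      unfolding turing_jump_iff_app[of e] app_iff_cert by blast
  qed
  ultimately show ?thesis by blast
qed

text \<open>The pairs \<open>\<langle>n, y\<rangle>\<close> with \<open>y\<close> the stage at which all \<open>z \<le> n\<close> have been refuted are
  infinite in number iff every \<open>z\<close> is refuted.\<close>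

lemma double_jump_finite:
  "\<exists>P. dec_in D (\<lambda>w. P (pfst w) (psnd w)) \<and>
     (\<forall>e. e \<in> turing_jump (turing_jump D) \<longleftrightarrow> finite {y. P e y})"
proof -
  obtain M where M: "dec_in D (\<lambda>w. M (pfst w) (pfst (psnd w)) (psnd (psnd w)))"
    and MD: "\<And>e. e \<in> turing_jump (turing_jump D) \<longleftrightarrow> (\<exists>z. \<forall>t. M e z t)"
    using double_jump_Sigma2[of D] by blast
  have M': "dec_in D (\<lambda>x. M (f x) (g x) (h x))" if "comp_in D f" "comp_in D g" "comp_in D h" for f g h
    using dec_in_comp[OF M, of "\<lambda>x. prod_encode (f x, prod_encode (g x, h x))"] that by (simp add: computable)
  define S where "S e n y \<longleftrightarrow> (\<forall>z\<le>n. \<exists>t\<le>y. \<not> M e z t)" for e n y :: nat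
  \<comment> \<open>Minimality of the stage leaves every \<open>n\<close> at most one pair, so there
    are as many pairs as there are \<open>n\<close> that reach a stage at all.\<close>
  define P where "P e w \<longleftrightarrow> S e (pfst w) (psnd w) \<and> (\<forall>y<psnd w. \<not> S e (pfst w) y)" for e w
  have "dec_in D (\<lambda>w. P (pfst w) (psnd w))"
    unfolding P_def S_def by (intro computable M')
  moreover have "e \<in> turing_jump (turing_jump D) \<longleftrightarrow> finite {y. P e y}" for e
  proof
    assume "e \<in> turing_jump (turing_jump D)"
    then obtain z where z: "\<forall>t. M e z t" unfolding MD by blast
    have "{y. P e y} \<subseteq> (\<lambda>n. prod_encode (n, LEAST y. S e n y)) ` {..<z}"
    proof
      fix w assume "w \<in> {y. P e y}"
      then have w: "S e (pfst w) (psnd w)" "\<forall>y<psnd w. \<not> S e (pfst w) y" unfolding P_def by auto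
      from w(1) z have "pfst w < z" unfolding S_def by (meson not_le)
      moreover have "(LEAST y. S e (pfst w) y) = psnd w"
        using w by (intro Least_equality) (auto simp: not_less[symmetric])
      ultimately show "w \<in> (\<lambda>n. prod_encode (n, LEAST y. S e n y)) ` {..<z}"
        by (intro image_eqI[of _ _ "pfst w"]) auto
    qed
    then show "finite {y. P e y}" by (rule finite_subset) simp
  next
    assume fin: "finite {y. P e y}"
    show "e \<in> turing_jump (turing_jump D)"
    proof (rule ccontr)
      assume "e \<notin> turing_jump (turing_jump D)"
      then have "\<forall>z. \<exists>t. \<not> M e z t" unfolding MD by blast
      then obtain T where T: "\<And>z. \<not> M e z (T z)" by metis
      have ex: "\<exists>y. S e n y" for n
      proof (rule exI[of _ "Max (T ` {..n})"], unfold S_def, intro allI impI)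
        show "\<exists>t\<le>Max (T ` {..n}). \<not> M e z t" if "z \<le> n" for z
          using T[of z] that by (intro exI[of _ "T z"]) auto
      qed
      have "prod_encode (n, LEAST y. S e n y) \<in> {y. P e y}" for n
        unfolding P_def mem_Collect_eq prod_encode_inverse fst_conv snd_conv
        by (intro conjI allI impI LeastI_ex[OF ex] not_less_Least)
      then have "range (\<lambda>n. prod_encode (n, LEAST y. S e n y)) \<subseteq> {y. P e y}" by blast
      then have "finite (range (\<lambda>n. prod_encode (n, LEAST y. S e n y)))" using fin by (rule finite_subset)
      moreover have "inj (\<lambda>n. prod_encode (n, LEAST y. S e n y))" by (rule injI) simp
      ultimately show False using finite_imageD infinite_UNIV_nat by blast
    qed
  qed
  ultimately show ?thesis by blast
qed

section \<open>Permutations of blocks\<close>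

lemma comp_in_div [computable]:
  assumes "comp_in A f" "comp_in A g" shows "comp_in A (\<lambda>x. f x div g x)"
proof -
  \<comment> \<open>The disjunct \<open>b = 0\<close> keeps the search for the quotient
    total.\<close>
  have eq: "a div b = (if b = 0 then 0 else (LEAST q. b = 0 \<or> a < Suc q * b))" for a b :: nat
  proof (cases "b = 0")
    case False
    then have "(LEAST q. b = 0 \<or> a < Suc q * b) = a div b"
      using dividend_less_div_times[of b a] less_mult_imp_div_less[of a "Suc _" b]
      by (intro Least_equality) (auto simp: less_Suc_eq_le)
    then show ?thesis using False by simp
  qed simp
  have L: "comp_in A (\<lambda>z. LEAST q. psnd z = 0 \<or> pfst z < Suc q * psnd z)"
  proof (rule comp_in_Least)
    show "\<exists>q. psnd z = 0 \<or> pfst z < Suc q * psnd z" for z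
      by (rule exI[of _ "pfst z"]) (cases "psnd z"; simp)
  qed (intro computable)
  have "comp_in A (\<lambda>z. pfst z div psnd z)"
    unfolding eq by (intro computable L)
  from comp_in_comp[OF this, of "\<lambda>x. prod_encode (f x, g x)"] assms show ?thesis
    by (simp add: comp_in_pair)
qed

lemma comp_in_mod [computable]:
  "comp_in A f \<Longrightarrow> comp_in A g \<Longrightarrow> comp_in A (\<lambda>x. f x mod g x)"
  unfolding minus_div_mult_eq_mod[symmetric] by (intro computable)

lemma dec_in_even [computable]: "comp_in A f \<Longrightarrow> dec_in A (\<lambda>x. even (f x))"
  unfolding even_iff_mod_2_eq_zero by (intro computable)

section \<open>Computable permutations and the matching of decidable sets\<close>

definition comp_perm :: "nat set \<Rightarrow> (nat \<Rightarrow> nat) \<Rightarrow> bool" where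
  "comp_perm D \<pi> \<longleftrightarrow> bij \<pi> \<and> comp_in D \<pi>"

lemma comp_perm_id: "comp_perm D (\<lambda>x. x)"
  unfolding comp_perm_def by (simp add: computable bij_id[unfolded id_def])

lemma comp_perm_comp: "comp_perm D \<pi> \<Longrightarrow> comp_perm D \<rho> \<Longrightarrow> comp_perm D (\<pi> \<circ> \<rho>)"
  unfolding comp_perm_def comp_def by (auto intro: comp_in_comp bij_comp[unfolded comp_def])

lemma comp_perm_inv: "comp_perm D \<pi> \<Longrightarrow> comp_perm D (the_inv \<pi>)"
proof -
  assume "comp_perm D \<pi>"
  then have \<pi>: "bij \<pi>" "comp_in D \<pi>" unfolding comp_perm_def by auto
  have eq: "the_inv \<pi> x = (LEAST y. \<pi> y = x)" for x
    using \<pi>(1) by (intro Least_equality[symmetric])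
      (auto simp: bij_def f_the_inv_into_f the_inv_f_f)
  have "comp_in D (\<lambda>x. LEAST y. \<pi> y = x)"
    by (rule comp_in_Least) (use \<pi> in \<open>auto intro!: computable comp_in_comp[OF \<pi>(2)] simp: bij_def surj_def\<close>, metis)
  then have "comp_in D (the_inv \<pi>)" unfolding eq[symmetric] .
  then show ?thesis using \<pi>(1) unfolding comp_perm_def bij_def[of \<pi>]
    using bij_betw_the_inv_into[OF \<pi>(1)] by simp
qed

lemma comp_perm_funpow: "comp_perm D \<pi> \<Longrightarrow> comp_perm D (\<pi> ^^ n)"
  by (induction n) (auto intro: comp_perm_comp comp_perm_id simp: id_def)

lemma comp_in_enumerate:
  assumes X: "dec_in D (\<lambda>x. x \<in> X)" and inf: "infinite X"
  shows "comp_in D (enumerate X)"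
proof -
  define s where "s b = (LEAST n. n \<in> X \<and> b < n)" for b
  have "comp_in D (\<lambda>b. LEAST n. n \<in> X \<and> b < n)"
  proof (rule comp_in_Least)
    show "\<exists>n. n \<in> X \<and> b < n" for b using inf unfolding infinite_nat_iff_unbounded by blast
  qed (intro computable dec_in_comp[OF X])
  then have s: "comp_in D s" unfolding s_def .
  have "comp_in D (\<lambda>n. rec_nat (LEAST n. n \<in> X) (\<lambda>n. s) n)"
    by (intro comp_in_rec computable comp_in_comp[OF s])
  moreover have "rec_nat (LEAST n. n \<in> X) (\<lambda>n. s) n = enumerate X n" for n
    by (induction n) (auto simp: enumerate_0 enumerate_Suc''[OF inf] s_def)
  ultimately show ?thesis by simp
qed

text \<open>The n-th element of \<open>X\<close> is matched with the n-th element of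
  \<open>Y\<close>, and likewise for the complements; infinity of all four sets makes both matchings
  total and onto.\<close>

lemma comp_perm_exists:
  assumes X: "dec_in D (\<lambda>x. x \<in> X)" and Y: "dec_in D (\<lambda>x. x \<in> Y)"
    and inf: "infinite X" "infinite (- X)" "infinite Y" "infinite (- Y)"
  shows "\<exists>\<beta>. comp_perm D \<beta> \<and> (\<forall>b. \<beta> b \<in> Y \<longleftrightarrow> b \<in> X)"
proof -
  \<comment> \<open>Outside \<open>X\<close> the implication holds at once, so the search terminates
    everywhere; each instance is used only on its own domain.\<close>
  define t where "t X Y b = enumerate Y (LEAST n. b \<in> X \<longrightarrow> enumerate X n = b)" for X Y :: "nat set" and b
  have bij: "bij_betw (enumerate X) UNIV X" if "infinite X" for X :: "nat set"
    using that by (rule bij_enumerate)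
  have "\<exists>n. b \<in> X \<longrightarrow> enumerate X n = b" if "infinite X" for X :: "nat set" and b
    using enumerate_Ex[OF that, of b] by blast
  note ex = this
  have t: "comp_in D (t X Y)" if "dec_in D (\<lambda>x. x \<in> X)" "dec_in D (\<lambda>x. x \<in> Y)" "infinite X" "infinite Y" for X Y
  proof -
    have "comp_in D (\<lambda>b. LEAST n. b \<in> X \<longrightarrow> enumerate X n = b)"
      by (rule comp_in_Least)
        (use ex[OF that(3)] in \<open>auto intro!: computable comp_in_comp[OF comp_in_enumerate[OF that(1,3)]] dec_in_comp[OF that(1)]\<close>)
    from comp_in_comp[OF comp_in_enumerate[OF that(2,4)] this] show ?thesis unfolding t_def .
  qed
  have tb: "bij_betw (t X Y) X Y" if "infinite X" "infinite Y" for X Y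
  proof -
    have "(LEAST n. b \<in> X \<longrightarrow> enumerate X n = b) = the_inv (enumerate X) b" if "b \<in> X" for b
      using that bij[OF \<open>infinite X\<close>] ex[OF \<open>infinite X\<close>, of b]
      by (intro Least_equality) (auto simp: bij_betw_def f_the_inv_into_f the_inv_f_f)
    then have "bij_betw (t X Y) X Y \<longleftrightarrow> bij_betw (enumerate Y \<circ> the_inv (enumerate X)) X Y"
      by (intro bij_betw_cong) (simp add: t_def)
    also have "\<dots>"
      using bij_betw_the_inv_into[OF bij[OF that(1)]] bij[OF that(2)] by (rule bij_betw_trans)
    finally show ?thesis by simp
  qed
  define \<beta> where "\<beta> b = (if b \<in> X then t X Y b else t (- X) (- Y) b)" for b
  have 1: "bij_betw \<beta> X Y"
    using tb[OF inf(1,3)] by (rule bij_betw_cong[THEN iffD1, rotated]) (simp add: \<beta>_def)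
  have 2: "bij_betw \<beta> (- X) (- Y)"
    using tb[OF inf(2,4)] by (rule bij_betw_cong[THEN iffD1, rotated]) (simp add: \<beta>_def)
  have "bij \<beta>" using bij_betw_combine[OF 1 2] by simp
  moreover have "comp_in D \<beta>" unfolding \<beta>_def
    using t[OF X Y inf(1,3)] t[of "- X" "- Y"] dec_in_not[OF X] dec_in_not[OF Y] inf
    by (intro comp_in_if X) auto
  moreover have "\<beta> b \<in> Y \<longleftrightarrow> b \<in> X" for b
    using bij_betwE[OF 1] bij_betwE[OF 2] by blast
  ultimately show ?thesis unfolding comp_perm_def by blast
qed

section \<open>Blocks of three points\<close>

definition block_map :: "(nat \<Rightarrow> nat) \<Rightarrow> nat \<Rightarrow> nat" where
  "block_map \<beta> x = 3 * \<beta> (x div 3) + x mod 3"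

definition within_blocks :: "(nat \<Rightarrow> bool) \<Rightarrow> (nat \<Rightarrow> nat) \<Rightarrow> nat \<Rightarrow> nat" where
  "within_blocks X s x = (if X (x div 3) then 3 * (x div 3) + s (x mod 3) else x)"

definition swap01 :: "nat \<Rightarrow> nat" where "swap01 i = (if i = 0 then 1 else if i = 1 then 0 else 2)"
definition cyc3 :: "nat \<Rightarrow> nat" where "cyc3 i = (if i = 2 then 0 else Suc i)"
definition cyc3' :: "nat \<Rightarrow> nat" where "cyc3' i = (if i = 0 then 2 else i - 1)"

lemma block_div_mod: "i < 3 \<Longrightarrow> (3 * b + i) div 3 = b" "i < 3 \<Longrightarrow> (3 * b + i) mod 3 = i" for b i :: nat
  by simp_all

lemma less_3_cases: "i < 3 \<longleftrightarrow> i = 0 \<or> i = 1 \<or> i = 2" for i :: nat by auto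

lemma mod_3_less: "x mod 3 < 3" for x :: nat by simp

lemma inblock_less: "i < 3 \<Longrightarrow> swap01 i < 3" "i < 3 \<Longrightarrow> cyc3 i < 3" "i < 3 \<Longrightarrow> cyc3' i < 3"
  by (auto simp: swap01_def cyc3_def cyc3'_def)

lemma within_blocks_comp_same:
  "(\<And>i. i < 3 \<Longrightarrow> t i < 3) \<Longrightarrow> within_blocks X s \<circ> within_blocks X t = within_blocks X (s \<circ> t)"
  by (auto simp: within_blocks_def fun_eq_iff block_div_mod mod_3_less)

lemma within_blocks_id: "(\<And>i. i < 3 \<Longrightarrow> s i = i) \<Longrightarrow> within_blocks X s = (\<lambda>x. x)"
  by (auto simp: within_blocks_def fun_eq_iff mod_3_less)

lemma bij_of_inverse: "f \<circ> g = (\<lambda>x. x) \<Longrightarrow> g \<circ> f = (\<lambda>x. x) \<Longrightarrow> bij f"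
  by (rule o_bij[of g]) (auto simp: id_def)

lemma the_inv_eq_of_inverse: "f \<circ> g = (\<lambda>x. x) \<Longrightarrow> g \<circ> f = (\<lambda>x. x) \<Longrightarrow> the_inv f = g"
proof (rule ext)
  fix x assume *: "f \<circ> g = (\<lambda>x. x)" "g \<circ> f = (\<lambda>x. x)"
  then have "the_inv f (f (g x)) = g x" using bij_of_inverse[OF *] by (intro the_inv_f_f) (auto simp: bij_def)
  then show "the_inv f x = g x" using * by (metis comp_apply)
qed

lemma swap01_inverse: "within_blocks X swap01 \<circ> within_blocks X swap01 = (\<lambda>x. x)"
  by (subst within_blocks_comp_same) (auto intro!: within_blocks_id simp: inblock_less swap01_def less_3_cases)

lemma cyc3_inverse:
  "within_blocks X cyc3 \<circ> within_blocks X cyc3' = (\<lambda>x. x)" "within_blocks X cyc3' \<circ> within_blocks X cyc3 = (\<lambda>x. x)"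
  by (subst within_blocks_comp_same;
      auto intro!: within_blocks_id simp: inblock_less cyc3_def cyc3'_def less_3_cases)+

lemma within_blocks_app: "i < 3 \<Longrightarrow> within_blocks X s (3 * b + i) = 3 * b + (if X b then s i else i)"
  by (simp add: within_blocks_def)

text \<open>Blockwise, a factor acting alone meets its own inverse and cancels. Where both act,
  conjugating \<open>cyc3\<close> by the transposition gives \<open>cyc3'\<close>, and the square of
  \<open>cyc3'\<close> is \<open>cyc3\<close>.\<close>

lemma within_blocks_commutator:
  "within_blocks X swap01 \<circ> within_blocks Z cyc3 \<circ> (within_blocks X swap01 \<circ> within_blocks Z cyc3') =
   within_blocks (\<lambda>b. X b \<and> Z b) cyc3"
proof
  fix x :: nat
  define b i where "b = x div 3" and "i = x mod 3"
  have x: "x = 3 * b + i" unfolding b_def i_def by simp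
  have i: "i < 3" unfolding i_def by simp
  then have fin: "swap01 (cyc3 (swap01 (cyc3' i))) = cyc3 i" "cyc3 (cyc3' i) = i" "swap01 (swap01 i) = i"
    by (auto simp: swap01_def cyc3_def cyc3'_def less_3_cases)
  show "(within_blocks X swap01 \<circ> within_blocks Z cyc3 \<circ> (within_blocks X swap01 \<circ> within_blocks Z cyc3')) x =
    within_blocks (\<lambda>b. X b \<and> Z b) cyc3 x"
    unfolding x comp_def
    by (cases "X b"; cases "Z b") (simp_all only: within_blocks_app i inblock_less if_True if_False simp_thms fin)
qed

lemma block_map_comp: "block_map \<beta> \<circ> block_map \<gamma> = block_map (\<beta> \<circ> \<gamma>)"
  by (auto simp: block_map_def fun_eq_iff block_div_mod mod_3_less)

lemma block_map_id: "block_map (\<lambda>b. b) = (\<lambda>x. x)"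
  by (auto simp: block_map_def fun_eq_iff)

text \<open>Conjugation by a block permutation relabels the blocks in which something happens and
  leaves the action inside a block alone. It serves twice: to shift columns, and to conjugate
  \<open>r\<close> to a permutation with other active blocks.\<close>

lemma block_map_within_blocks:
  "block_map \<beta> \<circ> within_blocks (\<lambda>b. X (\<beta> b)) s = within_blocks X s \<circ> block_map \<beta>" if "\<And>i. i < 3 \<Longrightarrow> s i < 3"
  using that by (auto simp: block_map_def within_blocks_def fun_eq_iff block_div_mod mod_3_less)

lemma comp_in_cyc3 [computable]:
  "comp_in A f \<Longrightarrow> comp_in A (\<lambda>x. swap01 (f x))" "comp_in A f \<Longrightarrow> comp_in A (\<lambda>x. cyc3 (f x))"
  unfolding swap01_def cyc3_def by (intro computable; assumption)+

lemma comp_in_within_blocks: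
  assumes "dec_in A X" "comp_in A s" shows "comp_in A (within_blocks X s)"
  unfolding within_blocks_def[abs_def]
  by (intro computable dec_in_comp[OF assms(1)] comp_in_comp[OF assms(2)])

lemma comp_perm_block_map:
  assumes "comp_perm A \<beta>" shows "comp_perm A (block_map \<beta>)"
proof -
  from assms have \<beta>: "bij \<beta>" "comp_in A \<beta>" unfolding comp_perm_def by auto
  have "comp_in A (block_map \<beta>)" unfolding block_map_def[abs_def]
    by (intro computable comp_in_comp[OF \<beta>(2)])
  moreover have "\<beta> \<circ> the_inv \<beta> = (\<lambda>x. x)" "the_inv \<beta> \<circ> \<beta> = (\<lambda>x. x)"
    using \<beta>(1) by (auto simp: fun_eq_iff bij_def f_the_inv_into_f the_inv_f_f)
  then have "bij (block_map \<beta>)"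
    by (intro bij_of_inverse[where g = "block_map (the_inv \<beta>)"]) (simp_all add: block_map_comp block_map_id)
  ultimately show ?thesis unfolding comp_perm_def by simp
qed

lemma comp_perm_within_blocks:
  assumes "dec_in A X"
  shows "comp_perm A (within_blocks X swap01)" "comp_perm A (within_blocks X cyc3)"
  unfolding comp_perm_def
  using bij_of_inverse[OF swap01_inverse swap01_inverse] bij_of_inverse[OF cyc3_inverse]
  by (auto intro!: comp_in_within_blocks assms comp_in_cyc3[OF comp_in_id, simplified])

text \<open>The even numbers carry the columns \<open>0, 1, 2, \<dots>\<close>, the odd ones the negative columns.\<close>

definition col_shift :: "nat \<Rightarrow> nat" where
  "col_shift b = prod_encode (if even (pfst b) then pfst b + 2 else if pfst b = 1 then 0 else pfst b - 2, psnd b)"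

definition col_shift' :: "nat \<Rightarrow> nat" where
  "col_shift' b = prod_encode (if odd (pfst b) then pfst b + 2 else if pfst b = 0 then 1 else pfst b - 2, psnd b)"

lemma col_shift_inverse: "col_shift \<circ> col_shift' = (\<lambda>x. x)" "col_shift' \<circ> col_shift = (\<lambda>x. x)"
  by ((rule ext, auto simp: col_shift_def col_shift'_def prod_encode_eq_iff elim!: evenE oddE; presburger)+)

lemma comp_perm_col_shift: "comp_perm A col_shift"
  unfolding comp_perm_def
proof
  show "comp_in A col_shift" unfolding col_shift_def[abs_def] by (intro computable)
qed (rule bij_of_inverse[OF col_shift_inverse])

lemma funpow_col_shift: "(col_shift ^^ m) (prod_encode (2 * k, y)) = prod_encode (2 * (k + m), y)"
  by (induction m) (auto simp: col_shift_def)

lemma mem_atomic_diagram: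
  "prod_encode (1, prod_encode (gterm_code s, gterm_code t)) \<in> atomic_diagram H \<longleftrightarrow>
   gterm_consts s \<union> gterm_consts t \<subseteq> carrier H \<and> gterm_value H s = gterm_value H t"
  unfolding atomic_diagram_def by (auto dest: gterm_code_inject split: if_splits)

section \<open>The double jump is computable from every copy\<close>

primrec pow_term :: "nat \<Rightarrow> nat \<Rightarrow> gterm" where
  "pow_term u 0 = One"
| "pow_term u (Suc m) = Mult (Elt u) (pow_term u m)"

text \<open>The commutator of \<open>r\<close> with a conjugate of \<open>p\<close>. Since
  \<open>u\<close>, \<open>p\<close>, \<open>r\<close> stay fixed, the code of the word is
  computable from \<open>m\<close>.\<close>

definition comm_term :: "nat \<Rightarrow> nat \<Rightarrow> nat \<Rightarrow> nat \<Rightarrow> gterm" where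
  "comm_term u p r m = (let c = Mult (Inv (pow_term u m)) (Mult (Elt p) (pow_term u m)) in
     Mult (Mult c (Elt r)) (Mult (Inv c) (Inv (Elt r))))"

lemma comp_in_comm_term:
  assumes "comp_in A f" shows "comp_in A (\<lambda>x. gterm_code (comm_term u p r (f x)))"
proof -
  have "comp_in A (\<lambda>x. rec_nat (gterm_code One)
      (\<lambda>n c. prod_encode (3, prod_encode (gterm_code (Elt u), c))) (f x))"
    by (intro comp_in_rec computable assms)
  moreover have "rec_nat (gterm_code One) (\<lambda>n c. prod_encode (3, prod_encode (gterm_code (Elt u), c))) n
     = gterm_code (pow_term u n)" for n
    by (induction n) simp_all
  ultimately have "comp_in A (\<lambda>x. gterm_code (pow_term u (f x)))" by simp
  then show ?thesis unfolding comm_term_def Let_def gterm_code.simps by (intro computable)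
qed

text \<open>The numbers \<open>e\<close> in the second jump of \<open>D\<close> are those for which \<open>P e\<close> has finitely many
  solutions. With \<open>w\<close> the permutation that performs a 3-cycle in the block \<open>(0, y)\<close> for every
  solution \<open>y\<close>, finiteness means that some restriction of \<open>w\<close> is trivial, and infinity that
  \<open>w\<close> is conjugate to a fixed permutation. Both are existential conditions on the group.\<close>

lemma double_jump_le_copy:
  fixes H :: "nat monoid" and \<kappa> :: "(nat \<Rightarrow> nat) \<Rightarrow> nat"
  assumes H: "group H"
    and closed: "\<And>\<pi>. comp_perm D \<pi> \<Longrightarrow> \<kappa> \<pi> \<in> carrier H"
    and hom: "\<And>\<pi> \<rho>. comp_perm D \<pi> \<Longrightarrow> comp_perm D \<rho> \<Longrightarrow> \<kappa> (\<pi> \<circ> \<rho>) = \<kappa> \<pi> \<otimes>\<^bsub>H\<^esub> \<kappa> \<rho>"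
    and inj: "\<And>\<pi>. comp_perm D \<pi> \<Longrightarrow> \<kappa> \<pi> = \<one>\<^bsub>H\<^esub> \<Longrightarrow> \<pi> = (\<lambda>x. x)"
    and conj: "\<And>r w h. comp_perm D r \<Longrightarrow> comp_perm D w \<Longrightarrow> infinite {x. r x \<noteq> x} \<Longrightarrow>
      infinite {x. r x = x} \<Longrightarrow> finite {x. w x \<noteq> x} \<Longrightarrow> h \<in> carrier H \<Longrightarrow>
      h \<otimes>\<^bsub>H\<^esub> \<kappa> r \<noteq> \<kappa> w \<otimes>\<^bsub>H\<^esub> h"
  shows "turing_le (turing_jump (turing_jump D)) (atomic_diagram H)"
proof -
  interpret H: group H by fact
  have \<kappa>_id: "\<kappa> (\<lambda>x. x) = \<one>\<^bsub>H\<^esub>"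
  proof -
    have "\<kappa> (\<lambda>x. x) \<otimes>\<^bsub>H\<^esub> \<kappa> (\<lambda>x. x) = \<kappa> (\<lambda>x. x)"
      using hom[OF comp_perm_id comp_perm_id] by (simp add: comp_def)
    then show ?thesis using H.r_cancel_one closed[OF comp_perm_id] by blast
  qed
  have \<kappa>_inv: "inv\<^bsub>H\<^esub> \<kappa> \<pi> = \<kappa> \<rho>"
    if "comp_perm D \<pi>" "comp_perm D \<rho>" "\<rho> \<circ> \<pi> = (\<lambda>x. x)" for \<pi> \<rho>
    using hom[OF that(2,1)] that(3) \<kappa>_id closed that by (intro H.inv_equality) simp_all
  obtain P where P: "dec_in D (\<lambda>w. P (pfst w) (psnd w))"
    and PD: "\<And>e. e \<in> turing_jump (turing_jump D) \<longleftrightarrow> finite {y. P e y}"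
    using double_jump_finite[of D] by blast
  \<comment> \<open>The index \<open>m\<close> is a pair of \<open>e\<close> and a threshold
    \<open>N\<close>; the cut below \<open>N\<close> is what later expresses finiteness by a trivial
    word.\<close>
  define R where "R m y \<longleftrightarrow> P (pfst m) y \<and> psnd m \<le> y" for m y
  \<comment> \<open>The even column \<open>2 * m\<close> stores the solutions for \<open>m\<close>;
    the odd columns, which stand for negative integers, stay empty.\<close>
  define XP where "XP b \<longleftrightarrow> even (pfst b) \<and> R (pfst b div 2) (psnd b)" for b
  define p where "p = within_blocks XP swap01"
  define Z where "Z b \<longleftrightarrow> pfst b = 0" for b
  define r where "r = within_blocks Z cyc3"
  define X where "X m b \<longleftrightarrow> pfst b = 0 \<and> R m (psnd b)" for m b
  define w where "w m = within_blocks (X m) cyc3" for m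
  define u where "u = block_map col_shift"
  have P': "dec_in D (\<lambda>x. P (f x) (g x))" if "comp_in D f" "comp_in D g" for f g
    using dec_in_comp[OF P, of "\<lambda>x. prod_encode (f x, g x)"] that by (simp add: computable)
  have XP: "dec_in D XP" unfolding XP_def[abs_def] R_def by (intro computable P')
  have Z: "dec_in D Z" unfolding Z_def[abs_def] by (intro computable)
  have X: "dec_in D (X m)" for m unfolding X_def[abs_def] R_def by (intro computable P')
  have cp: "comp_perm D p" "comp_perm D r" "comp_perm D u" "comp_perm D (w m)" for m
    unfolding p_def r_def u_def w_def
    by (intro comp_perm_within_blocks comp_perm_block_map comp_perm_col_shift XP Z X)+
  have r': "comp_perm D (within_blocks Z cyc3')"
    using comp_perm_inv[OF cp(2)] the_inv_eq_of_inverse[OF cyc3_inverse, of Z] by (simp add: r_def)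
  have value_pow: "gterm_value H (pow_term (\<kappa> u) m) = \<kappa> (u ^^ m)" for m
    by (induction m) (simp_all add: \<kappa>_id id_def hom[symmetric] cp comp_perm_funpow comp_def)
  have conj_p: "the_inv (u ^^ m) \<circ> (p \<circ> u ^^ m) = within_blocks (\<lambda>b. XP ((col_shift ^^ m) b)) swap01" for m
  proof -
    have u: "u ^^ m = block_map (col_shift ^^ m)"
    proof (induction m)
      case 0 then show ?case by (simp add: id_def block_map_id)
    next
      case (Suc m) then show ?case by (simp add: u_def block_map_comp) (simp add: comp_def)
    qed
    have "p \<circ> u ^^ m = u ^^ m \<circ> within_blocks (\<lambda>b. XP ((col_shift ^^ m) b)) swap01"
      unfolding u p_def by (rule block_map_within_blocks[symmetric]) (rule inblock_less)
    then have "the_inv (u ^^ m) \<circ> (p \<circ> u ^^ m) = the_inv (u ^^ m) \<circ> u ^^ m \<circ> within_blocks (\<lambda>b. XP ((col_shift ^^ m) b)) swap01"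
      by (simp add: comp_assoc)
    also have "the_inv (u ^^ m) \<circ> u ^^ m = id"
      using comp_perm_funpow[OF cp(3), of m] unfolding comp_perm_def bij_def
      by (auto simp: fun_eq_iff the_inv_f_f)
    finally show ?thesis by (simp only: id_comp)
  qed
  have value_comm: "gterm_value H (comm_term (\<kappa> u) (\<kappa> p) (\<kappa> r) m) = \<kappa> (w m)" for m
  proof -
    let ?c = "within_blocks (\<lambda>b. XP ((col_shift ^^ m) b)) swap01"
    have um: "comp_perm D (u ^^ m)" "comp_perm D (the_inv (u ^^ m))"
      using cp(3) by (auto intro: comp_perm_funpow comp_perm_inv)
    have um': "the_inv (u ^^ m) \<circ> u ^^ m = (\<lambda>x. x)"
      using um(1) unfolding comp_perm_def bij_def by (auto simp: fun_eq_iff the_inv_f_f)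
    have c: "comp_perm D ?c"
      unfolding conj_p[symmetric] by (intro comp_perm_comp um cp)
    have "\<kappa> ?c = inv\<^bsub>H\<^esub> \<kappa> (u ^^ m) \<otimes>\<^bsub>H\<^esub> (\<kappa> p \<otimes>\<^bsub>H\<^esub> \<kappa> (u ^^ m))"
      unfolding conj_p[symmetric] \<kappa>_inv[OF um um'] by (simp add: hom comp_perm_comp um cp)
    then have "gterm_value H (comm_term (\<kappa> u) (\<kappa> p) (\<kappa> r) m) =
        (\<kappa> ?c \<otimes>\<^bsub>H\<^esub> \<kappa> r) \<otimes>\<^bsub>H\<^esub> (inv\<^bsub>H\<^esub> \<kappa> ?c \<otimes>\<^bsub>H\<^esub> inv\<^bsub>H\<^esub> \<kappa> r)"
      by (simp add: comm_term_def Let_def value_pow)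
    also have "inv\<^bsub>H\<^esub> \<kappa> ?c = \<kappa> ?c" by (rule \<kappa>_inv[OF c c swap01_inverse])
    also have "inv\<^bsub>H\<^esub> \<kappa> r = \<kappa> (within_blocks Z cyc3')"
      by (rule \<kappa>_inv[OF cp(2) r']) (simp add: r_def cyc3_inverse)
    also have "(\<kappa> ?c \<otimes>\<^bsub>H\<^esub> \<kappa> r) \<otimes>\<^bsub>H\<^esub> (\<kappa> ?c \<otimes>\<^bsub>H\<^esub> \<kappa> (within_blocks Z cyc3')) =
      \<kappa> (?c \<circ> r \<circ> (?c \<circ> within_blocks Z cyc3'))"
      by (simp add: hom comp_perm_comp c cp r')
    also have "?c \<circ> r \<circ> (?c \<circ> within_blocks Z cyc3') = within_blocks (\<lambda>b. XP ((col_shift ^^ m) b) \<and> Z b) cyc3"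
      unfolding r_def by (rule within_blocks_commutator)
    \<comment> \<open>The shifted \<open>p\<close> shows column \<open>2 * m\<close> in column 0,
      and the conjunction with \<open>Z\<close> discards whatever it has in other columns.\<close>
    also have "(\<lambda>b. XP ((col_shift ^^ m) b) \<and> Z b) = X m"
    proof
      fix b
      have "XP ((col_shift ^^ m) b) \<longleftrightarrow> R m (psnd b)" if "pfst b = 0"
      proof -
        have "b = prod_encode (2 * 0, psnd b)" using that by (metis mult_0_right prod_encode_eq_iff)
        then have "(col_shift ^^ m) b = prod_encode (2 * m, psnd b)" using funpow_col_shift[of m 0 "psnd b"] by simp
        then show ?thesis by (simp add: XP_def)
      qed
      then show "(XP ((col_shift ^^ m) b) \<and> Z b) = X m b" by (auto simp: Z_def X_def)
    qed
    finally show ?thesis by (simp add: w_def)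
  qed
  have consts_pow: "gterm_consts (pow_term (\<kappa> u) m) \<subseteq> carrier H" for m
    by (induction m) (auto simp: closed cp)
  have consts_comm: "gterm_consts (comm_term (\<kappa> u) (\<kappa> p) (\<kappa> r) m) \<subseteq> carrier H" for m
    using consts_pow by (auto simp: comm_term_def Let_def closed cp)
  have w_app: "w m (3 * b + i) = 3 * b + (if X m b then cyc3 i else i)" if "i < 3" for m b i
    unfolding w_def using that by (rule within_blocks_app)
  have w_moved: "{x. w m x \<noteq> x} \<subseteq> (\<lambda>(b, i). 3 * b + i) ` ({b. X m b} \<times> {..<3})" for m
  proof
    fix x assume "x \<in> {x. w m x \<noteq> x}"
    then have "X m (x div 3)" by (auto simp: w_def within_blocks_def split: if_splits)
    then show "x \<in> (\<lambda>(b, i). 3 * b + i) ` ({b. X m b} \<times> {..<3})"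
      by (intro image_eqI[of _ _ "(x div 3, x mod 3)"]) auto
  qed
  have X_eq: "{b. X m b} = (\<lambda>y. prod_encode (0, y)) ` {y. R m y}" for m
    by (auto simp: X_def image_iff) (metis prod_encode_eq_iff)
  have X_finite: "finite {b. X m b} \<longleftrightarrow> finite {y. R m y}" for m
    unfolding X_eq by (rule finite_image_iff) (auto intro: inj_onI)
  have w_trivial: "\<kappa> (w m) = \<one>\<^bsub>H\<^esub> \<longleftrightarrow> (\<forall>y. \<not> R m y)" for m
  proof
    assume "\<kappa> (w m) = \<one>\<^bsub>H\<^esub>"
    then have "w m = (\<lambda>x. x)" by (rule inj[OF cp(4)])
    then have "\<not> X m b" for b using w_app[of 0 m b] by (auto simp: cyc3_def split: if_splits)
    from this[of "prod_encode (0, _)"] show "\<forall>y. \<not> R m y" by (simp add: X_def)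
  next
    assume "\<forall>y. \<not> R m y"
    then have "w m = (\<lambda>x. x)" by (auto simp: w_def within_blocks_def X_def fun_eq_iff)
    then show "\<kappa> (w m) = \<one>\<^bsub>H\<^esub>" by (simp add: \<kappa>_id)
  qed
  have inf_pairs: "infinite (range (\<lambda>y. prod_encode (c, y)))" for c
    by (rule range_inj_infinite) (auto intro: injI)
  have Z_inf: "infinite {b. Z b}"
    by (rule infinite_super[OF _ inf_pairs[of 0]]) (auto simp: Z_def)
  have not_Z_inf: "infinite {b. \<not> Z b}"
    by (rule infinite_super[OF _ inf_pairs[of 1]]) (auto simp: Z_def)
  \<comment> \<open>If \<open>{y. R m y}\<close> is infinite, \<open>w m\<close> and
    \<open>r\<close> both act in infinitely many blocks and leave infinitely many alone, so a
    computable permutation of blocks conjugates one to the other. A finite set gives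
    \<open>w m\<close> finite support, which \<open>conj\<close> rules out.\<close>
  have w_conj: "(\<exists>h\<in>carrier H. h \<otimes>\<^bsub>H\<^esub> \<kappa> r = \<kappa> (w m) \<otimes>\<^bsub>H\<^esub> h) \<longleftrightarrow> infinite {y. R m y}" for m
  proof
    assume "\<exists>h\<in>carrier H. h \<otimes>\<^bsub>H\<^esub> \<kappa> r = \<kappa> (w m) \<otimes>\<^bsub>H\<^esub> h"
    then obtain h where h: "h \<in> carrier H" "h \<otimes>\<^bsub>H\<^esub> \<kappa> r = \<kappa> (w m) \<otimes>\<^bsub>H\<^esub> h" by blast
    show "infinite {y. R m y}"
    proof
      assume "finite {y. R m y}"
      then have "finite {x. w m x \<noteq> x}"
        unfolding X_finite[symmetric] by (intro finite_subset[OF w_moved]) simp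
      moreover have "infinite {x. r x \<noteq> x}"
      proof (rule infinite_super)
        show "infinite ((\<lambda>b. 3 * b) ` {b. Z b})" using Z_inf by (subst finite_image_iff) (auto intro: inj_onI)
        show "(\<lambda>b. 3 * b) ` {b. Z b} \<subseteq> {x. r x \<noteq> x}"
          using within_blocks_app[of 0 Z cyc3] by (auto simp: r_def cyc3_def)
      qed
      moreover have "infinite {x. r x = x}"
      proof (rule infinite_super)
        show "infinite ((\<lambda>b. 3 * b) ` {b. \<not> Z b})" using not_Z_inf by (subst finite_image_iff) (auto intro: inj_onI)
        show "(\<lambda>b. 3 * b) ` {b. \<not> Z b} \<subseteq> {x. r x = x}"
          by (auto simp: r_def within_blocks_def)
      qed
      ultimately show False using conj[OF cp(2) cp(4) _ _ _ h(1)] h(2) by blast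
    qed
  next
    assume inf: "infinite {y. R m y}"
    have "\<exists>\<beta>. comp_perm D \<beta> \<and> (\<forall>b. \<beta> b \<in> {b. X m b} \<longleftrightarrow> b \<in> {b. Z b})"
    proof (rule comp_perm_exists)
      show "infinite (- {b. X m b})"
        by (rule infinite_super[OF _ inf_pairs[of 1]]) (auto simp: X_def)
      show "infinite (- {b. Z b})" using not_Z_inf by (simp add: Collect_neg_eq)
    qed (use X Z Z_inf inf X_finite in simp_all)
    then obtain \<beta> where \<beta>: "comp_perm D \<beta>" "Z = (\<lambda>b. X m (\<beta> b))" by (auto simp: fun_eq_iff)
    have "block_map \<beta> \<circ> r = w m \<circ> block_map \<beta>"
      unfolding r_def w_def \<beta>(2) by (rule block_map_within_blocks) (rule inblock_less)
    then have "\<kappa> (block_map \<beta>) \<otimes>\<^bsub>H\<^esub> \<kappa> r = \<kappa> (w m) \<otimes>\<^bsub>H\<^esub> \<kappa> (block_map \<beta>)"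
      using hom[OF comp_perm_block_map[OF \<beta>(1)] cp(2)] hom[OF cp(4) comp_perm_block_map[OF \<beta>(1)]] by simp
    then show "\<exists>h\<in>carrier H. h \<otimes>\<^bsub>H\<^esub> \<kappa> r = \<kappa> (w m) \<otimes>\<^bsub>H\<^esub> h"
      using closed[OF comp_perm_block_map[OF \<beta>(1)]] by blast
  qed
  let ?A = "atomic_diagram H" and ?t = "\<lambda>m. gterm_code (comm_term (\<kappa> u) (\<kappa> p) (\<kappa> r) m)"
  have "dec_in ?A (\<lambda>e. e \<in> turing_jump (turing_jump D))"
  proof (rule dec_in_Post)
    let ?fin = "\<lambda>e N. prod_encode (1, prod_encode (?t (prod_encode (e, N)), gterm_code One)) \<in> ?A"
    \<comment> \<open>The conjugacy is written as an equation of two products; 3 is the tag of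
      \<open>Mult\<close>, here applied to the commutator word and \<open>h\<close>.\<close>
    let ?inf = "\<lambda>e h. prod_encode (1, prod_encode (gterm_code (Mult (Elt h) (Elt (\<kappa> r))),
      prod_encode (3, prod_encode (?t (prod_encode (e, 0)), gterm_code (Elt h))))) \<in> ?A"
    show "dec_in ?A (\<lambda>z. ?fin (pfst z) (psnd z))"
      by (intro dec_in_oracle computable comp_in_comm_term)
    show "dec_in ?A (\<lambda>z. ?inf (pfst z) (psnd z))"
      unfolding gterm_code.simps by (intro dec_in_oracle computable comp_in_comm_term)
    fix e
    have fin: "?fin e N \<longleftrightarrow> (\<forall>y. \<not> (P e y \<and> N \<le> y))" for N
      unfolding mem_atomic_diagram using w_trivial[of "prod_encode (e, N)"] consts_comm
      by (simp add: value_comm R_def)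
    \<comment> \<open>The diagram mentions only constants in the carrier, so a search through all
      numbers \<open>h\<close> is a search through the copy.\<close>
    have inf: "?inf e h \<longleftrightarrow> h \<in> carrier H \<and> h \<otimes>\<^bsub>H\<^esub> \<kappa> r = \<kappa> (w (prod_encode (e, 0))) \<otimes>\<^bsub>H\<^esub> h" for h
      using mem_atomic_diagram[of "Mult (Elt h) (Elt (\<kappa> r))" "Mult (comm_term (\<kappa> u) (\<kappa> p) (\<kappa> r) (prod_encode (e, 0))) (Elt h)"] consts_comm
      by (auto simp: value_comm closed cp)
    show "e \<in> turing_jump (turing_jump D) \<longleftrightarrow> (\<exists>N. ?fin e N)"
      unfolding PD fin finite_nat_set_iff_bounded by (auto simp: not_le)
    show "e \<notin> turing_jump (turing_jump D) \<longleftrightarrow> (\<exists>h. ?inf e h)"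
      unfolding PD inf using w_conj[of "prod_encode (e, 0)"] by (auto simp: R_def)
  qed
  then show ?thesis unfolding turing_le_iff_dec .
qed

section \<open>Copies computable in the double jump\<close>

lemma app_unique: "app D e x y \<Longrightarrow> app D e x z \<Longrightarrow> y = z"
  unfolding app_def using recf_code_inject eval_deterministic by metis

lemma comp_in_iff_app: "comp_in D f \<longleftrightarrow> (\<exists>e. \<forall>x. app D e x (f x))"
  unfolding comp_in_def app_def using recf_code_inject by metis

lemma dec_in_app [computable]:
  assumes "comp_in (turing_jump D) f" "comp_in (turing_jump D) g" "comp_in (turing_jump D) h"
  shows "dec_in (turing_jump D) (\<lambda>x. app D (f x) (g x) (h x))"
proof -
  have "dec_in (turing_jump D) (\<lambda>z. app D (pfst z) (pfst (psnd z)) (psnd (psnd z)))"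
    unfolding app_iff_cert by (rule dec_in_jump_ex) (intro computable)
  from dec_in_comp[OF this, of "\<lambda>x. prod_encode (f x, prod_encode (g x, h x))"] assms show ?thesis
    by (simp add: comp_in_pair)
qed

lemma ex_prod_decode: "(\<exists>x y. P x y) \<longleftrightarrow> (\<exists>z. P (pfst z) (psnd z))"
  by (metis fst_conv prod_encode_inverse snd_conv)

lemma all_prod_decode: "(\<forall>x y. P x y) \<longleftrightarrow> (\<forall>z. P (pfst z) (psnd z))"
  by (metis fst_conv prod_encode_inverse snd_conv)

lemma dec_in_app_defined:
  assumes "comp_in (turing_jump D) f" "comp_in (turing_jump D) g"
  shows "dec_in (turing_jump D) (\<lambda>x. \<exists>y. app D (f x) (g x) y)"
proof -
  have "dec_in (turing_jump D) (\<lambda>z. \<exists>y. app D (pfst z) (psnd z) y)"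
    unfolding app_iff_cert ex_prod_decode by (rule dec_in_jump_ex) (intro computable)
  from dec_in_comp[OF this, of "\<lambda>x. prod_encode (f x, g x)"] assms show ?thesis
    by (simp add: comp_in_pair)
qed

lemma dec_in_jump_all2:
  "dec_in A (\<lambda>w. P (pfst w) (pfst (psnd w)) (psnd (psnd w))) \<Longrightarrow> dec_in (turing_jump A) (\<lambda>e. \<forall>x y. P e x y)"
  unfolding all_prod_decode by (rule dec_in_jump_all)

lemma dec_in_jump_all3:
  assumes "dec_in A (\<lambda>w. P (pfst w) (pfst (psnd w)) (pfst (psnd (psnd w))) (psnd (psnd (psnd w))))"
  shows "dec_in (turing_jump A) (\<lambda>e. \<forall>x y z. P e x y z)"
proof -
  have "(\<forall>x y z. P e x y z) \<longleftrightarrow> (\<forall>v. P e (pfst v) (pfst (psnd v)) (psnd (psnd v)))" for e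
    by (metis fst_conv prod_encode_inverse snd_conv)
  with dec_in_jump_all[OF assms] show ?thesis by simp
qed

text \<open>The default value 0 outside \<open>N\<close> ties each bijection of \<open>N\<close> to
  one total function, so that equality of group elements becomes equality of functions.\<close>

definition comp_bij_on :: "nat set \<Rightarrow> nat set \<Rightarrow> (nat \<Rightarrow> nat) \<Rightarrow> bool" where
  "comp_bij_on D N \<pi> \<longleftrightarrow> comp_in D \<pi> \<and> bij_betw \<pi> N N \<and> (\<forall>x. x \<notin> N \<longrightarrow> \<pi> x = 0)"

text \<open>Elements are represented by bijections of \<open>N\<close>, and the group consists of
  all \<open>D\<close>-computable ones that respect \<open>K\<close> on finite tuples. The jump may
  be used to decide \<open>K\<close>, because the quantifier over tuples costs a second jump in any
  case.\<close>

locale comp_perm_group = group G for G (structure) +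
  fixes D N :: "nat set" and K :: "nat list \<Rightarrow> nat list \<Rightarrow> bool" and \<rho> :: "'a \<Rightarrow> nat \<Rightarrow> nat"
  assumes N: "dec_in D (\<lambda>x. x \<in> N)"
    and K: "dec_in (turing_jump D) (\<lambda>z. K (list_decode (pfst z)) (list_decode (psnd z)))"
    and inj: "inj_on \<rho> (carrier G)"
    and image: "\<rho> ` carrier G = {\<pi>. comp_bij_on D N \<pi> \<and> (\<forall>xs. set xs \<subseteq> N \<longrightarrow> K xs (map \<pi> xs))}"
    and hom: "\<And>g h x. g \<in> carrier G \<Longrightarrow> h \<in> carrier G \<Longrightarrow> x \<in> N \<Longrightarrow> \<rho> (g \<otimes> h) x = \<rho> g (\<rho> h x)"
begin

abbreviation D' where "D' \<equiv> turing_jump D"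
abbreviation D'' where "D'' \<equiv> turing_jump (turing_jump D)"

lemma dec_in_N: "comp_in D' f \<Longrightarrow> dec_in D' (\<lambda>x. f x \<in> N)"
  using dec_in_comp[OF dec_in_jump[OF N]] .

lemma \<rho>_props: assumes "g \<in> carrier G"
  shows "comp_in D (\<rho> g)" "bij_betw (\<rho> g) N N" "x \<notin> N \<Longrightarrow> \<rho> g x = 0" "set xs \<subseteq> N \<Longrightarrow> K xs (map (\<rho> g) xs)"
  using assms image unfolding comp_bij_on_def by auto

lemma \<rho>_eqI:
  assumes "g \<in> carrier G" "h \<in> carrier G" "\<And>x. x \<in> N \<Longrightarrow> \<rho> g x = \<rho> h x" shows "g = h"
proof (rule inj_onD[OF inj _ assms(1,2)], rule ext)
  show "\<rho> g x = \<rho> h x" for x using assms \<rho>_props(3) by (cases "x \<in> N") simp_all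
qed

section \<open>Indices of group elements\<close>

definition index :: "nat \<Rightarrow> 'a \<Rightarrow> bool" where
  "index e g \<longleftrightarrow> g \<in> carrier G \<and> (\<forall>x. app D e x (\<rho> g x))"

lemma ex_index: "g \<in> carrier G \<Longrightarrow> \<exists>e. index e g"
  unfolding index_def using \<rho>_props(1) comp_in_iff_app by blast

lemma index_app: "index e g \<Longrightarrow> app D e x y \<longleftrightarrow> y = \<rho> g x"
  unfolding index_def using app_unique by blast

lemma index_unique: "index e g \<Longrightarrow> index e h \<Longrightarrow> g = h"
  by (rule \<rho>_eqI) (auto simp: index_def intro: app_unique)

definition is_index :: "nat \<Rightarrow> bool" where "is_index e \<longleftrightarrow> (\<exists>g. index e g)"

text \<open>Everything is said through the graph \<open>app D e\<close>. Each conjunct is a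
  universal statement about conditions that \<open>D'\<close> decides, hence is decided by
  \<open>D''\<close>; the tuples in the last one are coded lists.\<close>

lemma is_index_iff:
  "is_index e \<longleftrightarrow> (\<forall>x. \<exists>y. app D e x y) \<and> (\<forall>x. x \<notin> N \<longrightarrow> app D e x 0) \<and>
    (\<forall>x y. x \<in> N \<and> app D e x y \<longrightarrow> y \<in> N) \<and>
    (\<forall>x x' y. x \<in> N \<and> x' \<in> N \<and> app D e x y \<and> app D e x' y \<longrightarrow> x = x') \<and>
    (\<forall>y. y \<in> N \<longrightarrow> (\<exists>x. x \<in> N \<and> app D e x y)) \<and>
    (\<forall>x y. length (list_decode x) = length (list_decode y) \<and>
      (\<forall>i<length (list_decode x). nthd (list_decode x) i \<in> N \<and> app D e (nthd (list_decode x) i) (nthd (list_decode y) i))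
      \<longrightarrow> K (list_decode x) (list_decode y))" (is "_ \<longleftrightarrow> ?R")
proof
  assume "is_index e"
  then obtain g where g: "index e g" unfolding is_index_def ..
  then have G: "g \<in> carrier G" by (simp add: index_def)
  have "K xs ys" if "length xs = length ys" "\<forall>i<length xs. nthd xs i \<in> N \<and> nthd ys i = \<rho> g (nthd xs i)" for xs ys
  proof -
    have "ys = map (\<rho> g) xs" using that by (auto intro!: nth_equalityI simp: nthd_def)
    moreover have "set xs \<subseteq> N" using that(2) by (auto simp: in_set_conv_nth nthd_def)
    ultimately show ?thesis using \<rho>_props(4)[OF G] by blast
  qed
  then have K: "\<forall>x y. length (list_decode x) = length (list_decode y) \<and>
      (\<forall>i<length (list_decode x). nthd (list_decode x) i \<in> N \<and> app D e (nthd (list_decode x) i) (nthd (list_decode y) i))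
      \<longrightarrow> K (list_decode x) (list_decode y)" unfolding index_app[OF g] by blast
  have \<rho>N: "inj_on (\<rho> g) N" "\<rho> g ` N = N" using \<rho>_props(2)[OF G] by (auto simp: bij_betw_def)
  have "\<forall>x x' y. x \<in> N \<and> x' \<in> N \<and> app D e x y \<and> app D e x' y \<longrightarrow> x = x'"
    unfolding index_app[OF g] using \<rho>N(1) by (meson inj_onD)
  moreover have "\<forall>y. y \<in> N \<longrightarrow> (\<exists>x. x \<in> N \<and> app D e x y)" "\<forall>x y. x \<in> N \<and> app D e x y \<longrightarrow> y \<in> N"
    unfolding index_app[OF g] using \<rho>N(2) by blast+
  moreover have "\<forall>x. x \<notin> N \<longrightarrow> app D e x 0" "\<forall>x. \<exists>y. app D e x y"
    unfolding index_app[OF g] using \<rho>_props(3)[OF G] by simp_all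
  ultimately show ?R using K by (intro conjI) assumption+
next
  assume R: ?R
  then have "\<forall>x. \<exists>y. app D e x y" by (rule conjunct1)
  from choice[OF this] obtain \<pi> where \<pi>: "\<And>x. app D e x (\<pi> x)" by blast
  have app: "app D e x y \<longleftrightarrow> y = \<pi> x" for x y using \<pi> app_unique by blast
  have "comp_in D \<pi>" unfolding comp_in_iff_app using \<pi> by blast
  moreover have "bij_betw \<pi> N N"
  proof (rule bij_betw_imageI)
    have "\<forall>x x' y. x \<in> N \<and> x' \<in> N \<and> app D e x y \<and> app D e x' y \<longrightarrow> x = x'" using R by (elim conjE)
    then show "inj_on \<pi> N" unfolding app inj_on_def by blast
    have "\<forall>x y. x \<in> N \<and> app D e x y \<longrightarrow> y \<in> N" using R by (elim conjE)
    moreover have "\<forall>y. y \<in> N \<longrightarrow> (\<exists>x. x \<in> N \<and> app D e x y)" using R by (elim conjE)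
    ultimately show "\<pi> ` N = N" unfolding app by blast
  qed
  moreover have "K xs (map \<pi> xs)" if "set xs \<subseteq> N" for xs
  proof -
    have len: "length xs = length (map \<pi> xs) \<and> (\<forall>i<length xs. nthd xs i \<in> N \<and> nthd (map \<pi> xs) i = \<pi> (nthd xs i))"
      using that by (auto simp: nthd_def)
    have "\<forall>x y. length (list_decode x) = length (list_decode y) \<and>
      (\<forall>i<length (list_decode x). nthd (list_decode x) i \<in> N \<and> app D e (nthd (list_decode x) i) (nthd (list_decode y) i))
      \<longrightarrow> K (list_decode x) (list_decode y)" using R by (elim conjE)
    from this[rule_format, of "list_encode xs" "list_encode (map \<pi> xs)"] len show ?thesis
      unfolding app list_encode_inverse by blast
  qed
  moreover have "\<pi> x = 0" if "x \<notin> N" for x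
  proof -
    have "\<forall>x. x \<notin> N \<longrightarrow> app D e x 0" using R by (elim conjE)
    then show ?thesis using that unfolding app by simp
  qed
  ultimately have "\<pi> \<in> \<rho> ` carrier G" unfolding image comp_bij_on_def by blast
  then show "is_index e" unfolding is_index_def index_def using \<pi> by blast
qed

lemma dec_in_is_index: "dec_in D'' is_index"
proof -
  have K': "dec_in D' (\<lambda>x. K (list_decode (f x)) (list_decode (g x)))" if "comp_in D' f" "comp_in D' g" for f g
    using dec_in_comp[OF K, of "\<lambda>x. prod_encode (f x, g x)"] that by (simp add: computable)
  \<comment> \<open>Surjectivity has an existential quantifier behind the universal one. It is
    merged with that of the certificate, so that one jump suffices for both.\<close>
  have ex: "dec_in D' (\<lambda>z. \<exists>x. x \<in> N \<and> app D (pfst z) x (psnd z))"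
    unfolding app_iff_cert ex_simps[symmetric] ex_prod_decode
    by (rule dec_in_jump_ex) (intro computable dec_in_comp[OF N])
  show ?thesis
    unfolding is_index_iff[abs_def]
  proof (intro dec_in_conj)
    show "dec_in D'' (\<lambda>e. \<forall>x. \<exists>y. app D e x y)"
      by (rule dec_in_jump_all) (intro dec_in_app_defined computable)
    show "dec_in D'' (\<lambda>e. \<forall>x. x \<notin> N \<longrightarrow> app D e x 0)"
      by (rule dec_in_jump_all) (intro computable dec_in_N)
    show "dec_in D'' (\<lambda>e. \<forall>x y. x \<in> N \<and> app D e x y \<longrightarrow> y \<in> N)"
      by (rule dec_in_jump_all2) (intro computable dec_in_N)
    show "dec_in D'' (\<lambda>e. \<forall>x x' y. x \<in> N \<and> x' \<in> N \<and> app D e x y \<and> app D e x' y \<longrightarrow> x = x')"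
      by (rule dec_in_jump_all3) (intro computable dec_in_N)
    show "dec_in D'' (\<lambda>e. \<forall>y. y \<in> N \<longrightarrow> (\<exists>x. x \<in> N \<and> app D e x y))"
      by (rule dec_in_jump_all) (intro computable dec_in_N ex)
    show "dec_in D'' (\<lambda>e. \<forall>x y. length (list_decode x) = length (list_decode y) \<and>
      (\<forall>i<length (list_decode x). nthd (list_decode x) i \<in> N \<and> app D e (nthd (list_decode x) i) (nthd (list_decode y) i))
      \<longrightarrow> K (list_decode x) (list_decode y))"
      by (rule dec_in_jump_all2) (intro computable dec_in_N K')
  qed
qed

section \<open>The copy on least indices\<close>

definition code :: "'a \<Rightarrow> nat" where "code g = (LEAST e. index e g)"

lemma index_code: "g \<in> carrier G \<Longrightarrow> index (code g) g"
  unfolding code_def by (rule LeastI_ex) (rule ex_index)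

lemma inj_on_code: "inj_on code (carrier G)"
  by (rule inj_onI) (metis index_code index_unique)

definition Dom :: "nat set" where "Dom = code ` carrier G"

text \<open>Two indices name total functions, so inclusion of the graphs already means equality and
  takes universal quantifiers only.\<close>

lemma Dom_iff: "e \<in> Dom \<longleftrightarrow> is_index e \<and> (\<forall>e'<e. is_index e' \<longrightarrow> \<not> (\<forall>x y. app D e' x y \<longrightarrow> app D e x y))"
proof
  assume "e \<in> Dom"
  then obtain g where g: "g \<in> carrier G" "e = code g" unfolding Dom_def by blast
  then have e: "index e g" by (simp add: index_code)
  have "\<not> (\<forall>x y. app D e' x y \<longrightarrow> app D e x y)" if "e' < e" "is_index e'" for e'
  proof
    assume *: "\<forall>x y. app D e' x y \<longrightarrow> app D e x y"
    from that(2) obtain h where h: "index e' h" unfolding is_index_def ..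
    have "g = h"
      by (rule \<rho>_eqI) (use e h * index_app[OF e] index_app[OF h] in \<open>auto simp: index_def\<close>)
    then have "e \<le> e'" unfolding g(2) code_def using h by (intro Least_le) simp
    then show False using that(1) by simp
  qed
  then show "is_index e \<and> (\<forall>e'<e. is_index e' \<longrightarrow> \<not> (\<forall>x y. app D e' x y \<longrightarrow> app D e x y))"
    using e unfolding is_index_def by blast
next
  assume *: "is_index e \<and> (\<forall>e'<e. is_index e' \<longrightarrow> \<not> (\<forall>x y. app D e' x y \<longrightarrow> app D e x y))"
  then obtain g where g: "index e g" unfolding is_index_def by blast
  then have G: "g \<in> carrier G" by (simp add: index_def)
  have "\<not> code g < e"
    using * index_code[OF G] index_app[OF index_code[OF G]] index_app[OF g] unfolding is_index_def by blast
  moreover have "code g \<le> e" unfolding code_def using g by (rule Least_le)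
  ultimately show "e \<in> Dom" unfolding Dom_def using G by (intro image_eqI[of _ _ g]) auto
qed

lemma dec_in_Dom: "comp_in D'' f \<Longrightarrow> dec_in D'' (\<lambda>x. f x \<in> Dom)"
proof -
  have "dec_in D'' (\<lambda>z. \<forall>x y. app D (psnd z) x y \<longrightarrow> app D (pfst z) x y)"
    by (rule dec_in_jump_all2) (intro computable)
  then have "dec_in D'' (\<lambda>e. e \<in> Dom)"
    unfolding Dom_iff by (intro computable dec_in_comp[OF dec_in_is_index])
  then show "comp_in D'' f \<Longrightarrow> ?thesis" by (rule dec_in_comp)
qed

definition elt :: "nat \<Rightarrow> 'a" where "elt e = inv_into (carrier G) code e"

lemma elt_code: "g \<in> carrier G \<Longrightarrow> elt (code g) = g"
  unfolding elt_def by (rule inv_into_f_f[OF inj_on_code])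

lemma code_elt: "e \<in> Dom \<Longrightarrow> code (elt e) = e"
  unfolding elt_def Dom_def by (rule f_inv_into_f)

lemma elt_closed: "e \<in> Dom \<Longrightarrow> elt e \<in> carrier G"
  unfolding elt_def Dom_def by (rule inv_into_into)

lemma code_closed: "g \<in> carrier G \<Longrightarrow> code g \<in> Dom"
  unfolding Dom_def by blast

definition H :: "nat monoid" where
  "H = \<lparr>carrier = Dom, monoid.mult = (\<lambda>a b. code (elt a \<otimes> elt b)), one = code \<one>\<rparr>"

lemma H_sel: "carrier H = Dom" "a \<otimes>\<^bsub>H\<^esub> b = code (elt a \<otimes> elt b)" "\<one>\<^bsub>H\<^esub> = code \<one>"
  by (simp_all add: H_def)

lemma code_iso: "code \<in> iso G H"
  unfolding iso_def hom_def bij_betw_def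
  using inj_on_code by (auto simp: H_sel Dom_def elt_code)

lemma group_H: "group H"
proof -
  have "group (H\<lparr>one := code \<one>\<rparr>)" by (rule iso_imp_img_group[OF code_iso])
  then show ?thesis by (simp add: H_def)
qed

lemma H_iso: "H \<cong> G"
  using code_iso by (simp add: is_iso_def iso_sym is_group) (metis empty_iff iso_set_sym)

text \<open>A search for the one element of \<open>Dom\<close> that acts as the product. The premise
  lets the search end also when \<open>a\<close> or \<open>b\<close> is not an element;
  \<open>x\<close> ranges over \<open>N\<close> because elements are determined by their values
  there.\<close>

definition comp_mult :: "nat \<Rightarrow> nat \<Rightarrow> nat" where
  "comp_mult a b = (LEAST e. a \<in> Dom \<and> b \<in> Dom \<longrightarrow> e \<in> Dom \<and>
     (\<forall>x y z. x \<in> N \<and> app D b x y \<and> app D a y z \<longrightarrow> app D e x z))"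

definition comp_inv :: "nat \<Rightarrow> nat" where
  "comp_inv a = (LEAST e. a \<in> Dom \<longrightarrow> e \<in> Dom \<and> comp_mult e a = code \<one>)"

lemma comp_mult_iff:
  assumes "a \<in> Dom" "b \<in> Dom"
  shows "e \<in> Dom \<and> (\<forall>x y z. x \<in> N \<and> app D b x y \<and> app D a y z \<longrightarrow> app D e x z) \<longleftrightarrow> e = a \<otimes>\<^bsub>H\<^esub> b"
proof -
  have i: "app D e x y \<longleftrightarrow> y = \<rho> (elt e) x" if "e \<in> Dom" for e x y
    by (rule index_app) (use index_code[OF elt_closed[OF that]] code_elt[OF that] in simp)
  have "e \<in> Dom \<Longrightarrow> (\<forall>x y z. x \<in> N \<and> app D b x y \<and> app D a y z \<longrightarrow> app D e x z) \<longleftrightarrow> elt e = elt a \<otimes> elt b"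
    using \<rho>_eqI[of "elt e" "elt a \<otimes> elt b"] assms by (auto simp: i hom elt_closed)
  moreover have "a \<otimes>\<^bsub>H\<^esub> b \<in> Dom" using assms by (simp add: H_sel code_closed elt_closed)
  ultimately show ?thesis using assms code_elt[of e] elt_code[of "elt a \<otimes> elt b"]
    by (auto simp: H_sel elt_closed)
qed

lemma comp_mult: "a \<in> Dom \<Longrightarrow> b \<in> Dom \<Longrightarrow> comp_mult a b = a \<otimes>\<^bsub>H\<^esub> b"
  unfolding comp_mult_def by (simp add: comp_mult_iff Least_equality)

lemma comp_inv: "a \<in> Dom \<Longrightarrow> comp_inv a = inv\<^bsub>H\<^esub> a"
proof -
  interpret H: group H by (rule group_H)
  assume a: "a \<in> Dom"
  have "e \<in> Dom \<and> comp_mult e a = code \<one> \<longleftrightarrow> e = inv\<^bsub>H\<^esub> a" for e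
    using a comp_mult[of _ a] H.inv_equality[of e a] H.l_inv[of a] H.inv_closed[of a] by (auto simp: H_sel(1,3))
  then show ?thesis unfolding comp_inv_def using a by (simp add: Least_equality)
qed

lemma comp_in_comp_mult: "comp_in D'' f \<Longrightarrow> comp_in D'' g \<Longrightarrow> comp_in D'' (\<lambda>x. comp_mult (f x) (g x))"
proof -
  have R: "dec_in D'' (\<lambda>w. \<forall>x y z. x \<in> N \<and> app D (pfst w) x y \<and> app D (pfst (psnd w)) y z \<longrightarrow> app D (psnd (psnd w)) x z)"
    by (rule dec_in_jump_all3) (intro computable dec_in_N)
  have "comp_in D'' (\<lambda>w. comp_mult (pfst w) (psnd w))"
    unfolding comp_mult_def
  proof (rule comp_in_Least)
    let ?P = "\<lambda>w e. pfst w \<in> Dom \<and> psnd w \<in> Dom \<longrightarrow> e \<in> Dom \<and>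
      (\<forall>x y z. x \<in> N \<and> app D (psnd w) x y \<and> app D (pfst w) y z \<longrightarrow> app D e x z)"
    show "dec_in D'' (\<lambda>z. ?P (pfst z) (psnd z))"
      using dec_in_comp[OF R, of "\<lambda>z. prod_encode (psnd (pfst z), prod_encode (pfst (pfst z), psnd z))"]
      by (intro computable dec_in_Dom) (simp add: computable)
    show "\<exists>e. ?P w e" for w
      by (rule exI[of _ "pfst w \<otimes>\<^bsub>H\<^esub> psnd w"], rule impI, rule comp_mult_iff[THEN iffD2]) auto
  qed
  from comp_in_comp[OF this, of "\<lambda>x. prod_encode (f x, g x)"]
  show "comp_in D'' f \<Longrightarrow> comp_in D'' g \<Longrightarrow> ?thesis" by (simp add: computable)
qed

lemma comp_in_comp_inv: "comp_in D'' f \<Longrightarrow> comp_in D'' (\<lambda>x. comp_inv (f x))"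
proof -
  interpret H: group H by (rule group_H)
  have "comp_in D'' comp_inv"
    unfolding comp_inv_def[abs_def]
  proof (rule comp_in_Least)
    show "\<exists>e. a \<in> Dom \<longrightarrow> e \<in> Dom \<and> comp_mult e a = code \<one>" for a
      using comp_mult[of _ a] H.l_inv[of a] H.inv_closed[of a] unfolding H_sel(1,3) by metis
  qed (intro computable dec_in_Dom comp_in_comp_mult)
  then show "comp_in D'' f \<Longrightarrow> ?thesis" by (rule comp_in_comp)
qed

section \<open>Evaluation of terms in the copy\<close>

definition val :: "nat \<Rightarrow> nat" where
  "val x = (if \<exists>s. gterm_code s = x \<and> gterm_consts s \<subseteq> Dom
     then Suc (gterm_value H (THE s. gterm_code s = x)) else 0)"

text \<open>Values are raised by one so that 0 can mark the numbers that are not codes of terms over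
  \<open>Dom\<close>.\<close>

lemma val_code: "val (gterm_code s) = (if gterm_consts s \<subseteq> Dom then Suc (gterm_value H s) else 0)"
proof -
  have "(THE s'. gterm_code s' = gterm_code s) = s" by (rule the_equality) (auto dest: gterm_code_inject)
  moreover have "(\<exists>s'. gterm_code s' = gterm_code s \<and> gterm_consts s' \<subseteq> Dom) \<longleftrightarrow> gterm_consts s \<subseteq> Dom"
    by (auto dest: gterm_code_inject)
  ultimately show ?thesis by (simp add: val_def)
qed

lemma val_nonzero: "val x \<noteq> 0 \<Longrightarrow> \<exists>s. gterm_code s = x \<and> gterm_consts s \<subseteq> Dom"
  by (auto simp: val_def split: if_splits)

lemma gterm_value_closed: "gterm_consts s \<subseteq> Dom \<Longrightarrow> gterm_value H s \<in> Dom"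
proof -
  interpret H: group H by (rule group_H)
  show "gterm_consts s \<subseteq> Dom \<Longrightarrow> gterm_value H s \<in> Dom"
    unfolding H_sel(1)[symmetric] by (induction s) auto
qed

text \<open>Course-of-values form of \<open>val\<close>: the group operations are replaced by total
  functions that \<open>D''\<close> computes, and the mark 0 is passed on from subterms.\<close>

lemma val_eq:
  "val x = (let t = pfst x; b = psnd x in
     if t = 0 then (if b \<in> Dom then Suc b else 0)
     else if t = 1 then (if b = 0 then Suc (code \<one>) else 0)
     else if t = 2 then (if val b = 0 then 0 else Suc (comp_inv (val b - 1)))
     else if t = 3 then (if val (pfst b) = 0 \<or> val (psnd b) = 0 then 0
       else Suc (comp_mult (val (pfst b) - 1) (val (psnd b) - 1)))
     else 0)" (is "_ = ?R x")
proof (cases "\<exists>s. gterm_code s = x")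
  case True
  then obtain s where s: "gterm_code s = x" ..
  have "val (gterm_code s) = ?R (gterm_code s)"
    unfolding val_code by (cases s) (auto simp: val_code gterm_value_closed comp_mult comp_inv H_sel(3))
  then show ?thesis unfolding s .
next
  case False
  then have x: "val x = 0" by (auto simp: val_def)
  have False if "?R x \<noteq> 0"
  proof -
    let ?t = "pfst x" and ?b = "psnd x"
    from that consider "?t = 0" "?b \<in> Dom" | "?t = 1" "?b = 0" | "?t = 2" "val ?b \<noteq> 0"
      | "?t = 3" "val (pfst ?b) \<noteq> 0" "val (psnd ?b) \<noteq> 0"
      by (auto simp: Let_def split: if_splits)
    then have "\<exists>s. gterm_code s = x"
    proof cases
      case 1 then have "gterm_code (Elt ?b) = x" by (simp add: prod_encode_eq_iff)
      then show ?thesis ..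
    next
      case 2 then have "gterm_code One = x" by (simp add: prod_encode_eq_iff)
      then show ?thesis ..
    next
      case 3
      from val_nonzero[OF 3(2)] obtain s where "gterm_code s = ?b" by blast
      with 3 have "gterm_code (Inv s) = x" by (simp add: prod_encode_eq_iff)
      then show ?thesis ..
    next
      case 4
      from val_nonzero[OF 4(2)] val_nonzero[OF 4(3)] obtain s s' where "gterm_code s = pfst ?b" "gterm_code s' = psnd ?b" by blast
      with 4 have "gterm_code (Mult s s') = x" by (simp add: prod_encode_eq_iff)
      then show ?thesis ..
    qed
    then show False using False by blast
  qed
  then show ?thesis using x by metis
qed

lemma comp_in_val: "comp_in D'' val"
proof -
  define lk where "lk C x y = nthd C (x - Suc y)" for C x y
  define V where "V x C = (let t = pfst x; b = psnd x in
     if t = 0 then (if b \<in> Dom then Suc b else 0)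
     else if t = 1 then (if b = 0 then Suc (code \<one>) else 0)
     else if t = 2 then (if lk C x b = 0 then 0 else Suc (comp_inv (lk C x b - 1)))
     else if t = 3 then (if lk C x (pfst b) = 0 \<or> lk C x (psnd b) = 0 then 0
       else Suc (comp_mult (lk C x (pfst b) - 1) (lk C x (psnd b) - 1)))
     else 0)" for x C
  show ?thesis
  proof (rule comp_in_course_of_values[where G = V])
    show "comp_in D'' (\<lambda>z. V (pfst z) (list_decode (psnd z)))"
      unfolding V_def Let_def lk_def by (intro computable dec_in_Dom comp_in_comp_inv comp_in_comp_mult)
    fix x
    show "val x = V x (map val (rev [0..<x]))"
    proof (cases "pfst x = 0")
      case True
      show ?thesis unfolding val_eq[of x] V_def Let_def True by simp
    next
      case False
      then have "psnd x < x" using psnd_less[of x] by simp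
      moreover have "pfst (psnd x) < x" "psnd (psnd x) < x"
        using pfst_le[of "psnd x"] psnd_le[of "psnd x"] \<open>psnd x < x\<close> by linarith+
      ultimately show ?thesis unfolding val_eq[of x] V_def Let_def lk_def by (simp only: nthd_course)
    qed
  qed
qed

lemma atomic_diagram_iff:
  "x \<in> atomic_diagram H \<longleftrightarrow> val (pfst (psnd x)) \<noteq> 0 \<and> val (psnd (psnd x)) \<noteq> 0 \<and>
     pfst x = of_bool (val (pfst (psnd x)) = val (psnd (psnd x)))"
proof
  assume "x \<in> atomic_diagram H"
  then show "val (pfst (psnd x)) \<noteq> 0 \<and> val (psnd (psnd x)) \<noteq> 0 \<and>
     pfst x = of_bool (val (pfst (psnd x)) = val (psnd (psnd x)))"
    unfolding atomic_diagram_def by (auto simp: val_code H_sel(1))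
next
  assume *: "val (pfst (psnd x)) \<noteq> 0 \<and> val (psnd (psnd x)) \<noteq> 0 \<and>
     pfst x = of_bool (val (pfst (psnd x)) = val (psnd (psnd x)))"
  then obtain s t where st: "gterm_code s = pfst (psnd x)" "gterm_consts s \<subseteq> Dom"
    "gterm_code t = psnd (psnd x)" "gterm_consts t \<subseteq> Dom" using val_nonzero by meson
  with * have "pfst x = (if gterm_value H s = gterm_value H t then 1 else 0)"
    using val_code[of s] val_code[of t] by simp
  with st have "x = prod_encode (if gterm_value H s = gterm_value H t then 1 else 0, prod_encode (gterm_code s, gterm_code t))"
    by (metis prod_encode_eq_iff)
  then show "x \<in> atomic_diagram H"
    unfolding atomic_diagram_def H_sel(1) using st(2,4) by blast
qed

lemma atomic_diagram_H: "turing_le (atomic_diagram H) D''"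
  unfolding turing_le_iff_dec atomic_diagram_iff
  by (intro computable comp_in_comp[OF comp_in_val])

text \<open>Composing \<open>\<iota>\<close> with an isomorphism carries its properties to an
  arbitrary copy. The isomorphism contributes only finitely many constants to the reduction, so it
  may be as complicated as it likes.\<close>

lemma iso_type_has_degreeI:
  assumes closed: "\<And>\<pi>. comp_perm D \<pi> \<Longrightarrow> \<iota> \<pi> \<in> carrier G"
    and \<iota>_hom: "\<And>\<pi> \<rho>. comp_perm D \<pi> \<Longrightarrow> comp_perm D \<rho> \<Longrightarrow> \<iota> (\<pi> \<circ> \<rho>) = \<iota> \<pi> \<otimes> \<iota> \<rho>"
    and \<iota>_inj: "\<And>\<pi>. comp_perm D \<pi> \<Longrightarrow> \<iota> \<pi> = \<one> \<Longrightarrow> \<pi> = (\<lambda>x. x)"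
    and conj: "\<And>r w h. comp_perm D r \<Longrightarrow> comp_perm D w \<Longrightarrow> infinite {x. r x \<noteq> x} \<Longrightarrow>
      infinite {x. r x = x} \<Longrightarrow> finite {x. w x \<noteq> x} \<Longrightarrow> h \<in> carrier G \<Longrightarrow> h \<otimes> \<iota> r \<noteq> \<iota> w \<otimes> h"
  shows "iso_type_has_degree G (degree_of D'')"
proof -
  have lower: "turing_le D'' (atomic_diagram H')" if H': "group H'" "H' \<cong> G" for H' :: "nat monoid"
  proof -
    interpret H': group H' by fact
    obtain f where f: "f \<in> iso G H'"
      using H'.iso_sym[OF H'(2)] unfolding is_iso_def by blast
    then have fh: "f \<in> hom G H'" and fb: "bij_betw f (carrier G) (carrier H')" by (auto simp: iso_def)
    have f_inj: "x = y" if "x \<in> carrier G" "y \<in> carrier G" "f x = f y" for x y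
      using fb that by (auto simp: bij_betw_def inj_on_def)
    show ?thesis
    proof (rule double_jump_le_copy[where \<kappa> = "\<lambda>\<pi>. f (\<iota> \<pi>)"])
      show "group H'" by fact
      show "f (\<iota> \<pi>) \<in> carrier H'" if "comp_perm D \<pi>" for \<pi> using hom_in_carrier[OF fh] closed[OF that] .
      show "f (\<iota> (\<pi> \<circ> \<rho>)) = f (\<iota> \<pi>) \<otimes>\<^bsub>H'\<^esub> f (\<iota> \<rho>)" if "comp_perm D \<pi>" "comp_perm D \<rho>" for \<pi> \<rho>
        using \<iota>_hom[OF that] hom_mult[OF fh] closed that by simp
      show "\<pi> = (\<lambda>x. x)" if "comp_perm D \<pi>" "f (\<iota> \<pi>) = \<one>\<^bsub>H'\<^esub>" for \<pi>
        using \<iota>_inj[OF that(1)] f_inj[OF closed[OF that(1)] one_closed] that(2) hom_one[OF fh is_group H'(1)] by simp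
      fix r w h
      assume *: "comp_perm D r" "comp_perm D w" "infinite {x. r x \<noteq> x}"
        "infinite {x. r x = x}" "finite {x. w x \<noteq> x}" "h \<in> carrier H'"
      then obtain g where g: "g \<in> carrier G" "h = f g" using fb by (auto simp: bij_betw_def)
      show "h \<otimes>\<^bsub>H'\<^esub> f (\<iota> r) \<noteq> f (\<iota> w) \<otimes>\<^bsub>H'\<^esub> h"
        using conj[OF *(1-5) g(1)] f_inj[of "g \<otimes> \<iota> r" "\<iota> w \<otimes> g"] g * closed hom_mult[OF fh]
        by auto
    qed
  qed
  \<comment> \<open>The copy on least indices is below \<open>D''\<close> by construction and above
    it by the bound for arbitrary copies, so it attains the degree.\<close>
  have "degree_of (atomic_diagram H) = degree_of D''"
    using atomic_diagram_H lower[OF group_H H_iso] by (simp add: degree_of_le_iff antisym)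
  then have "degree_of D'' \<in> copy_degrees G"
    unfolding copy_degrees_def using group_H H_iso by (metis (mono_tags, lifting) mem_Collect_eq)
  moreover have "degree_of D'' \<le> e'" if "e' \<in> copy_degrees G" for e'
    using that lower unfolding copy_degrees_def by (auto simp: degree_of_le_iff)
  ultimately show ?thesis unfolding iso_type_has_degree_def by blast
qed

end

section \<open>The degree of a bijection\<close>

text \<open>The function on codes induced by \<open>f\<close>; the default 0 is the one that
  \<open>comp_bij_on\<close> asks for.\<close>

definition transport :: "('a \<Rightarrow> nat) \<Rightarrow> 'a set \<Rightarrow> ('a \<Rightarrow> 'a) \<Rightarrow> nat \<Rightarrow> nat" where
  "transport c S f x = (if x \<in> c ` S then c (f (inv_into S c x)) else 0)"

lemma transport_app: "inj_on c S \<Longrightarrow> s \<in> S \<Longrightarrow> transport c S f (c s) = c (f s)"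
  by (simp add: transport_def inv_into_f_f)

lemma transport_outside: "x \<notin> c ` S \<Longrightarrow> transport c S f x = 0"
  by (simp add: transport_def)

text \<open>On a decidable domain a value is found by searching the graph, and the graph is tested
  by computing the value.\<close>

lemma fun_degree_le_iff:
  assumes c: "inj_on c S" and N: "dec_in D (\<lambda>x. x \<in> c ` S)" and f: "f ` S \<subseteq> S"
  shows "fun_degree c S f \<le> degree_of D \<longleftrightarrow> comp_in D (transport c S f)"
proof -
  let ?g = "(\<lambda>x. prod_encode (c x, c (f x))) ` S"
  have g: "prod_encode (x, y) \<in> ?g \<longleftrightarrow> x \<in> c ` S \<and> y = transport c S f x" for x y
    using transport_app[OF c] by (auto simp: image_iff)
  have g': "z \<in> ?g \<longleftrightarrow> pfst z \<in> c ` S \<and> psnd z = transport c S f (pfst z)" for z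
    using g[of "pfst z" "psnd z"] by simp
  have "dec_in D (\<lambda>z. z \<in> ?g) \<longleftrightarrow> comp_in D (transport c S f)"
  proof
    assume *: "dec_in D (\<lambda>z. z \<in> ?g)"
    have "comp_in D (\<lambda>x. LEAST y. if x \<in> c ` S then prod_encode (x, y) \<in> ?g else y = 0)"
    proof (rule comp_in_Least)
      show "dec_in D (\<lambda>z. if pfst z \<in> c ` S then prod_encode (pfst z, psnd z) \<in> ?g else psnd z = 0)"
        by (intro computable dec_in_comp[OF N] dec_in_comp[OF *])
      show "\<exists>y. if x \<in> c ` S then prod_encode (x, y) \<in> ?g else y = 0" for x
        unfolding g by (rule exI[of _ "transport c S f x"]) (simp add: transport_outside)
    qed
    moreover have "(LEAST y. if x \<in> c ` S then prod_encode (x, y) \<in> ?g else y = 0) = transport c S f x" for x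
      unfolding g by (rule Least_equality) (auto simp: transport_outside split: if_splits)
    ultimately show "comp_in D (transport c S f)" by simp
  next
    assume *: "comp_in D (transport c S f)"
    show "dec_in D (\<lambda>z. z \<in> ?g)"
      unfolding g' by (intro computable dec_in_comp[OF N] comp_in_comp[OF *])
  qed
  then show ?thesis unfolding fun_degree_def degree_of_le_iff turing_le_iff_dec .
qed

lemma transport_bij_betw:
  assumes c: "inj_on c S" and f: "bij_betw f S S" shows "bij_betw (transport c S f) (c ` S) (c ` S)"
proof (rule bij_betw_imageI)
  show "inj_on (transport c S f) (c ` S)"
  proof (rule inj_onI, elim imageE, hypsubst)
    fix s t assume "s \<in> S" "t \<in> S" "transport c S f (c s) = transport c S f (c t)"
    then have "f s = f t" using c f by (auto simp: transport_app bij_betw_def dest: inj_onD)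
    then show "c s = c t" using f \<open>s \<in> S\<close> \<open>t \<in> S\<close> by (auto simp: bij_betw_def dest: inj_onD)
  qed
  have "transport c S f ` c ` S = c ` f ` S" using transport_app[OF c] by (auto simp: image_image)
  then show "transport c S f ` c ` S = c ` S" using f by (simp add: bij_betw_def)
qed

lemma transport_compose:
  assumes "inj_on c S" "g ` S \<subseteq> S" "x \<in> c ` S"
  shows "transport c S (compose S f g) x = transport c S f (transport c S g x)"
  using assms by (auto simp: transport_app compose_def image_subset_iff)

lemma comp_bij_on_transport:
  assumes c: "inj_on c S" and N: "dec_in D (\<lambda>x. x \<in> c ` S)" and \<pi>: "comp_bij_on D (c ` S) \<pi>"
  shows "\<exists>f. f \<in> Bij S \<and> fun_degree c S f \<le> degree_of D \<and> transport c S f = \<pi>"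
proof -
  define f where "f = (\<lambda>s\<in>S. inv_into S c (\<pi> (c s)))"
  have \<pi>': "bij_betw \<pi> (c ` S) (c ` S)" "comp_in D \<pi>" using \<pi> by (auto simp: comp_bij_on_def)
  have "bij_betw (inv_into S c \<circ> (\<pi> \<circ> c)) S S"
    using c by (intro bij_betw_trans[OF bij_betw_trans[OF inj_on_imp_bij_betw \<pi>'(1)]] bij_betw_inv_into inj_on_imp_bij_betw)
  then have f: "bij_betw f S S"
    by (rule bij_betw_cong[THEN iffD1, rotated]) (simp add: f_def)
  have "transport c S f x = \<pi> x" for x
  proof (cases "x \<in> c ` S")
    case True
    then have "\<pi> x \<in> c ` S" using \<pi>'(1) by (rule bij_betwE[rule_format, rotated])
    then show ?thesis using True c by (auto simp: transport_app f_def f_inv_into_f)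
  qed (use \<pi> in \<open>simp add: transport_outside comp_bij_on_def\<close>)
  then have t: "transport c S f = \<pi>" by (rule ext)
  have "f \<in> Bij S" using f by (simp add: Bij_def f_def)
  moreover have "fun_degree c S f \<le> degree_of D"
    using fun_degree_le_iff[OF c N, of f] f \<pi>'(2) t by (simp add: bij_betw_def)
  ultimately show ?thesis using t by blast
qed

lemma transport_eq_iff:
  assumes c: "inj_on c S" and f: "f \<in> Bij S" "g \<in> Bij S" and eq: "transport c S f = transport c S g"
  shows "f = g"
proof (rule extensionalityI[of f S])
  show "f \<in> extensional S" "g \<in> extensional S" using f by (auto simp: Bij_def)
  fix s assume s: "s \<in> S"
  then have "c (f s) = c (g s)" using eq transport_app[OF c] by metis
  moreover have "f s \<in> S" "g s \<in> S" using f s by (auto simp: Bij_def bij_betw_def)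
  ultimately show "f s = g s" using c by (auto dest: inj_onD)
qed

lemma BijGroup_sel:
  "carrier (BijGroup S) = Bij S" "f \<in> Bij S \<Longrightarrow> g \<in> Bij S \<Longrightarrow> f \<otimes>\<^bsub>BijGroup S\<^esub> g = compose S f g"
  "\<one>\<^bsub>BijGroup S\<^esub> = (\<lambda>x\<in>S. x)"
  by (simp_all add: BijGroup_def)

lemma Bij_image: "f \<in> Bij S \<Longrightarrow> f ` S \<subseteq> S" and Bij_bij: "f \<in> Bij S \<Longrightarrow> bij_betw f S S"
  by (auto simp: Bij_def bij_betw_def)

lemma fun_degree_compose:
  assumes c: "inj_on c S" and N: "dec_in D (\<lambda>x. x \<in> c ` S)" and fg: "f \<in> Bij S" "g \<in> Bij S"
    and d: "fun_degree c S f \<le> degree_of D" "fun_degree c S g \<le> degree_of D"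
  shows "fun_degree c S (compose S f g) \<le> degree_of D"
proof -
  have eq: "transport c S (compose S f g) = (\<lambda>x. if x \<in> c ` S then transport c S f (transport c S g x) else 0)"
    using transport_compose[OF c Bij_image[OF fg(2)]] by (auto simp: fun_eq_iff transport_outside)
  have f: "comp_in D (transport c S f)" and g: "comp_in D (transport c S g)"
    using d fun_degree_le_iff[OF c N Bij_image] fg by auto
  have "comp_in D (transport c S (compose S f g))"
    unfolding eq by (intro computable dec_in_comp[OF N] comp_in_comp[OF f] comp_in_comp[OF g])
  then show ?thesis using fun_degree_le_iff[OF c N Bij_image] compose_Bij fg by blast
qed

text \<open>The inverse is computed by searching for a preimage, which bijectivity guarantees and
  makes unique.\<close>

lemma fun_degree_inverse:
  assumes c: "inj_on c S" and N: "dec_in D (\<lambda>x. x \<in> c ` S)" and f: "f \<in> Bij S"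
    and d: "fun_degree c S f \<le> degree_of D"
  shows "fun_degree c S (\<lambda>x\<in>S. inv_into S f x) \<le> degree_of D" (is "fun_degree c S ?g \<le> _")
proof -
  have g: "?g \<in> Bij S" using f by (rule restrict_inv_into_Bij)
  have F: "comp_in D (transport c S f)" using d fun_degree_le_iff[OF c N Bij_image] f by auto
  have "comp_in D (\<lambda>x. LEAST y. if x \<in> c ` S then y \<in> c ` S \<and> transport c S f y = x else y = 0)"
  proof (rule comp_in_Least)
    fix x
    have "x \<in> c ` S \<Longrightarrow> \<exists>y\<in>c ` S. transport c S f y = x"
      using transport_bij_betw[OF c Bij_bij[OF f]] unfolding bij_betw_def by (metis imageE)
    then show "\<exists>y. if x \<in> c ` S then y \<in> c ` S \<and> transport c S f y = x else y = 0"
      by (cases "x \<in> c ` S") auto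
  qed (intro computable dec_in_comp[OF N] comp_in_comp[OF F])
  moreover have "(LEAST y. if x \<in> c ` S then y \<in> c ` S \<and> transport c S f y = x else y = 0) = transport c S ?g x" for x
  proof (cases "x \<in> c ` S")
    case True
    then obtain s where s: "s \<in> S" "x = c s" by blast
    obtain t where t: "t \<in> S" "s = f t" using Bij_bij[OF f] s(1) by (auto simp: bij_betw_def)
    have "y \<in> c ` S \<and> transport c S f y = x \<longleftrightarrow> y = c t" for y
    proof
      assume y: "y \<in> c ` S \<and> transport c S f y = x"
      have "inj_on (transport c S f) (c ` S)"
        using transport_bij_betw[OF c Bij_bij[OF f]] by (rule bij_betw_imp_inj_on)
      from inj_onD[OF this, of y "c t"] y show "y = c t" using transport_app[OF c t(1), of f] s t by simp
    next
      assume "y = c t"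
      then show "y \<in> c ` S \<and> transport c S f y = x" using transport_app[OF c t(1), of f] s t by simp
    qed
    moreover have "transport c S ?g x = c t"
      using s t transport_app[OF c s(1)] Bij_bij[OF f] by (simp add: bij_betw_def inv_into_f_f)
    ultimately show ?thesis using True by (simp add: Least_equality)
  next
    case False
    then show ?thesis by (simp add: transport_outside Least_equality)
  qed
  ultimately have "comp_in D (transport c S ?g)" by simp
  then show ?thesis using fun_degree_le_iff[OF c N Bij_image[OF g]] by blast
qed

section \<open>Computing with rational numbers\<close>

text \<open>A rational is kept as a difference of natural numbers over a positive denominator. This
  avoids signs and lowest terms, and arithmetic and comparison reduce to natural numbers.\<close>

definition compq_in :: "nat set \<Rightarrow> (nat \<Rightarrow> rat) \<Rightarrow> bool" where
  "compq_in A f \<longleftrightarrow> (\<exists>a b c. comp_in A a \<and> comp_in A b \<and> comp_in A c \<and>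
     (\<forall>x. 0 < c x \<and> f x = (of_nat (a x) - of_nat (b x)) / of_nat (c x)))"

lemma compq_inI:
  "comp_in A a \<Longrightarrow> comp_in A b \<Longrightarrow> comp_in A c \<Longrightarrow>
   (\<And>x. 0 < c x \<and> f x = (of_nat (a x) - of_nat (b x)) / of_nat (c x)) \<Longrightarrow> compq_in A f"
  unfolding compq_in_def by blast

lemma compq_inE:
  assumes "compq_in A f"
  obtains a b c where "comp_in A a" "comp_in A b" "comp_in A c" "\<forall>x. 0 < c x"
    "f = (\<lambda>x. (of_nat (a x) - of_nat (b x)) / of_nat (c x))"
proof -
  from assms obtain a b c where *: "comp_in A a" "comp_in A b" "comp_in A c"
    and f: "\<forall>x. 0 < c x \<and> f x = (of_nat (a x) - of_nat (b x)) / of_nat (c x)"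
    unfolding compq_in_def by blast
  have "f = (\<lambda>x. (of_nat (a x) - of_nat (b x)) / of_nat (c x))" using f by (intro ext) blast
  with * f show ?thesis using that by blast
qed

lemma compq_in_comp:
  assumes "compq_in A f" "comp_in A g" shows "compq_in A (\<lambda>x. f (g x))"
  using assms(1)
proof (rule compq_inE)
  fix a b c :: "nat \<Rightarrow> nat"
  assume *: "comp_in A a" "comp_in A b" "comp_in A c" "\<forall>x. 0 < c x" "f = (\<lambda>x. (of_nat (a x) - of_nat (b x)) / of_nat (c x))"
  show ?thesis
    unfolding *(5) using *(4)
    by (intro compq_inI[OF comp_in_comp[OF *(1) assms(2)] comp_in_comp[OF *(2) assms(2)] comp_in_comp[OF *(3) assms(2)]]) simp
qed

lemma compq_in_of_nat [computable]: "comp_in A f \<Longrightarrow> compq_in A (\<lambda>x. of_nat (f x))"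
  by (rule compq_inI[where b = "\<lambda>x. 0" and c = "\<lambda>x. 1"]) (auto intro: computable)

lemma compq_in_diff [computable]:
  assumes "compq_in A f" "compq_in A g" shows "compq_in A (\<lambda>x. f x - g x)"
proof -
  obtain a b c where 1: "comp_in A a" "comp_in A b" "comp_in A c" "\<forall>x. 0 < c x" "f = (\<lambda>x. (of_nat (a x) - of_nat (b x)) / of_nat (c x))"
    using assms(1) by (rule compq_inE)
  obtain a' b' c' where 2: "comp_in A a'" "comp_in A b'" "comp_in A c'" "\<forall>x. 0 < c' x" "g = (\<lambda>x. (of_nat (a' x) - of_nat (b' x)) / of_nat (c' x))"
    using assms(2) by (rule compq_inE)
  show ?thesis
  proof (rule compq_inI)
    show "comp_in A (\<lambda>x. a x * c' x + b' x * c x)" "comp_in A (\<lambda>x. b x * c' x + a' x * c x)" "comp_in A (\<lambda>x. c x * c' x)"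
      using 1 2 by (auto intro!: computable)
    show "0 < c x * c' x \<and> f x - g x = (of_nat (a x * c' x + b' x * c x) - of_nat (b x * c' x + a' x * c x)) / of_nat (c x * c' x)" for x
      using 1(4)[rule_format, of x] 2(4)[rule_format, of x] unfolding 1(5) 2(5) by (simp add: divide_simps) (simp add: algebra_simps)
  qed
qed

lemma compq_in_of_nat_const [computable]: "compq_in A (\<lambda>x. 0)" "compq_in A (\<lambda>x. 1)"
  using compq_in_of_nat[OF comp_in_const, of A 0] compq_in_of_nat[OF comp_in_const, of A 1] by simp_all

lemma compq_in_minus [computable]: "compq_in A f \<Longrightarrow> compq_in A (\<lambda>x. - f x)"
  using compq_in_diff[OF compq_in_of_nat_const(1)] by simp

lemma compq_in_add [computable]: "compq_in A f \<Longrightarrow> compq_in A g \<Longrightarrow> compq_in A (\<lambda>x. f x + g x)"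
  using compq_in_diff[OF _ compq_in_minus] by simp

lemma dec_in_rat_less [computable]:
  assumes "compq_in A f" "compq_in A g" shows "dec_in A (\<lambda>x. f x < g x)"
proof -
  obtain a b c where 1: "comp_in A a" "comp_in A b" "comp_in A c" "\<forall>x. 0 < c x" "(\<lambda>x. g x - f x) = (\<lambda>x. (of_nat (a x) - of_nat (b x)) / of_nat (c x))"
    using compq_in_diff[OF assms(2,1)] by (rule compq_inE)
  have "f x < g x \<longleftrightarrow> b x < a x" for x
  proof -
    have "f x < g x \<longleftrightarrow> 0 < g x - f x" by simp
    also have "\<dots> \<longleftrightarrow> 0 < (of_nat (a x) - of_nat (b x)) / (of_nat (c x) :: rat)"
      using fun_cong[OF 1(5), of x] by simp
    also have "\<dots> \<longleftrightarrow> b x < a x" using 1(4)[rule_format, of x] by (simp add: zero_less_divide_iff)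
    finally show ?thesis .
  qed
  then show ?thesis using 1 by (simp add: computable)
qed

lemma dec_in_rat_le [computable]: "compq_in A f \<Longrightarrow> compq_in A g \<Longrightarrow> dec_in A (\<lambda>x. f x \<le> g x)"
  unfolding not_less[symmetric] by (intro computable)

lemma compq_in_if [computable]:
  assumes P: "dec_in A P" and f: "compq_in A f" and g: "compq_in A g" shows "compq_in A (\<lambda>x. if P x then f x else g x)"
proof -
  obtain a b c where 1: "comp_in A a" "comp_in A b" "comp_in A c" "\<forall>x. 0 < c x" "f = (\<lambda>x. (of_nat (a x) - of_nat (b x)) / of_nat (c x))"
    using f by (rule compq_inE)
  obtain a' b' c' where 2: "comp_in A a'" "comp_in A b'" "comp_in A c'" "\<forall>x. 0 < c' x" "g = (\<lambda>x. (of_nat (a' x) - of_nat (b' x)) / of_nat (c' x))"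
    using g by (rule compq_inE)
  show ?thesis
    by (rule compq_inI[where a = "\<lambda>x. if P x then a x else a' x" and b = "\<lambda>x. if P x then b x else b' x" and c = "\<lambda>x. if P x then c x else c' x"])
      (use 1 2 P in \<open>auto intro: comp_in_if\<close>)
qed

text \<open>The divisor has the sign of \<open>a - b\<close> in its representation, and each sign
  gets its own formula. For \<open>a = b\<close> the quotient is 0 by the convention on division by
  zero.\<close>

lemma compq_in_divide [computable]:
  assumes f: "compq_in A f" and g: "compq_in A g" shows "compq_in A (\<lambda>x. f x / g x)"
proof -
  have pos: "compq_in A (\<lambda>x. f x / of_nat (Suc (h x)))" if h: "comp_in A h" for h
  proof -
    obtain a b c where 1: "comp_in A a" "comp_in A b" "comp_in A c" "\<forall>x. 0 < c x" "f = (\<lambda>x. (of_nat (a x) - of_nat (b x)) / of_nat (c x))"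
      using f by (rule compq_inE)
    show ?thesis
      by (rule compq_inI[where a = a and b = b and c = "\<lambda>x. c x * Suc (h x)"])
        (use 1 h in \<open>auto intro!: computable simp: 1(5) distrib_left\<close>)
  qed
  have mult: "compq_in A (\<lambda>x. f x * of_nat (h x))" if f: "compq_in A f" and h: "comp_in A h" for f h
  proof -
    obtain a b c where 1: "comp_in A a" "comp_in A b" "comp_in A c" "\<forall>x. 0 < c x" "f = (\<lambda>x. (of_nat (a x) - of_nat (b x)) / of_nat (c x))"
      using f by (rule compq_inE)
    show ?thesis
      by (rule compq_inI[where a = "\<lambda>x. a x * h x" and b = "\<lambda>x. b x * h x" and c = c])
        (use 1 h in \<open>auto intro!: computable simp: 1(5) algebra_simps diff_divide_distrib\<close>)
  qed
  obtain a b c where 2: "comp_in A a" "comp_in A b" "comp_in A c" "\<forall>x. 0 < c x" "g = (\<lambda>x. (of_nat (a x) - of_nat (b x)) / of_nat (c x))"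
    using g by (rule compq_inE)
  \<comment> \<open>Writing the denominators as successors makes them positive without a side
    condition.\<close>
  have eq: "f x / g x = (if a x = b x then 0 else if b x < a x then f x / of_nat (Suc (a x - b x - 1)) * of_nat (c x)
      else - (f x / of_nat (Suc (b x - a x - 1)) * of_nat (c x)))" for x
  proof (cases "a x" "b x" rule: linorder_cases)
    case less
    then have "Suc (b x - a x - 1) = b x - a x" by simp
    then show ?thesis using less 2(4)[rule_format, of x] unfolding 2(5)
      by (simp add: of_nat_diff less_imp_le divide_simps) (simp add: algebra_simps)
  next
    case greater
    then have "Suc (a x - b x - 1) = a x - b x" by simp
    then show ?thesis using greater 2(4)[rule_format, of x] unfolding 2(5)
      by (simp add: of_nat_diff less_imp_le divide_simps)
  qed (simp add: 2(5))
  show ?thesis unfolding eq by (intro computable mult pos 2)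
qed

lemma comp_in_nat_floor [computable]:
  assumes f: "compq_in A f" shows "comp_in A (\<lambda>x. nat \<lfloor>f x\<rfloor>)"
proof -
  obtain a b c where 1: "comp_in A a" "comp_in A b" "comp_in A c" "\<forall>x. 0 < c x" "f = (\<lambda>x. (of_nat (a x) - of_nat (b x)) / of_nat (c x))"
    using f by (rule compq_inE)
  have "nat \<lfloor>f x\<rfloor> = (a x - b x) div c x" for x
  proof (cases "b x \<le> a x")
    case True
    then have "f x = of_nat (a x - b x) / of_nat (c x)" by (simp add: 1(5) of_nat_diff)
    then show ?thesis by (simp add: floor_divide_of_nat_eq)
  next
    \<comment> \<open>A negative value gives 0 on both sides, as \<open>nat\<close> and subtraction
      both truncate.\<close>
    case False
    then have "f x \<le> 0" using 1(4)[rule_format, of x] unfolding 1(5) by (simp add: divide_simps)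
    then show ?thesis using False by simp
  qed
  then show ?thesis using 1 by (simp add: computable)
qed

lemma of_int_int_decode:
  "of_int (int_decode n) = (if even n then of_nat (n div 2) else - of_nat (n div 2) - 1)"
  by (simp add: int_decode_def sum_decode_def)

lemma compq_in_nat_to_rat [computable]:
  assumes "comp_in A f" shows "compq_in A (\<lambda>x. nat_to_rat_surj (f x))"
proof -
  have "nat_to_rat_surj n = of_int (int_decode (pfst n)) / of_int (int_decode (psnd n))" for n
    by (simp add: nat_to_rat_surj_def Let_def case_prod_unfold Fract_of_int_quotient)
  then show ?thesis unfolding of_int_int_decode using assms by (simp add: computable)
qed

section \<open>Step sets\<close>

text \<open>The members of \<open>B_eta\<close> are the sets of rationals whose indicator is a right-continuous
  step function with finitely many break points.\<close>

definition breaks :: "rat set \<Rightarrow> rat set \<Rightarrow> bool" where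
  "breaks E X \<longleftrightarrow> (\<forall>q q'. q < q' \<and> (\<forall>e\<in>E. \<not> (q < e \<and> e \<le> q')) \<longrightarrow> (q \<in> X \<longleftrightarrow> q' \<in> X))"

lemma breaksD: "breaks E X \<Longrightarrow> q < q' \<Longrightarrow> (\<And>e. e \<in> E \<Longrightarrow> q < e \<Longrightarrow> e \<le> q' \<Longrightarrow> False) \<Longrightarrow> q \<in> X \<longleftrightarrow> q' \<in> X"
  unfolding breaks_def by blast

lemma breaks_mono: "breaks E X \<Longrightarrow> E \<subseteq> E' \<Longrightarrow> breaks E' X"
  unfolding breaks_def by blast

lemma breaks_iff: "breaks E X \<Longrightarrow> breaks E Y \<Longrightarrow> breaks E {q. q \<in> X \<longleftrightarrow> q \<in> Y}"
  unfolding breaks_def by blast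

lemma breaks_ops:
  "breaks E X \<Longrightarrow> breaks E (- X)" "breaks E X \<Longrightarrow> breaks E' Y \<Longrightarrow> breaks (E \<union> E') (X \<union> Y)"
  unfolding breaks_def by blast+

text \<open>A point takes over membership from the largest break point not above it, or from
  \<open>q0\<close> if there is none. Hence finitely many points decide whether a step set is
  everything.\<close>

lemma breaks_eq_UNIV:
  assumes "breaks E X" "finite E" "E \<subseteq> X" "\<forall>e\<in>E. q0 < e" "q0 \<in> X" shows "X = UNIV"
proof -
  have "q \<in> X" for q
  proof (cases "\<exists>e\<in>E. e \<le> q")
    case True
    define e where "e = Max {e\<in>E. e \<le> q}"
    have e: "e \<in> {e\<in>E. e \<le> q}" unfolding e_def using True assms(2) by (intro Max_in) auto
    have max: "e' \<le> e" if "e' \<in> E" "e' \<le> q" for e' unfolding e_def using that assms(2) by (intro Max_ge) auto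
    show ?thesis
    proof (cases "e = q")
      case False
      then have "e \<in> X \<longleftrightarrow> q \<in> X" using e max by (intro breaksD[OF assms(1)]) force+
      then show ?thesis using e assms(3) by auto
    qed (use e assms(3) in auto)
  next
    case False
    show ?thesis
    proof (cases q q0 rule: linorder_cases)
      case less
      then have "q \<in> X \<longleftrightarrow> q0 \<in> X" using assms(4) by (intro breaksD[OF assms(1)]) force+
      then show ?thesis using assms(5) by simp
    next
      case greater
      then have "q0 \<in> X \<longleftrightarrow> q \<in> X" using False by (intro breaksD[OF assms(1)]) force+
      then show ?thesis using assms(5) by simp
    qed (use assms(5) in simp)
  qed
  then show ?thesis by blast
qed

definition end_points :: "nat \<Rightarrow> rat set" where
  "end_points n = {nat_to_rat_surj m | m k. k \<in> set (list_decode n) \<and> (pfst k = Suc m \<or> psnd k = Suc m)}"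

lemma end_points_ball:
  "(\<forall>e\<in>end_points n. R e) \<longleftrightarrow> (\<forall>k\<in>set (list_decode n). (pfst k \<noteq> 0 \<longrightarrow> R (nat_to_rat_surj (pfst k - 1))) \<and>
     (psnd k \<noteq> 0 \<longrightarrow> R (nat_to_rat_surj (psnd k - 1))))" (is "?L \<longleftrightarrow> ?R")
proof
  show "?L \<Longrightarrow> ?R" unfolding end_points_def by (auto simp: gr0_conv_Suc) (metis diff_Suc_1 not0_implies_Suc)+
  show "?R \<Longrightarrow> ?L" unfolding end_points_def by force
qed

lemma finite_end_points: "finite (end_points n)"
proof (rule finite_subset)
  let ?S = "set (list_decode n)"
  show "end_points n \<subseteq> (\<lambda>k. nat_to_rat_surj (pfst k - 1)) ` ?S \<union> (\<lambda>k. nat_to_rat_surj (psnd k - 1)) ` ?S"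
    unfolding end_points_def by force
qed simp

lemma interval_of_iff:
  "q \<in> interval_of k \<longleftrightarrow> (pfst k = 0 \<or> nat_to_rat_surj (pfst k - 1) \<le> q) \<and> (psnd k = 0 \<or> q < nat_to_rat_surj (psnd k - 1))"
  by (auto simp: interval_of_def case_prod_unfold split: nat.splits)

lemma B_eta_elem_iff: "q \<in> B_eta_elem n \<longleftrightarrow> (\<exists>k\<in>set (list_decode n). q \<in> interval_of k)"
  by (simp add: B_eta_elem_def)

lemma breaks_end_points: "breaks (end_points n) (B_eta_elem n)"
  unfolding breaks_def
proof (intro allI impI, elim conjE)
  fix q q' :: rat assume lt: "q < q'" and e: "\<forall>e\<in>end_points n. \<not> (q < e \<and> e \<le> q')"
  have "q \<in> interval_of k \<longleftrightarrow> q' \<in> interval_of k" if "k \<in> set (list_decode n)" for k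
    using e[unfolded end_points_ball, rule_format, OF that] lt unfolding interval_of_iff by auto
  then show "q \<in> B_eta_elem n \<longleftrightarrow> q' \<in> B_eta_elem n" unfolding B_eta_elem_iff by blast
qed

text \<open>The break points cut the line into finitely many half-open pieces on which membership is
  constant, and \<open>X\<close> is the union of the pieces inside it.\<close>

lemma breaks_imp_B_eta:
  assumes X: "breaks E X" and E: "finite E" shows "X \<in> B_eta"
proof -
  \<comment> \<open>Besides the piece to the left of all break points there is one from each break
    point up to the next; the last one is unbounded.\<close>
  define pieces where "pieces = insert {q. \<forall>e\<in>E. q < e} ((\<lambda>e. {q. e \<le> q \<and> (\<forall>e'\<in>E. e < e' \<longrightarrow> q < e')}) ` E)"
  have below: "{q. \<forall>e\<in>E'. q < e} = (if E' = {} then UNIV else {..<Min E'})" if "finite E'" for E' :: "rat set"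
  proof (cases "E' = {}")
    case False
    show ?thesis unfolding if_not_P[OF False]
      by (auto simp: Min_gr_iff[OF that False])
  qed simp
  have half: "P \<in> half_open_intervals" if "P \<in> pieces" for P
  proof -
    from that consider "P = {q. \<forall>e\<in>E. q < e}" | e where "P = {e..} \<inter> {q. \<forall>e'\<in>{e'\<in>E. e < e'}. q < e'}"
      unfolding pieces_def by (auto simp: atLeast_def)
    then show ?thesis
    proof cases
      case 1
      then show ?thesis unfolding below[OF E] by (auto simp: half_open_intervals_def)
    next
      case 2
      have "finite {e'\<in>E. e < e'}" using E by simp
      note b = below[OF this]
      show ?thesis
      proof (cases "{e'\<in>E. e < e'} = {}")
        case True
        then have "P = {e..}" using 2 b by simp
        then show ?thesis by (auto simp: half_open_intervals_def)
      next
        case False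
        then have "P = {e..<Min {e'\<in>E. e < e'}}" using 2 b by (auto simp: atLeastLessThan_def)
        then show ?thesis by (auto simp: half_open_intervals_def)
      qed
    qed
  qed
  have fin: "finite pieces" unfolding pieces_def using E by simp
  have cover: "\<exists>P\<in>pieces. q \<in> P" for q
  proof (cases "\<forall>e\<in>E. q < e")
    case True
    then show ?thesis by (intro bexI[of _ "{q. \<forall>e\<in>E. q < e}"]) (simp_all add: pieces_def)
  next
    case False
    define e where "e = Max {e\<in>E. e \<le> q}"
    have e: "e \<in> {e\<in>E. e \<le> q}" unfolding e_def using False E by (intro Max_in) (auto simp: not_less)
    have "e' \<le> e" if "e' \<in> E" "e' \<le> q" for e' unfolding e_def using that E by (intro Max_ge) auto
    then have "\<forall>e'\<in>E. e < e' \<longrightarrow> q < e'" by (meson not_less)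
    with e show ?thesis by (intro bexI[of _ "{q. e \<le> q \<and> (\<forall>e'\<in>E. e < e' \<longrightarrow> q < e')}"]) (simp_all add: pieces_def)
  qed
  have const: "q \<in> X \<longleftrightarrow> q' \<in> X" if "P \<in> pieces" "q \<in> P" "q' \<in> P" for P q q'
  proof -
    have *: "q \<in> X \<longleftrightarrow> q' \<in> X" if "q < q'" "q \<in> P" "q' \<in> P" for q q'
    proof (rule breaksD[OF X \<open>q < q'\<close>])
      fix e assume e: "e \<in> E" "q < e" "e \<le> q'"
      from \<open>P \<in> pieces\<close> consider "P = {q. \<forall>e\<in>E. q < e}" | d where "P = {q. d \<le> q \<and> (\<forall>e'\<in>E. d < e' \<longrightarrow> q < e')}"
        unfolding pieces_def by blast
      then show False
      proof cases
        case 1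
        then show False using that(3) e by (auto simp: not_less[symmetric])
      next
        case 2
        then have "d < e" "d < e \<longrightarrow> q' < e" using that(2,3) e by auto
        then show False using e(3) by simp
      qed
    qed
    consider "q < q'" | "q = q'" | "q' < q" by (rule linorder_cases)
    then show ?thesis
    proof cases
      case 1 then show ?thesis using that(2,3) by (rule *)
    next
      case 3 then show ?thesis using *[of q' q] that(2,3) by blast
    qed simp
  qed
  have "X = \<Union>{P\<in>pieces. P \<subseteq> X}"
  proof (intro subset_antisym subsetI)
    fix q assume q: "q \<in> X"
    from cover obtain P where P: "P \<in> pieces" "q \<in> P" by blast
    then have "P \<subseteq> X" using const q by blast
    then show "q \<in> \<Union>{P\<in>pieces. P \<subseteq> X}" using P by blast
  qed blast
  moreover have "finite {P\<in>pieces. P \<subseteq> X}" "{P\<in>pieces. P \<subseteq> X} \<subseteq> half_open_intervals"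
    using half fin by auto
  ultimately show ?thesis unfolding B_eta_def by blast
qed

lemma B_eta_iff: "X \<in> B_eta \<longleftrightarrow> (\<exists>E. finite E \<and> breaks E X)"
proof
  assume "X \<in> B_eta"
  then obtain n where "X = B_eta_elem n" unfolding range_B_eta_elem[symmetric] by blast
  then show "\<exists>E. finite E \<and> breaks E X" using breaks_end_points[of n] finite_end_points[of n] by blast
qed (auto intro: breaks_imp_B_eta)

lemma B_eta_Compl: "X \<in> B_eta \<Longrightarrow> - X \<in> B_eta"
  unfolding B_eta_iff by (blast intro: breaks_ops)

lemma B_eta_Un: "X \<in> B_eta \<Longrightarrow> Y \<in> B_eta \<Longrightarrow> X \<union> Y \<in> B_eta"
  unfolding B_eta_iff by (blast intro: breaks_ops)

lemma B_eta_Int: "X \<in> B_eta \<Longrightarrow> Y \<in> B_eta \<Longrightarrow> X \<inter> Y \<in> B_eta"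
  using B_eta_Compl[OF B_eta_Un[OF B_eta_Compl B_eta_Compl]] by fastforce

lemma B_eta_empty: "{} \<in> B_eta" and B_eta_UNIV: "UNIV \<in> B_eta"
  unfolding B_eta_iff breaks_def by auto

lemma B_eta_elem_in: "B_eta_elem n \<in> B_eta" using range_B_eta_elem by blast

section \<open>Permutations of the unit intervals\<close>

definition shuffle :: "(nat \<Rightarrow> nat) \<Rightarrow> rat \<Rightarrow> rat" where
  "shuffle \<pi> q = (if q < 0 then q else of_nat (\<pi> (nat \<lfloor>q\<rfloor>)) + (q - of_nat (nat \<lfloor>q\<rfloor>)))"

definition unit_interval :: "nat \<Rightarrow> rat set" where "unit_interval n = {of_nat n..<of_nat n + 1}"

lemma unit_interval_iff: "q \<in> unit_interval n \<longleftrightarrow> 0 \<le> q \<and> nat \<lfloor>q\<rfloor> = n"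
proof
  assume *: "0 \<le> q \<and> nat \<lfloor>q\<rfloor> = n"
  then have "\<lfloor>q\<rfloor> = int n" by auto
  then show "q \<in> unit_interval n" by (simp add: unit_interval_def floor_eq_iff)
next
  assume q: "q \<in> unit_interval n"
  then have "\<lfloor>q\<rfloor> = int n" by (simp add: unit_interval_def floor_eq_iff)
  moreover have "0 \<le> q" using q of_nat_0_le_iff[of n] unfolding unit_interval_def by (simp add: order_trans[of 0 "of_nat n"])
  ultimately show "0 \<le> q \<and> nat \<lfloor>q\<rfloor> = n" by simp
qed

lemma shuffle_neg: "q < 0 \<Longrightarrow> shuffle \<pi> q = q" by (simp add: shuffle_def)

lemma shuffle_unit: "q \<in> unit_interval n \<Longrightarrow> shuffle \<pi> q = of_nat (\<pi> n) + (q - of_nat n)"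
  by (auto simp: shuffle_def unit_interval_iff)

lemma shuffle_in: "q \<in> unit_interval n \<Longrightarrow> shuffle \<pi> q \<in> unit_interval (\<pi> n)"
  unfolding shuffle_unit by (simp add: unit_interval_def)

lemma rat_unit_cases: obtains "q < 0" | n where "q \<in> unit_interval n"
  using unit_interval_iff[of q] by (cases "q < 0") auto

lemma unit_interval_nonneg: "q \<in> unit_interval n \<Longrightarrow> \<not> q < 0"
  by (simp add: unit_interval_iff)

lemma shuffle_comp: "shuffle \<pi> (shuffle \<rho> q) = shuffle (\<pi> \<circ> \<rho>) q"
proof (cases q rule: rat_unit_cases)
  case 1 then show ?thesis by (simp add: shuffle_neg)
next
  case (2 n)
  show ?thesis unfolding shuffle_unit[OF shuffle_in[OF 2]] unfolding shuffle_unit[OF 2] by simp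
qed

lemma shuffle_id: "shuffle (\<lambda>x. x) q = q"
  by (cases q rule: rat_unit_cases) (auto simp: shuffle_neg shuffle_unit)

lemma shuffle_the_inv: "bij \<pi> \<Longrightarrow> shuffle (the_inv \<pi>) (shuffle \<pi> q) = q" "bij \<pi> \<Longrightarrow> shuffle \<pi> (shuffle (the_inv \<pi>) q) = q"
  unfolding shuffle_comp by (auto simp: comp_def bij_def f_the_inv_into_f the_inv_f_f shuffle_id)

lemma inj_shuffle: "bij \<pi> \<Longrightarrow> inj (shuffle \<pi>)"
  by (rule inj_on_inverseI[of _ "shuffle (the_inv \<pi>)"]) (simp add: shuffle_the_inv)

lemma shuffle_image_iff: "bij \<pi> \<Longrightarrow> q \<in> shuffle \<pi> ` X \<longleftrightarrow> shuffle (the_inv \<pi>) q \<in> X"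
  by (metis image_iff shuffle_the_inv)

text \<open>Pulling back creates breaks at preimages of old ones and at integers, where neighbouring
  unit intervals are torn apart. From \<open>M\<close> on every interval lands to the right of all
  old breaks, where membership no longer changes, so finitely many integers suffice.\<close>

lemma breaks_shuffle_vimage:
  assumes Y: "breaks E Y" and M: "\<forall>i\<ge>M. \<forall>e\<in>E. e < of_nat (\<pi> i)"
  shows "breaks ({a. shuffle \<pi> a \<in> E} \<union> of_nat ` {..M}) {q. shuffle \<pi> q \<in> Y}"
  unfolding breaks_def mem_Collect_eq
proof (intro allI impI, elim conjE)
  fix q q' :: rat
  assume lt: "q < q'" and b: "\<forall>e\<in>{a. shuffle \<pi> a \<in> E} \<union> of_nat ` {..M}. \<not> (q < e \<and> e \<le> q')"
  show "shuffle \<pi> q \<in> Y \<longleftrightarrow> shuffle \<pi> q' \<in> Y"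
  proof (cases q rule: rat_unit_cases)
    case 1
    \<comment> \<open>The integer 0 separates the fixed negative half-line from the unit intervals
      and is among the breaks.\<close>
    have "q' < 0" using b[rule_format, of 0] 1 by (force simp: image_iff)
    then show ?thesis
      unfolding shuffle_neg[OF 1] shuffle_neg[OF \<open>q' < 0\<close>]
      using breaksD[OF Y lt] b by (metis (no_types, lifting) UnI1 mem_Collect_eq shuffle_neg order_le_less_trans)
  next
    case (2 n)
    have "\<not> q' < 0" using unit_interval_nonneg[OF 2] lt by linarith
    then obtain n' where n': "q' \<in> unit_interval n'" by (cases q' rule: rat_unit_cases) auto
    show ?thesis
    proof (cases "n = n'")
      case True
      show ?thesis
      proof (rule breaksD[OF Y])
        show "shuffle \<pi> q < shuffle \<pi> q'" using lt 2 n' True by (simp add: shuffle_unit)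
        fix e assume e: "e \<in> E" "shuffle \<pi> q < e" "e \<le> shuffle \<pi> q'"
        let ?a = "e - of_nat (\<pi> n) + of_nat n"
        have a: "q < ?a" "?a \<le> q'" using e 2 n' True by (simp_all add: shuffle_unit)
        then have "?a \<in> unit_interval n" using 2 n' True by (auto simp: unit_interval_def)
        then have "shuffle \<pi> ?a = e" by (simp add: shuffle_unit)
        then show False using b a e(1) by auto
      qed
    next
      case False
      have "nat \<lfloor>q\<rfloor> \<le> nat \<lfloor>q'\<rfloor>" using lt by (intro nat_mono floor_mono) simp
      then have nn: "n < n'" using False 2 n' by (simp add: unit_interval_iff)
      \<comment> \<open>The integer \<open>Suc n\<close> lies in the gap \<open>(q, q']\<close>, so
        it is not a listed break and must exceed \<open>M\<close>.\<close>
      have "q < of_nat (Suc n)" using 2 by (simp add: unit_interval_def)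
      moreover have "of_nat (Suc n) \<le> q'"
        using n' nn of_nat_mono[of "Suc n" n', where 'a = rat] by (simp add: unit_interval_def)
      ultimately have "Suc n \<notin> {..M}" using b by blast
      then have "M \<le> n" "M \<le> n'" using nn by auto
      then have beyond: "\<forall>e\<in>E. e < shuffle \<pi> q" "\<forall>e\<in>E. e < shuffle \<pi> q'"
        using M shuffle_in[OF 2, of \<pi>] shuffle_in[OF n', of \<pi>] unfolding unit_interval_def
        by (auto intro: less_le_trans)
      show ?thesis
      proof (cases "shuffle \<pi> q" "shuffle \<pi> q'" rule: linorder_cases)
        case less
        then show ?thesis using beyond by (intro breaksD[OF Y]) force+
      next
        case greater
        then have "shuffle \<pi> q' \<in> Y \<longleftrightarrow> shuffle \<pi> q \<in> Y" using beyond by (intro breaksD[OF Y]) force+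
        then show ?thesis by simp
      qed simp
    qed
  qed
qed

text \<open>The points where \<open>X\<close> agrees with the preimage of \<open>Y\<close> form a
  step set with known breaks. It is everything iff it contains these breaks and one point to the
  left of them, here \<open>- of_nat (Suc L)\<close>.\<close>

lemma shuffle_eq_iff_test:
  assumes \<pi>: "bij \<pi>" and E: "breaks E X" "breaks E' Y" "finite E" "finite E'"
    and L: "\<forall>e\<in>E \<union> E'. - of_nat L < e \<and> e < of_nat L" and M: "\<forall>j\<le>L. the_inv \<pi> j < M"
  shows "shuffle \<pi> ` X = Y \<longleftrightarrow>
    (\<forall>e\<in>E. e \<in> X \<longleftrightarrow> shuffle \<pi> e \<in> Y) \<and> (\<forall>e\<in>E'. shuffle (the_inv \<pi>) e \<in> X \<longleftrightarrow> e \<in> Y) \<and>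
    (\<forall>i\<le>M. of_nat i \<in> X \<longleftrightarrow> shuffle \<pi> (of_nat i) \<in> Y) \<and> (- of_nat (Suc L) \<in> X \<longleftrightarrow> shuffle \<pi> (- of_nat (Suc L)) \<in> Y)"
    (is "_ \<longleftrightarrow> ?T")
proof -
  let ?Z = "{q. q \<in> X \<longleftrightarrow> shuffle \<pi> q \<in> Y}"
  let ?E = "E \<union> ({a. shuffle \<pi> a \<in> E'} \<union> of_nat ` {..M})"
  have im: "shuffle \<pi> ` X = Y \<longleftrightarrow> ?Z = UNIV"
    using shuffle_the_inv[OF \<pi>] by (auto simp: set_eq_iff shuffle_image_iff[OF \<pi>]; metis)
  \<comment> \<open>All numbers that \<open>\<pi>\<close> sends to at most \<open>L\<close> are
    below \<open>M\<close>; the others go beyond every break of \<open>Y\<close>.\<close>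
  have "e < of_nat (\<pi> i)" if "M \<le> i" "e \<in> E'" for i e
  proof -
    have "L < \<pi> i"
    proof (rule ccontr)
      assume "\<not> L < \<pi> i"
      then have "the_inv \<pi> (\<pi> i) < M" using M by simp
      then show False using that(1) \<pi> by (simp add: bij_def the_inv_f_f)
    qed
    then have "of_nat L < (of_nat (\<pi> i) :: rat)" by simp
    then show ?thesis using L that(2) by (meson UnI2 less_trans)
  qed
  then have "breaks ({a. shuffle \<pi> a \<in> E'} \<union> of_nat ` {..M}) {q. shuffle \<pi> q \<in> Y}"
    by (intro breaks_shuffle_vimage[OF E(2)]) blast
  from breaks_iff[OF breaks_mono[OF E(1)] breaks_mono[OF this], of ?E]
  have b: "breaks ?E ?Z" by simp
  have fin: "finite ?E"
    using E(3,4) finite_vimageI[OF E(4) inj_shuffle[OF \<pi>]] by (simp add: vimage_def)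
  have low: "\<forall>e\<in>?E. - of_nat (Suc L) < e"
  proof
    fix e assume e: "e \<in> ?E"
    have *: "- of_nat (Suc L) < (- of_nat L :: rat)" "- of_nat (Suc L) < (0 :: rat)" by simp_all
    show "- of_nat (Suc L) < e"
    proof (cases "e < 0")
      case True
      have "e \<in> E \<union> E'" using e True by (auto simp: shuffle_neg)
      then show ?thesis using L *(1) by (meson less_trans)
    next
      case False
      then show ?thesis using *(2) by linarith
    qed
  qed
  have "?Z = UNIV \<longleftrightarrow> ?E \<subseteq> ?Z \<and> - of_nat (Suc L) \<in> ?Z"
    using breaks_eq_UNIV[OF b fin _ low] by blast
  also have "\<dots> \<longleftrightarrow> ?T"
  proof -
    have "(\<forall>a. shuffle \<pi> a \<in> E' \<longrightarrow> (a \<in> X \<longleftrightarrow> shuffle \<pi> a \<in> Y)) \<longleftrightarrow> (\<forall>e\<in>E'. shuffle (the_inv \<pi>) e \<in> X \<longleftrightarrow> e \<in> Y)"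
      using shuffle_the_inv[OF \<pi>] by metis
    moreover have "?E \<subseteq> ?Z \<longleftrightarrow> (\<forall>e\<in>E. e \<in> ?Z) \<and> (\<forall>a. shuffle \<pi> a \<in> E' \<longrightarrow> a \<in> ?Z) \<and> (\<forall>i\<le>M. of_nat i \<in> ?Z)"
      by blast
    ultimately show ?thesis unfolding mem_Collect_eq by (simp only: conj_assoc)
  qed
  finally show ?thesis by (rule trans[OF im])
qed

lemma shuffle_B_eta:
  assumes \<pi>: "bij \<pi>" and X: "X \<in> B_eta" shows "shuffle \<pi> ` X \<in> B_eta"
proof -
  let ?\<pi> = "the_inv \<pi>"
  obtain E where E: "finite E" "breaks E X" using X unfolding B_eta_iff by blast
  have \<pi>': "bij ?\<pi>" using bij_betw_the_inv_into[OF \<pi>] by simp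
  obtain L :: nat where L: "\<forall>e\<in>E. e < of_nat L"
  proof -
    obtain L :: nat where "Max (insert 0 E) < of_nat L" using reals_Archimedean2 by blast
    then show ?thesis using that E(1) by (metis Max_less_iff finite.insertI insertI2 insert_not_empty)
  qed
  \<comment> \<open>A bijection maps only finitely many numbers below \<open>L\<close>; past them
    the images avoid all breaks.\<close>
  have "finite {i. ?\<pi> i < L}"
    using finite_vimageI[of "{..<L}" ?\<pi>] \<pi>' by (simp add: vimage_def bij_def)
  then obtain M where M: "\<forall>i\<in>{i. ?\<pi> i < L}. i < M" unfolding finite_nat_set_iff_bounded by blast
  have "e < of_nat (?\<pi> i)" if "M \<le> i" "e \<in> E" for i e
  proof -
    have "L \<le> ?\<pi> i" using M that(1) by (meson leD leI mem_Collect_eq)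
    then show ?thesis using L that(2) of_nat_mono[of L "?\<pi> i", where 'a = rat] by force
  qed
  then have "breaks ({a. shuffle ?\<pi> a \<in> E} \<union> of_nat ` {..M}) {q. shuffle ?\<pi> q \<in> X}"
    by (intro breaks_shuffle_vimage[OF E(2)]) blast
  moreover have "{q. shuffle ?\<pi> q \<in> X} = shuffle \<pi> ` X" using shuffle_image_iff[OF \<pi>] by auto
  moreover have "finite ({a. shuffle ?\<pi> a \<in> E} \<union> of_nat ` {..M})"
    using finite_vimageI[OF E(1) inj_shuffle[OF \<pi>']] by (simp add: vimage_def)
  ultimately show ?thesis unfolding B_eta_iff by metis
qed

lemma unit_interval_B_eta: "unit_interval n \<in> B_eta"
  unfolding B_eta_iff breaks_def unit_interval_def
  by (rule exI[of _ "{of_nat n, of_nat n + 1}"]) force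

section \<open>Automorphisms of the interval algebra\<close>

lemma dec_in_B_eta_elem [computable]:
  assumes f: "compq_in A f" and g: "comp_in A g" shows "dec_in A (\<lambda>x. f x \<in> B_eta_elem (g x))"
  unfolding B_eta_elem_iff interval_of_iff by (intro computable compq_in_comp[OF f] g)

lemma compq_in_shuffle:
  assumes "comp_in A \<pi>" "compq_in A f" shows "compq_in A (\<lambda>x. shuffle \<pi> (f x))"
  unfolding shuffle_def by (intro computable comp_in_comp[OF assms(1)] assms(2))

lemma ex_bound_end_points: "\<exists>L::nat. \<forall>e\<in>end_points a \<union> end_points b. - of_nat L < e \<and> e < of_nat L"
proof -
  let ?E = "end_points a \<union> end_points b"
  obtain L :: nat where L: "Max (insert 0 (abs ` ?E)) < of_nat L" using reals_Archimedean2 by blast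
  have "\<bar>e\<bar> < of_nat L" if "e \<in> ?E" for e
  proof -
    have "\<bar>e\<bar> \<le> Max (insert 0 (abs ` ?E))" using that finite_end_points by (intro Max_ge) auto
    then show ?thesis using L by simp
  qed
  then show ?thesis by (intro exI[of _ L]) (auto simp: abs_less_iff minus_less_iff)
qed

text \<open>The bounds of the finite test are found by search; after that all its quantifiers are
  bounded.\<close>

lemma dec_in_shuffle_image:
  assumes \<pi>: "comp_perm D \<pi>" and fg: "comp_in D f" "comp_in D g"
  shows "dec_in D (\<lambda>x. shuffle \<pi> ` B_eta_elem (f x) = B_eta_elem (g x))"
proof -
  have p: "comp_in D \<pi>" "bij \<pi>" using \<pi> by (auto simp: comp_perm_def)
  have p': "comp_in D (the_inv \<pi>)" using comp_perm_inv[OF \<pi>] by (auto simp: comp_perm_def)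
  define bound where "bound z L \<longleftrightarrow> (\<forall>e\<in>end_points (pfst z). - of_nat L < e \<and> e < of_nat L) \<and>
    (\<forall>e\<in>end_points (psnd z). - of_nat L < e \<and> e < of_nat L)" for z and L :: nat
  define L where "L z = (LEAST L. bound z L)" for z
  have ex: "\<exists>L. bound z L" for z using ex_bound_end_points[of "pfst z" "psnd z"] unfolding bound_def by blast
  have "comp_in D (\<lambda>z. LEAST L. bound z L)"
    by (rule comp_in_Least[OF _ ex]) (unfold bound_def end_points_ball, intro computable)
  then have L: "comp_in D L" unfolding L_def .
  have bL: "bound z (L z)" for z unfolding L_def by (rule LeastI_ex) (rule ex)
  define M where "M z = (LEAST M. \<forall>j\<le>L z. the_inv \<pi> j < M)" for z
  have exM: "\<exists>M. \<forall>j\<le>L z. the_inv \<pi> j < M" for z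
    by (rule exI[of _ "Suc (Max (the_inv \<pi> ` {..L z}))"]) (auto simp: less_Suc_eq_le)
  have "comp_in D (\<lambda>z. LEAST M. \<forall>j\<le>L z. the_inv \<pi> j < M)"
    by (rule comp_in_Least[OF _ exM]) (intro computable comp_in_comp[OF L] comp_in_comp[OF p'])
  then have M: "comp_in D M" unfolding M_def .
  have bM: "\<forall>j\<le>L z. the_inv \<pi> j < M z" for z unfolding M_def by (rule LeastI_ex) (rule exM)
  have iff: "shuffle \<pi> ` B_eta_elem (pfst z) = B_eta_elem (psnd z) \<longleftrightarrow>
      (\<forall>e\<in>end_points (pfst z). e \<in> B_eta_elem (pfst z) \<longleftrightarrow> shuffle \<pi> e \<in> B_eta_elem (psnd z)) \<and>
      (\<forall>e\<in>end_points (psnd z). shuffle (the_inv \<pi>) e \<in> B_eta_elem (pfst z) \<longleftrightarrow> e \<in> B_eta_elem (psnd z)) \<and>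
      (\<forall>i\<le>M z. of_nat i \<in> B_eta_elem (pfst z) \<longleftrightarrow> shuffle \<pi> (of_nat i) \<in> B_eta_elem (psnd z)) \<and>
      (- of_nat (Suc (L z)) \<in> B_eta_elem (pfst z) \<longleftrightarrow> shuffle \<pi> (- of_nat (Suc (L z))) \<in> B_eta_elem (psnd z))" for z
    by (rule shuffle_eq_iff_test[OF p(2) breaks_end_points breaks_end_points finite_end_points finite_end_points _ bM])
      (use bL[of z] in \<open>auto simp: bound_def\<close>)
  have "dec_in D (\<lambda>z. shuffle \<pi> ` B_eta_elem (pfst z) = B_eta_elem (psnd z))"
    unfolding iff end_points_ball
    by (intro computable compq_in_shuffle p p' comp_in_comp[OF L] comp_in_comp[OF M])
  from dec_in_comp[OF this, of "\<lambda>x. prod_encode (f x, g x)"] fg show ?thesis by (simp add: computable)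
qed

text \<open>Equality is the test for the identity permutation.\<close>

lemma dec_in_B_eta_elem_eq:
  "comp_in D f \<Longrightarrow> comp_in D g \<Longrightarrow> dec_in D (\<lambda>x. B_eta_elem (f x) = B_eta_elem (g x))"
  using dec_in_shuffle_image[OF comp_perm_id, of D f g] by (simp add: shuffle_id)

lemma B_eta_elem_code: "X \<in> B_eta \<Longrightarrow> B_eta_elem (B_eta_code X) = X"
proof -
  assume "X \<in> B_eta"
  then obtain n where "B_eta_elem n = X" unfolding range_B_eta_elem[symmetric] by blast
  then show ?thesis unfolding B_eta_code_def by (rule LeastI)
qed

lemma B_eta_code_image: "x \<in> B_eta_code ` B_eta \<longleftrightarrow> (\<forall>y<x. B_eta_elem y \<noteq> B_eta_elem x)"
proof
  assume "x \<in> B_eta_code ` B_eta"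
  then obtain X where X: "X \<in> B_eta" "x = B_eta_code X" by blast
  show "\<forall>y<x. B_eta_elem y \<noteq> B_eta_elem x"
    unfolding X(2) B_eta_elem_code[OF X(1)] unfolding B_eta_code_def by (auto dest: not_less_Least)
next
  assume "\<forall>y<x. B_eta_elem y \<noteq> B_eta_elem x"
  then have "B_eta_code (B_eta_elem x) = x"
    unfolding B_eta_code_def by (intro Least_equality) (auto simp: not_less[symmetric])
  then show "x \<in> B_eta_code ` B_eta" using B_eta_elem_in by (metis image_eqI)
qed

lemma dec_in_B_eta_code: "dec_in D (\<lambda>x. x \<in> B_eta_code ` B_eta)"
  unfolding B_eta_code_image by (intro computable dec_in_B_eta_elem_eq)

section \<open>Automorphisms as order isomorphisms\<close>

lemma boolean_hom_on_subset_iff: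
  assumes "boolean_hom_on B_eta f" "inj_on f B_eta" "X \<in> B_eta" "Y \<in> B_eta"
  shows "f X \<subseteq> f Y \<longleftrightarrow> X \<subseteq> Y"
proof -
  have "X \<subseteq> Y \<longleftrightarrow> X \<union> Y = Y" by blast
  also have "\<dots> \<longleftrightarrow> f (X \<union> Y) = f Y" using inj_on_eq_iff[OF assms(2) B_eta_Un[OF assms(3,4)] assms(4)] by simp
  also have "f (X \<union> Y) = f X \<union> f Y" using assms unfolding boolean_hom_on_def by blast
  finally show ?thesis by blast
qed

text \<open>Unions and intersections are suprema and infima for inclusion. Because \<open>f\<close>
  is onto, the union of two values is itself a value \<open>f Z\<close>, and \<open>Z\<close> can be
  compared with the union of the arguments.\<close>

lemma boolean_hom_onI:
  assumes f: "bij_betw f B_eta B_eta" and le: "\<And>X Y. X \<in> B_eta \<Longrightarrow> Y \<in> B_eta \<Longrightarrow> f X \<subseteq> f Y \<longleftrightarrow> X \<subseteq> Y"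
  shows "boolean_hom_on B_eta f"
proof -
  have fB: "f X \<in> B_eta" if "X \<in> B_eta" for X using f that by (rule bij_betwE[rule_format])
  have pre: "\<exists>X\<in>B_eta. Y = f X" if "Y \<in> B_eta" for Y using f that by (auto simp: bij_betw_def)
  have un: "f (X \<union> Y) = f X \<union> f Y" if XY: "X \<in> B_eta" "Y \<in> B_eta" for X Y
  proof
    obtain Z where Z: "Z \<in> B_eta" "f X \<union> f Y = f Z" using pre B_eta_Un fB XY by metis
    then have "X \<subseteq> Z" "Y \<subseteq> Z" using le XY by blast+
    then show "f (X \<union> Y) \<subseteq> f X \<union> f Y" unfolding Z(2) using le[OF B_eta_Un[OF XY] Z(1)] by blast
    show "f X \<union> f Y \<subseteq> f (X \<union> Y)" using le[OF _ B_eta_Un[OF XY]] XY by blast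
  qed
  have int: "f (X \<inter> Y) = f X \<inter> f Y" if XY: "X \<in> B_eta" "Y \<in> B_eta" for X Y
  proof
    obtain Z where Z: "Z \<in> B_eta" "f X \<inter> f Y = f Z" using pre B_eta_Int fB XY by metis
    then have "Z \<subseteq> X" "Z \<subseteq> Y" using le XY by blast+
    then show "f X \<inter> f Y \<subseteq> f (X \<inter> Y)" unfolding Z(2) using le[OF Z(1) B_eta_Int[OF XY]] by blast
    show "f (X \<inter> Y) \<subseteq> f X \<inter> f Y" using le[OF B_eta_Int[OF XY]] XY by blast
  qed
  have 0: "f {} = {}"
  proof -
    obtain Z where "Z \<in> B_eta" "{} = f Z" using pre[OF B_eta_empty] by blast
    then show ?thesis using le[OF B_eta_empty, of Z] by blast
  qed
  have 1: "f UNIV = UNIV"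
  proof -
    obtain Z where "Z \<in> B_eta" "UNIV = f Z" using pre[OF B_eta_UNIV] by blast
    then show ?thesis using le[of Z UNIV] B_eta_UNIV by blast
  qed
  have "f (- X) = - f X" if X: "X \<in> B_eta" for X
  proof -
    have "f X \<union> f (- X) = UNIV" "f X \<inter> f (- X) = {}"
      using un[OF X B_eta_Compl[OF X]] int[OF X B_eta_Compl[OF X]] 0 1 by simp_all
    then show ?thesis by blast
  qed
  then show ?thesis unfolding boolean_hom_on_def using 0 1 un int by blast
qed

text \<open>Inclusion involves two sets only and names no operation, so the automorphism condition
  becomes a relation on pairs of codes, a form that fits \<open>comp_perm_group\<close>.\<close>

lemma boolean_hom_on_iff:
  assumes "f \<in> Bij B_eta"
  shows "boolean_hom_on B_eta f \<longleftrightarrow> (\<forall>X\<in>B_eta. \<forall>Y\<in>B_eta. f X \<subseteq> f Y \<longleftrightarrow> X \<subseteq> Y)"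
proof
  have "inj_on f B_eta" using Bij_bij[OF assms] by (rule bij_betw_imp_inj_on)
  then show "boolean_hom_on B_eta f \<Longrightarrow> \<forall>X\<in>B_eta. \<forall>Y\<in>B_eta. f X \<subseteq> f Y \<longleftrightarrow> X \<subseteq> Y"
    by (intro ballI boolean_hom_on_subset_iff)
qed (rule boolean_hom_onI[OF Bij_bij[OF assms]], blast)

definition order_iso :: "(rat set \<Rightarrow> rat set) \<Rightarrow> bool" where
  "order_iso f \<longleftrightarrow> (\<forall>X\<in>B_eta. \<forall>Y\<in>B_eta. f X \<subseteq> f Y \<longleftrightarrow> X \<subseteq> Y)"

lemma carrier_Aut_B_eta: "carrier (Aut_B_eta (degree_of D)) =
    {f \<in> Bij B_eta. order_iso f \<and> fun_degree B_eta_code B_eta f \<le> degree_of D}"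
  using boolean_hom_on_iff by (auto simp: Aut_B_eta_def order_iso_def)

lemma Aut_B_eta_mult: "f \<in> carrier (Aut_B_eta d) \<Longrightarrow> g \<in> carrier (Aut_B_eta d) \<Longrightarrow>
    f \<otimes>\<^bsub>Aut_B_eta d\<^esub> g = compose B_eta f g"
  by (simp add: Aut_B_eta_def BijGroup_def)

lemma Aut_B_eta_one: "\<one>\<^bsub>Aut_B_eta d\<^esub> = (\<lambda>x\<in>B_eta. x)"
  by (simp add: Aut_B_eta_def BijGroup_def)

lemma group_Aut_B_eta: "group (Aut_B_eta (degree_of D))"
proof -
  interpret B: group "BijGroup B_eta" by (rule group_BijGroup)
  let ?C = "carrier (Aut_B_eta (degree_of D))"
  note deg = dec_in_B_eta_code[of D]
  have "subgroup ?C (BijGroup B_eta)"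
  proof (rule B.subgroupI)
    show "?C \<subseteq> carrier (BijGroup B_eta)" by (auto simp: carrier_Aut_B_eta BijGroup_sel)
    have id: "(\<lambda>x\<in>B_eta. x) \<in> Bij B_eta" by (rule id_Bij)
    have "transport B_eta_code B_eta (\<lambda>x\<in>B_eta. x) = (\<lambda>x. if x \<in> B_eta_code ` B_eta then x else 0)"
      by (auto simp: fun_eq_iff transport_app[OF inj_on_B_eta_code] transport_outside)
    then have "comp_in D (transport B_eta_code B_eta (\<lambda>x\<in>B_eta. x))"
      by (simp add: computable deg)
    then have "(\<lambda>x\<in>B_eta. x) \<in> ?C"
      using id fun_degree_le_iff[OF inj_on_B_eta_code deg Bij_image[OF id]] by (simp add: carrier_Aut_B_eta order_iso_def)
    then show "?C \<noteq> {}" by blast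
    fix f assume f: "f \<in> ?C"
    then have fB: "f \<in> Bij B_eta" by (simp add: carrier_Aut_B_eta)
    let ?g = "\<lambda>x\<in>B_eta. inv_into B_eta f x"
    have g: "?g \<in> Bij B_eta" using fB by (rule restrict_inv_into_Bij)
    have "order_iso ?g" unfolding order_iso_def
    proof (intro ballI)
      fix X Y assume XY: "X \<in> B_eta" "Y \<in> B_eta"
      have fg: "?g Z \<in> B_eta" "f (?g Z) = Z" if "Z \<in> B_eta" for Z
        using that Bij_image[OF g] Bij_bij[OF fB] by (auto simp: bij_betw_def f_inv_into_f image_subset_iff)
      have "\<forall>X\<in>B_eta. \<forall>Y\<in>B_eta. f X \<subseteq> f Y \<longleftrightarrow> X \<subseteq> Y" using f unfolding carrier_Aut_B_eta order_iso_def by blast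
      from this[rule_format, OF fg(1)[OF XY(1)] fg(1)[OF XY(2)]]
      show "?g X \<subseteq> ?g Y \<longleftrightarrow> X \<subseteq> Y" unfolding fg(2)[OF XY(1)] fg(2)[OF XY(2)] by (rule sym)
    qed
    then show "inv\<^bsub>BijGroup B_eta\<^esub> f \<in> ?C"
      using g fun_degree_inverse[OF inj_on_B_eta_code deg fB] f unfolding inv_BijGroup[OF fB] by (simp add: carrier_Aut_B_eta)
    fix g assume g: "g \<in> ?C"
    then have gB: "g \<in> Bij B_eta" by (simp add: carrier_Aut_B_eta)
    have "order_iso (compose B_eta f g)"
      using f g Bij_image[OF gB] unfolding carrier_Aut_B_eta order_iso_def by (auto simp: compose_def image_subset_iff)
    then show "f \<otimes>\<^bsub>BijGroup B_eta\<^esub> g \<in> ?C"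
      unfolding BijGroup_sel(2)[OF fB gB]
      using f g fun_degree_compose[OF inj_on_B_eta_code deg fB gB] compose_Bij[OF fB gB] by (simp add: carrier_Aut_B_eta)
  qed
  then have "group (BijGroup B_eta\<lparr>carrier := ?C\<rparr>)" by (rule B.subgroup_imp_group)
  then show ?thesis by (simp add: Aut_B_eta_def)
qed

text \<open>Inclusion is spelt out over the enumeration of the rationals: this gives universal
  statements, which the jump decides.\<close>

definition Aut_relation :: "nat list \<Rightarrow> nat list \<Rightarrow> bool" where
  "Aut_relation xs ys \<longleftrightarrow> (\<forall>k. nat_to_rat_surj k \<in> B_eta_elem (nthd xs 0) \<longrightarrow> nat_to_rat_surj k \<in> B_eta_elem (nthd xs 1))
     \<longleftrightarrow> (\<forall>k. nat_to_rat_surj k \<in> B_eta_elem (nthd ys 0) \<longrightarrow> nat_to_rat_surj k \<in> B_eta_elem (nthd ys 1))"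

lemma B_eta_elem_subset_iff: "(\<forall>k. nat_to_rat_surj k \<in> X \<longrightarrow> nat_to_rat_surj k \<in> Y) \<longleftrightarrow> X \<subseteq> Y"
  using surj_nat_to_rat_surj by (metis subset_iff surjD)

lemma Aut_relation_iff: "Aut_relation xs ys \<longleftrightarrow>
    (B_eta_elem (nthd xs 0) \<subseteq> B_eta_elem (nthd xs 1) \<longleftrightarrow> B_eta_elem (nthd ys 0) \<subseteq> B_eta_elem (nthd ys 1))"
  unfolding Aut_relation_def B_eta_elem_subset_iff ..

section \<open>The embedding of computable permutations\<close>

definition shuffle_map :: "(nat \<Rightarrow> nat) \<Rightarrow> rat set \<Rightarrow> rat set" where
  "shuffle_map \<pi> = (\<lambda>X\<in>B_eta. shuffle \<pi> ` X)"

lemma shuffle_map_Bij: assumes "bij \<pi>" shows "shuffle_map \<pi> \<in> Bij B_eta"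
proof -
  have \<pi>': "bij (the_inv \<pi>)" using bij_betw_the_inv_into[OF assms] by simp
  have inv: "shuffle (the_inv \<pi>) ` shuffle \<pi> ` X = X" "shuffle \<pi> ` shuffle (the_inv \<pi>) ` X = X" for X
    by (simp_all add: image_image shuffle_the_inv[OF assms])
  have "bij_betw (\<lambda>X. shuffle \<pi> ` X) B_eta B_eta"
    by (rule bij_betw_byWitness[where f' = "\<lambda>X. shuffle (the_inv \<pi>) ` X"])
      (auto simp: inv shuffle_B_eta assms \<pi>')
  then have "bij_betw (shuffle_map \<pi>) B_eta B_eta"
    by (rule bij_betw_cong[THEN iffD1, rotated]) (simp add: shuffle_map_def)
  then show ?thesis by (simp add: Bij_def shuffle_map_def)
qed

lemma shuffle_map_carrier:
  assumes \<pi>: "comp_perm D \<pi>" shows "shuffle_map \<pi> \<in> carrier (Aut_B_eta (degree_of D))"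
proof -
  have b: "bij \<pi>" using \<pi> by (simp add: comp_perm_def)
  have B: "shuffle_map \<pi> \<in> Bij B_eta" by (rule shuffle_map_Bij[OF b])
  have "order_iso (shuffle_map \<pi>)"
    unfolding order_iso_def shuffle_map_def using inj_image_subset_iff[OF inj_shuffle[OF b]] by auto
  moreover have "fun_degree B_eta_code B_eta (shuffle_map \<pi>) \<le> degree_of D"
    unfolding fun_degree_le_iff[OF inj_on_B_eta_code dec_in_B_eta_code Bij_image[OF B]]
  proof -
    \<comment> \<open>\<open>B_eta_code\<close> is itself a least notation, so the search for the
      least \<open>y\<close> returns the code of the image and not merely one of its
      notations.\<close>
    define t where "t x = (LEAST y. shuffle \<pi> ` B_eta_elem x = B_eta_elem y)" for x
    have "comp_in D (\<lambda>x. LEAST y. shuffle \<pi> ` B_eta_elem x = B_eta_elem y)"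
    proof (rule comp_in_Least)
      show "\<exists>y. shuffle \<pi> ` B_eta_elem x = B_eta_elem y" for x
        using shuffle_B_eta[OF b B_eta_elem_in[of x]] B_eta_elem_code by metis
    qed (intro dec_in_shuffle_image \<pi> computable)
    then have t: "comp_in D t" unfolding t_def .
    have "transport B_eta_code B_eta (shuffle_map \<pi>) x = (if x \<in> B_eta_code ` B_eta then t x else 0)" for x
    proof (cases "x \<in> B_eta_code ` B_eta")
      case True
      then obtain X where X: "X \<in> B_eta" "x = B_eta_code X" by blast
      have "B_eta_elem x = X" unfolding X(2) by (rule B_eta_elem_code[OF X(1)])
      then have "t x = B_eta_code (shuffle \<pi> ` X)"
        unfolding t_def B_eta_code_def by (intro arg_cong[of _ _ Least]) auto
      then show ?thesis using True transport_app[OF inj_on_B_eta_code X(1)] X by (simp add: shuffle_map_def)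
    qed (simp add: transport_outside)
    then have "transport B_eta_code B_eta (shuffle_map \<pi>) = (\<lambda>x. if x \<in> B_eta_code ` B_eta then t x else 0)" by (rule ext)
    then show "comp_in D (transport B_eta_code B_eta (shuffle_map \<pi>))"
      by (simp only:) (intro comp_in_if dec_in_B_eta_code t comp_in_const)
  qed
  ultimately show ?thesis using B by (simp add: carrier_Aut_B_eta)
qed

lemma shuffle_map_hom:
  assumes "comp_perm D \<pi>" "comp_perm D \<rho>"
  shows "shuffle_map (\<pi> \<circ> \<rho>) = shuffle_map \<pi> \<otimes>\<^bsub>Aut_B_eta (degree_of D)\<^esub> shuffle_map \<rho>"
proof -
  have "bij \<rho>" using assms by (simp add: comp_perm_def)
  then show ?thesis
    unfolding Aut_B_eta_mult[OF shuffle_map_carrier[OF assms(1)] shuffle_map_carrier[OF assms(2)]]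
    by (auto simp: shuffle_map_def compose_def fun_eq_iff shuffle_B_eta image_image shuffle_comp)
qed

lemma shuffle_unit_fixed: "\<pi> n = n \<Longrightarrow> q \<in> unit_interval n \<Longrightarrow> shuffle \<pi> q = q"
  by (simp add: shuffle_unit)

lemma unit_interval_disjoint: "q \<in> unit_interval n \<Longrightarrow> q \<in> unit_interval m \<Longrightarrow> n = m"
  by (simp add: unit_interval_iff)

lemma unit_interval_of_nat: "of_nat n \<in> unit_interval n"
  by (simp add: unit_interval_def)

lemma shuffle_map_inj:
  assumes "comp_perm D \<pi>" "shuffle_map \<pi> = \<one>\<^bsub>Aut_B_eta (degree_of D)\<^esub>" shows "\<pi> = (\<lambda>x. x)"
proof
  fix n
  have "shuffle \<pi> ` unit_interval n = unit_interval n"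
    using fun_cong[OF assms(2), of "unit_interval n"] unit_interval_B_eta[of n]
    by (simp add: Aut_B_eta_one shuffle_map_def)
  then have "shuffle \<pi> (of_nat n) \<in> unit_interval n" using unit_interval_of_nat by blast
  then show "\<pi> n = n" using shuffle_in[OF unit_interval_of_nat] unit_interval_disjoint by metis
qed

text \<open>A permutation \<open>w\<close> with finite support moves every nonempty part of a largest clopen set
  and fixes everything outside it. If \<open>r\<close> moves infinitely many unit intervals, then a set with
  this property for \<open>r\<close> contains all of them from some point on, also the fixed ones.\<close>

lemma shuffle_map_not_conj:
  assumes r: "comp_perm D r" and w: "comp_perm D w"
    and inf: "infinite {x. r x \<noteq> x}" "infinite {x. r x = x}" and fin: "finite {x. w x \<noteq> x}"
    and h: "h \<in> carrier (Aut_B_eta (degree_of D))"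
  shows "h \<otimes>\<^bsub>Aut_B_eta (degree_of D)\<^esub> shuffle_map r \<noteq> shuffle_map w \<otimes>\<^bsub>Aut_B_eta (degree_of D)\<^esub> h"
proof
  assume eq: "h \<otimes>\<^bsub>Aut_B_eta (degree_of D)\<^esub> shuffle_map r = shuffle_map w \<otimes>\<^bsub>Aut_B_eta (degree_of D)\<^esub> h"
  have hB: "h \<in> Bij B_eta" and hom: "boolean_hom_on B_eta h"
    using h by (auto simp: Aut_B_eta_def)
  have bij: "bij r" "bij w" using r w by (auto simp: comp_perm_def)
  have h_in: "h X \<in> B_eta" if "X \<in> B_eta" for X using Bij_image[OF hB] that by blast
  have h_inj: "X = Y" if "h X = h Y" "X \<in> B_eta" "Y \<in> B_eta" for X Y
    using Bij_bij[OF hB] that by (auto simp: bij_betw_def dest: inj_onD)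
  have h_onto: "\<exists>X\<in>B_eta. h X = Y" if "Y \<in> B_eta" for Y
    using bij_betw_imp_surj_on[OF Bij_bij[OF hB]] that by (metis imageE)
  have h_empty: "h {} = {}" using hom by (simp add: boolean_hom_on_def)
  have h_Int: "h (X \<inter> Y) = h X \<inter> h Y" if "X \<in> B_eta" "Y \<in> B_eta" for X Y
    using hom that by (simp add: boolean_hom_on_def)
  have h_Compl: "h (- X) = - h X" if "X \<in> B_eta" for X
    using hom that by (simp add: boolean_hom_on_def)
  have conj: "h (shuffle r ` X) = shuffle w ` h X" if "X \<in> B_eta" for X
    using fun_cong[OF eq[unfolded Aut_B_eta_mult[OF h shuffle_map_carrier[OF r]] Aut_B_eta_mult[OF shuffle_map_carrier[OF w] h]], of X]
      that h_in by (simp add: compose_def shuffle_map_def)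
  define W where "W = (\<Union>n\<in>{x. w x \<noteq> x}. unit_interval n)"
  have "(\<Union>n\<in>F. unit_interval n) \<in> B_eta" if "finite F" for F
    using that by induction (auto simp: B_eta_empty intro: B_eta_Un unit_interval_B_eta)
  then have W: "W \<in> B_eta" unfolding W_def using fin by blast
  have w_out: "shuffle w q = q" if "q \<notin> W" for q
    using that by (cases q rule: rat_unit_cases) (auto simp: W_def shuffle_neg, metis shuffle_unit_fixed)
  obtain X where X: "X \<in> B_eta" "h X = W" using h_onto[OF W] by blast
  \<comment> \<open>The part \<open>?Z\<close> of a moved interval outside \<open>X\<close> goes
    under \<open>h\<close> to a set outside \<open>W\<close>, which \<open>w\<close> fixes
    pointwise. Then \<open>r\<close> maps \<open>?Z\<close> to itself, yet it carries the interval
    to a disjoint one; so \<open>?Z\<close> is empty.\<close>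
  have moved: "unit_interval n \<subseteq> X" if n: "r n \<noteq> n" for n
  proof -
    let ?Z = "unit_interval n \<inter> - X"
    have Z: "?Z \<in> B_eta" by (intro B_eta_Int unit_interval_B_eta B_eta_Compl X)
    have "h ?Z \<inter> W = {}"
      using h_Int[OF unit_interval_B_eta B_eta_Compl[OF X(1)], of n] h_Compl[OF X(1)] X(2) by auto
    then have "\<forall>q\<in>h ?Z. shuffle w q = q" using w_out by blast
    then have "shuffle w ` h ?Z = h ?Z" by simp
    then have "h (shuffle r ` ?Z) = h ?Z" using conj[OF Z] by simp
    from h_inj[OF this shuffle_B_eta[OF bij(1) Z] Z] have *: "shuffle r ` ?Z = ?Z" .
    have "?Z = {}"
    proof (rule ccontr)
      assume "?Z \<noteq> {}"
      then obtain q where "q \<in> ?Z" by blast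
      then have "shuffle r q \<in> unit_interval n" "q \<in> unit_interval n" using * by blast+
      then show False using shuffle_in[of q n r] unit_interval_disjoint n by blast
    qed
    then show ?thesis by blast
  qed
  obtain E where E: "finite E" "breaks E X" using X(1) unfolding B_eta_iff by blast
  obtain L :: nat where L: "\<forall>e\<in>E. e < of_nat L"
  proof -
    obtain L :: nat where "Max (insert 0 E) < of_nat L" using reals_Archimedean2 by blast
    then show ?thesis using that E(1) by (metis Max_less_iff finite.insertI insertI2 insert_not_empty)
  qed
  obtain n where n: "r n \<noteq> n" "L \<le> n" using inf(1) unfolding infinite_nat_iff_unbounded_le by blast
  obtain m where m: "r m = m" "n < m" using inf(2) unfolding infinite_nat_iff_unbounded by blast
  \<comment> \<open>Past its last break \<open>X\<close> is constant, and it contains the moved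
    interval \<open>n\<close>; the fixed interval \<open>m\<close> lies further right.\<close>
  have mX: "unit_interval m \<subseteq> X"
  proof
    fix q assume q: "q \<in> unit_interval m"
    have "of_nat L \<le> (of_nat n :: rat)" "of_nat n < (of_nat m :: rat)" "of_nat m \<le> q"
      using n m q by (simp_all add: unit_interval_def)
    then have "of_nat n \<in> X \<longleftrightarrow> q \<in> X" using L by (intro breaksD[OF E(2)]) force+
    then show "q \<in> X" using moved[OF n(1)] unit_interval_of_nat by blast
  qed
  let ?Y = "h (unit_interval m)"
  have YW: "?Y \<subseteq> W"
    using h_Int[OF unit_interval_B_eta X(1), of m] mX X(2) by (metis Int_absorb2 inf.cobounded2)
  have "?Y \<noteq> {}"
    using h_inj[of "unit_interval m" "{}"] h_empty unit_interval_B_eta B_eta_empty unit_interval_of_nat by blast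
  then obtain q k where q: "q \<in> ?Y" "q \<in> unit_interval k" "w k \<noteq> k" using YW unfolding W_def by blast
  \<comment> \<open>The nonempty image of the fixed interval \<open>m\<close> lies inside
    \<open>W\<close> and so meets an interval \<open>k\<close> moved by \<open>w\<close>. The
    preimage of that intersection is contained in interval \<open>m\<close>, hence fixed by
    \<open>r\<close>, which would make \<open>?V\<close> invariant under \<open>w\<close>.\<close>
  let ?V = "?Y \<inter> unit_interval k"
  have "?V \<in> B_eta" by (intro B_eta_Int h_in unit_interval_B_eta)
  then obtain Z where Z: "Z \<in> B_eta" "h Z = ?V" using h_onto by blast
  have "h (Z \<inter> unit_interval m) = h Z"
    using h_Int[OF Z(1) unit_interval_B_eta] Z(2) by blast
  from h_inj[OF this B_eta_Int[OF Z(1) unit_interval_B_eta] Z(1)] have "Z \<inter> unit_interval m = Z" .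
  then have "\<forall>q\<in>Z. shuffle r q = q" using shuffle_unit_fixed[of r m] m(1) by blast
  then have "shuffle r ` Z = Z" by simp
  then have "shuffle w ` ?V = ?V" using conj[OF Z(1)] Z(2) by simp
  then have "shuffle w q \<in> unit_interval k" using q by blast
  then show False using shuffle_in[OF q(2), of w] unit_interval_disjoint q(3) by blast
qed

lemma iso_type_Aut_B_eta: "iso_type_has_degree (Aut_B_eta (degree_of D)) (degree_of (turing_jump (turing_jump D)))"
proof -
  let ?G = "Aut_B_eta (degree_of D)" and ?\<rho> = "transport B_eta_code B_eta"
  note c = inj_on_B_eta_code and N = dec_in_B_eta_code[of D]
  \<comment> \<open>The guard on the length leaves out tuples without two entries; there
    \<open>nthd\<close> would supply the default 0 on both sides instead of codes of a set and its
    image.\<close>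
  have K: "(\<forall>xs. set xs \<subseteq> B_eta_code ` B_eta \<longrightarrow> (2 \<le> length xs \<longrightarrow> Aut_relation xs (map (?\<rho> f) xs))) \<longleftrightarrow> order_iso f"
    (is "?L \<longleftrightarrow> ?R") if f: "f \<in> Bij B_eta" for f
  proof
    have fB: "f X \<in> B_eta" if "X \<in> B_eta" for X using Bij_image[OF f] that by blast
    show ?R if L: ?L
      unfolding order_iso_def
    proof (intro ballI)
      fix X Y assume XY: "X \<in> B_eta" "Y \<in> B_eta"
      have "Aut_relation [B_eta_code X, B_eta_code Y] (map (?\<rho> f) [B_eta_code X, B_eta_code Y])"
        using L[rule_format, of "[B_eta_code X, B_eta_code Y]"] XY by simp
      then show "f X \<subseteq> f Y \<longleftrightarrow> X \<subseteq> Y"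
        using XY fB by (simp add: Aut_relation_iff nthd_def transport_app[OF c] B_eta_elem_code)
    qed
    show ?L if R: ?R
    proof (intro allI impI)
      fix xs assume xs: "set xs \<subseteq> B_eta_code ` B_eta" "2 \<le> length xs"
      then have "xs ! 0 \<in> B_eta_code ` B_eta" "xs ! 1 \<in> B_eta_code ` B_eta" 
        using nth_mem[of 0 xs] nth_mem[of 1 xs] by (auto simp only: subset_iff)
      then obtain X Y where XY: "X \<in> B_eta" "xs ! 0 = B_eta_code X" "Y \<in> B_eta" "xs ! 1 = B_eta_code Y" by blast
      have "nthd xs 0 = B_eta_code X" "nthd xs 1 = B_eta_code Y"
        "nthd (map (?\<rho> f) xs) 0 = B_eta_code (f X)" "nthd (map (?\<rho> f) xs) 1 = B_eta_code (f Y)"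
        using xs(2) XY transport_app[OF c, of _ f] by (auto simp: nthd_def)
      then show "Aut_relation xs (map (?\<rho> f) xs)"
        using R XY fB unfolding order_iso_def Aut_relation_iff by (simp add: B_eta_elem_code)
    qed
  qed
  have dK: "dec_in (turing_jump D) (\<lambda>z. 2 \<le> length (list_decode (pfst z)) \<longrightarrow> Aut_relation (list_decode (pfst z)) (list_decode (psnd z)))"
    unfolding Aut_relation_def by (intro computable dec_in_jump_all)
  have "comp_perm_group ?G D (B_eta_code ` B_eta) (\<lambda>xs ys. 2 \<le> length xs \<longrightarrow> Aut_relation xs ys) ?\<rho>"
  proof (intro comp_perm_group.intro comp_perm_group_axioms.intro)
    show "group ?G" by (rule group_Aut_B_eta)
    show "inj_on ?\<rho> (carrier ?G)"
      by (rule inj_onI) (auto simp: carrier_Aut_B_eta intro: transport_eq_iff[OF c])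
    show "?\<rho> ` carrier ?G = {\<pi>. comp_bij_on D (B_eta_code ` B_eta) \<pi> \<and>
      (\<forall>xs. set xs \<subseteq> B_eta_code ` B_eta \<longrightarrow> (2 \<le> length xs \<longrightarrow> Aut_relation xs (map \<pi> xs)))}" (is "_ = ?S")
    proof (intro subset_antisym subsetI)
      fix \<pi> assume "\<pi> \<in> ?\<rho> ` carrier ?G"
      then obtain f where f: "f \<in> Bij B_eta" "order_iso f" "fun_degree B_eta_code B_eta f \<le> degree_of D" "\<pi> = ?\<rho> f"
        by (auto simp: carrier_Aut_B_eta)
      then show "\<pi> \<in> ?S"
        using K[OF f(1)] fun_degree_le_iff[OF c N Bij_image[OF f(1)]] transport_bij_betw[OF c Bij_bij[OF f(1)]]
        by (simp add: comp_bij_on_def transport_outside)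
    next
      fix \<pi> assume \<pi>: "\<pi> \<in> ?S"
      then obtain f where f: "f \<in> Bij B_eta" "fun_degree B_eta_code B_eta f \<le> degree_of D" "?\<rho> f = \<pi>"
        using comp_bij_on_transport[OF c N] by blast
      with \<pi> K[OF f(1)] have "f \<in> carrier ?G" by (simp add: carrier_Aut_B_eta)
      then show "\<pi> \<in> ?\<rho> ` carrier ?G" using f(3) by blast
    qed
    show "?\<rho> (f \<otimes>\<^bsub>?G\<^esub> g) x = ?\<rho> f (?\<rho> g x)"
      if "f \<in> carrier ?G" "g \<in> carrier ?G" "x \<in> B_eta_code ` B_eta" for f g x
      unfolding Aut_B_eta_mult[OF that(1,2)]
      by (rule transport_compose[OF c _ that(3)]) (use that(2) in \<open>auto simp: carrier_Aut_B_eta dest: Bij_image\<close>)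
  qed (use N dK in simp_all)
  then show ?thesis
    by (rule comp_perm_group.iso_type_has_degreeI[where \<iota> = shuffle_map])
      (simp_all add: shuffle_map_carrier shuffle_map_hom shuffle_map_inj shuffle_map_not_conj)
qed

section \<open>Computable fields and vectors\<close>

lemma comp_in_mono: "turing_le B A \<Longrightarrow> comp_in B f \<Longrightarrow> comp_in A f"
  unfolding turing_le_def comp_in_def using eval_subst_oracle by blast

lemma turing_le_empty: "turing_le {} A"
  unfolding turing_le_iff_dec by (simp add: dec_in_const)

lemma comp_in_empty: "comp_in {} f \<Longrightarrow> comp_in A f"
  by (rule comp_in_mono[OF turing_le_empty])

lemma dec_in_empty: "dec_in {} P \<Longrightarrow> dec_in A P"
  unfolding dec_in_def by (rule comp_in_empty)

text \<open>The program for \<open>h\<close> is known to halt only on arguments in \<open>C\<close>.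
  Others are first replaced by the fixed \<open>c\<close>, and a case distinction afterwards
  discards the result.\<close>

lemma comp_in_computable_op:
  assumes C: "dec_in {} (\<lambda>x. x \<in> C)" and h: "computable_op_on C h" and c: "c \<in> C"
    and fg: "comp_in A f" "comp_in A g"
  shows "comp_in A (\<lambda>x. if f x \<in> C \<and> g x \<in> C then h (f x) (g x) else 0)"
proof -
  obtain p where p: "\<forall>x\<in>C. \<forall>y\<in>C. eval {} p [x, y] (h x y)" using h unfolding computable_op_on_def by blast
  let ?r = "\<lambda>x. if x \<in> C then x else c"
  have r: "comp_in {} (\<lambda>z. ?r (k z))" if "comp_in {} k" for k
    by (intro comp_in_if dec_in_comp[OF C] that comp_in_const)
  obtain q q' where q: "\<forall>z. eval {} q [z] (?r (pfst z))" "\<forall>z. eval {} q' [z] (?r (psnd z))"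
    using r[OF comp_in_pfst[OF comp_in_id]] r[OF comp_in_psnd[OF comp_in_id]] unfolding comp_in_def by blast
  have "eval {} (Comp p [q, q']) [z] (h (?r (pfst z)) (?r (psnd z)))" for z
    by (rule eval_Comp2[OF q(1)[rule_format] q(2)[rule_format]]) (use p c in auto)
  then have "comp_in {} (\<lambda>z. h (?r (pfst z)) (?r (psnd z)))" unfolding comp_in_def by blast
  then have "comp_in A (\<lambda>z. h (?r (pfst z)) (?r (psnd z)))" by (rule comp_in_empty)
  from comp_in_comp[OF this, of "\<lambda>x. prod_encode (f x, g x)"] fg
  have "comp_in A (\<lambda>x. h (?r (f x)) (?r (g x)))" by (simp add: comp_in_pair cong: if_cong)
  then have "comp_in A (\<lambda>x. if f x \<in> C \<and> g x \<in> C then h (?r (f x)) (?r (g x)) else 0)"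
    by (intro computable dec_in_comp[OF dec_in_empty[OF C]] fg)
  then show ?thesis by (simp cong: if_cong)
qed

locale comp_field =
  fixes F :: "nat ring" (structure)
  assumes comp_field: "computable_field F"
begin

sublocale field F using comp_field by (simp add: computable_field_def)

abbreviation V where "V \<equiv> carrier (V_inf F)"
abbreviation vcode where "vcode \<equiv> vec_code F"

lemma dec_in_carrier [computable]: "comp_in A f \<Longrightarrow> dec_in A (\<lambda>x. f x \<in> carrier F)"
  using comp_field dec_in_comp[OF dec_in_empty]
  by (auto simp: computable_field_def decidable_def turing_le_iff_dec)

definition fadd where "fadd a b = (if a \<in> carrier F \<and> b \<in> carrier F then a \<oplus> b else 0)"
definition fmult where "fmult a b = (if a \<in> carrier F \<and> b \<in> carrier F then a \<otimes> b else 0)"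

lemma comp_in_fadd [computable]:
  "comp_in A f \<Longrightarrow> comp_in A g \<Longrightarrow> comp_in A (\<lambda>x. fadd (f x) (g x))"
  "comp_in A f \<Longrightarrow> comp_in A g \<Longrightarrow> comp_in A (\<lambda>x. fmult (f x) (g x))"
  unfolding fadd_def fmult_def using comp_field
  by (auto intro!: comp_in_computable_op[OF _ _ zero_closed] simp: computable_field_def decidable_def turing_le_iff_dec)

section \<open>Vectors and their codes\<close>

lemma V_iff: "v \<in> V \<longleftrightarrow> (\<forall>i. v i \<in> carrier F) \<and> finite {i. v i \<noteq> \<zero>}"
  by (simp add: V_inf_def)

lemma V_closed: "v \<in> V \<Longrightarrow> v i \<in> carrier F" by (simp add: V_iff)

definition lin :: "nat \<Rightarrow> (nat \<Rightarrow> nat) \<Rightarrow> nat \<Rightarrow> (nat \<Rightarrow> nat) \<Rightarrow> nat \<Rightarrow> nat" where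
  "lin a u b v = (\<lambda>i. a \<otimes> u i \<oplus> b \<otimes> v i)"

lemma lin_V_inf: "a \<odot>\<^bsub>V_inf F\<^esub> u \<oplus>\<^bsub>V_inf F\<^esub> b \<odot>\<^bsub>V_inf F\<^esub> v = lin a u b v"
  by (simp add: V_inf_def lin_def)

lemma lin_closed: "a \<in> carrier F \<Longrightarrow> b \<in> carrier F \<Longrightarrow> u \<in> V \<Longrightarrow> v \<in> V \<Longrightarrow> lin a u b v \<in> V"
proof -
  assume *: "a \<in> carrier F" "b \<in> carrier F" "u \<in> V" "v \<in> V"
  have "{i. lin a u b v i \<noteq> \<zero>} \<subseteq> {i. u i \<noteq> \<zero>} \<union> {i. v i \<noteq> \<zero>}" using * by (auto simp: lin_def)
  with * show ?thesis unfolding V_iff by (auto simp: lin_def intro: finite_subset)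
qed

lemma semilinear_iff:
  "semilinear F \<sigma> \<mu> \<longleftrightarrow> (\<forall>u\<in>V. \<forall>v\<in>V. \<forall>a\<in>carrier F. \<forall>b\<in>carrier F. \<mu> (lin a u b v) = lin (\<sigma> a) (\<mu> u) (\<sigma> b) (\<mu> v))"
  unfolding semilinear_def lin_V_inf ..

text \<open>The list is read as a vector: beyond its end stands the zero of the field, which may
  differ from the number 0 that \<open>nthd\<close> returns.\<close>

definition entry :: "nat list \<Rightarrow> nat \<Rightarrow> nat" where
  "entry l i = (if i < length l then nthd l i else \<zero>)"

lemma comp_in_entry [computable]:
  "compl_in A L \<Longrightarrow> comp_in A f \<Longrightarrow> comp_in A (\<lambda>x. entry (L x) (f x))"
  unfolding entry_def by (intro computable)

definition vlen :: "(nat \<Rightarrow> nat) \<Rightarrow> nat" where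
  "vlen v = (LEAST n. \<forall>i\<ge>n. v i = \<zero>)"

lemma list_decode_vcode: "list_decode (vcode v) = map v [0..<vlen v]"
  by (simp add: vec_code_def vlen_def)

lemma vlen_zero: assumes "v \<in> V" "vlen v \<le> i" shows "v i = \<zero>"
proof -
  have "finite {i. v i \<noteq> \<zero>}" using assms by (simp add: V_iff)
  then obtain n where "\<forall>i\<in>{i. v i \<noteq> \<zero>}. i < n" unfolding finite_nat_set_iff_bounded by blast
  then have "\<forall>i\<ge>n. v i = \<zero>" by force
  then have "\<forall>i\<ge>vlen v. v i = \<zero>" unfolding vlen_def by (rule LeastI)
  then show ?thesis using assms(2) by blast
qed

lemma vlen_le: "\<forall>i\<ge>n. v i = \<zero> \<Longrightarrow> vlen v \<le> n"
  unfolding vlen_def by (rule Least_le)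

lemma entry_vcode: "v \<in> V \<Longrightarrow> entry (list_decode (vcode v)) = v"
  by (auto simp: entry_def list_decode_vcode nthd_def vlen_zero fun_eq_iff)

text \<open>Cutting a vector after its last nonzero entry leaves a list without trailing zero, and
  padding such a list with zeros gives a vector of exactly that length. Membership thus becomes
  decidable.\<close>

lemma vcode_image: "n \<in> vcode ` V \<longleftrightarrow> (\<forall>x\<in>set (list_decode n). x \<in> carrier F) \<and>
    (length (list_decode n) = 0 \<or> nthd (list_decode n) (length (list_decode n) - 1) \<noteq> \<zero>)" (is "_ \<longleftrightarrow> ?R (list_decode n)")
proof
  assume "n \<in> vcode ` V"
  then obtain v where v: "v \<in> V" "n = vcode v" by blast
  have "v (vlen v - 1) \<noteq> \<zero>" if "vlen v \<noteq> 0"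
  proof
    assume z: "v (vlen v - 1) = \<zero>"
    have "\<forall>i\<ge>vlen v - 1. v i = \<zero>"
    proof (intro allI impI)
      fix i assume "vlen v - 1 \<le> i"
      then consider "vlen v \<le> i" | "i = vlen v - 1" by linarith
      then show "v i = \<zero>" using z vlen_zero[OF v(1)] by cases simp_all
    qed
    then have "vlen v \<le> vlen v - 1" by (rule vlen_le)
    then show False using that by linarith
  qed
  then show "?R (list_decode n)" unfolding v(2) list_decode_vcode using V_closed[OF v(1)] by (auto simp: nthd_def)
next
  assume R: "?R (list_decode n)"
  let ?l = "list_decode n"
  have "{i. entry ?l i \<noteq> \<zero>} \<subseteq> {..<length ?l}" by (auto simp: entry_def)
  then have V: "entry ?l \<in> V"
    unfolding V_iff using R by (auto simp: entry_def nthd_def intro: finite_subset)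
  have "vlen (entry ?l) = length ?l"
  proof (rule antisym)
    show "vlen (entry ?l) \<le> length ?l" by (rule vlen_le) (simp add: entry_def)
    show "length ?l \<le> vlen (entry ?l)"
    proof (rule ccontr)
      assume "\<not> length ?l \<le> vlen (entry ?l)"
      then have "vlen (entry ?l) \<le> length ?l - 1" "0 < length ?l" by linarith+
      then have "entry ?l (length ?l - 1) = \<zero>" "0 < length ?l" using vlen_zero[OF V] by blast+
      then show False using R by (simp add: entry_def)
    qed
  qed
  then have "vcode (entry ?l) = list_encode (map (entry ?l) [0..<length ?l])"
    using list_decode_vcode[of "entry ?l"] by (metis list_decode_inverse)
  moreover have "map (entry ?l) [0..<length ?l] = ?l"
    by (rule nth_equalityI) (auto simp: entry_def nthd_def)
  ultimately show "n \<in> vcode ` V" using V by (metis image_eqI list_decode_inverse)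
qed

lemma dec_in_vcode: "dec_in A (\<lambda>x. x \<in> vcode ` V)"
  unfolding vcode_image by (intro computable)

lemma dec_in_id_image: "dec_in A (\<lambda>x. x \<in> (\<lambda>a. a) ` carrier F)"
  unfolding image_ident by (intro computable)

lemma inj_vcode: "inj_on vcode V" by (rule inj_on_vec_code)

section \<open>The group of semilinear transformations\<close>

abbreviation vec_action where "vec_action \<equiv> transport vcode V"
abbreviation scalar_action where "scalar_action \<equiv> transport (\<lambda>a. a) (carrier F)"

lemma scalar_action_app: "a \<in> carrier F \<Longrightarrow> scalar_action \<sigma> a = \<sigma> a"
  using transport_app[of "\<lambda>a. a" "carrier F" a \<sigma>] by simp

definition semilinear_aut :: "(nat \<Rightarrow> nat) \<Rightarrow> ((nat \<Rightarrow> nat) \<Rightarrow> (nat \<Rightarrow> nat)) \<Rightarrow> bool" where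
  "semilinear_aut \<sigma> \<mu> \<longleftrightarrow> (\<forall>a\<in>carrier F. \<forall>b\<in>carrier F. \<sigma> (a \<oplus> b) = \<sigma> a \<oplus> \<sigma> b \<and> \<sigma> (a \<otimes> b) = \<sigma> a \<otimes> \<sigma> b) \<and>
     \<sigma> \<one> = \<one> \<and> semilinear F \<sigma> \<mu>"

lemma ring_iso_iff:
  assumes "\<sigma> \<in> Bij (carrier F)"
  shows "\<sigma> \<in> ring_iso F F \<longleftrightarrow> (\<forall>a\<in>carrier F. \<forall>b\<in>carrier F. \<sigma> (a \<oplus> b) = \<sigma> a \<oplus> \<sigma> b \<and> \<sigma> (a \<otimes> b) = \<sigma> a \<otimes> \<sigma> b) \<and> \<sigma> \<one> = \<one>"
  using Bij_bij[OF assms] Bij_image[OF assms] unfolding ring_iso_def ring_hom_def by auto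

lemma carrier_GSL: "(\<mu>, \<sigma>) \<in> carrier (GSL F (degree_of D)) \<longleftrightarrow>
    \<mu> \<in> Bij V \<and> \<sigma> \<in> Bij (carrier F) \<and> semilinear_aut \<sigma> \<mu> \<and> fun_degree vcode V \<mu> \<le> degree_of D \<and>
    fun_degree (\<lambda>a. a) (carrier F) \<sigma> \<le> degree_of D"
  using ring_iso_iff unfolding GSL_def semilinear_aut_def by auto

lemma GSL_mult: "(\<mu>, \<sigma>) \<in> carrier (GSL F d) \<Longrightarrow> (\<mu>', \<sigma>') \<in> carrier (GSL F d) \<Longrightarrow>
    (\<mu>, \<sigma>) \<otimes>\<^bsub>GSL F d\<^esub> (\<mu>', \<sigma>') = (compose V \<mu> \<mu>', compose (carrier F) \<sigma> \<sigma>')"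
  by (simp add: GSL_def DirProd_def BijGroup_def)

lemma GSL_one: "\<one>\<^bsub>GSL F d\<^esub> = (\<lambda>v\<in>V. v, \<lambda>a\<in>carrier F. a)"
  by (simp add: GSL_def DirProd_def BijGroup_def)

text \<open>Each law for the inverses follows by applying the injective map \<open>\<sigma>\<close>
  or \<open>\<mu>\<close> to both sides.\<close>

lemma semilinear_aut_inverse:
  assumes \<mu>: "\<mu> \<in> Bij V" and \<sigma>: "\<sigma> \<in> Bij (carrier F)" and s: "semilinear_aut \<sigma> \<mu>"
  shows "semilinear_aut (\<lambda>a\<in>carrier F. inv_into (carrier F) \<sigma> a) (\<lambda>v\<in>V. inv_into V \<mu> v)" (is "semilinear_aut ?\<sigma> ?\<mu>")
proof -
  have \<sigma>': "?\<sigma> a \<in> carrier F" "\<sigma> (?\<sigma> a) = a" if "a \<in> carrier F" for a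
    using that Bij_image[OF restrict_inv_into_Bij[OF \<sigma>]] Bij_bij[OF \<sigma>] by (auto simp: bij_betw_def f_inv_into_f image_subset_iff)
  have \<mu>': "?\<mu> v \<in> V" "\<mu> (?\<mu> v) = v" if "v \<in> V" for v
    using that Bij_image[OF restrict_inv_into_Bij[OF \<mu>]] Bij_bij[OF \<mu>] by (auto simp: bij_betw_def f_inv_into_f image_subset_iff)
  have \<sigma>_inj: "a = b" if "\<sigma> a = \<sigma> b" "a \<in> carrier F" "b \<in> carrier F" for a b
    using that Bij_bij[OF \<sigma>] by (auto simp: bij_betw_def dest: inj_onD)
  have \<mu>_inj: "u = v" if "\<mu> u = \<mu> v" "u \<in> V" "v \<in> V" for u v
    using that Bij_bij[OF \<mu>] by (auto simp: bij_betw_def dest: inj_onD)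
  have h: "\<sigma> (a \<oplus> b) = \<sigma> a \<oplus> \<sigma> b" "\<sigma> (a \<otimes> b) = \<sigma> a \<otimes> \<sigma> b" if "a \<in> carrier F" "b \<in> carrier F" for a b
    using s that by (auto simp: semilinear_aut_def)
  have l: "\<mu> (lin a u b v) = lin (\<sigma> a) (\<mu> u) (\<sigma> b) (\<mu> v)" if "u \<in> V" "v \<in> V" "a \<in> carrier F" "b \<in> carrier F" for a b u v
    using s that by (auto simp: semilinear_aut_def semilinear_iff)
  show ?thesis unfolding semilinear_aut_def semilinear_iff
  proof (intro conjI ballI)
    fix a b assume ab: "a \<in> carrier F" "b \<in> carrier F"
    show "?\<sigma> (a \<oplus> b) = ?\<sigma> a \<oplus> ?\<sigma> b"
      by (rule \<sigma>_inj) (simp_all only: h \<sigma>' ab add.m_closed)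
    show "?\<sigma> (a \<otimes> b) = ?\<sigma> a \<otimes> ?\<sigma> b"
      by (rule \<sigma>_inj) (simp_all only: h \<sigma>' ab m_closed)
    fix u v assume uv: "u \<in> V" "v \<in> V"
    show "?\<mu> (lin a u b v) = lin (?\<sigma> a) (?\<mu> u) (?\<sigma> b) (?\<mu> v)"
      by (rule \<mu>_inj) (simp_all only: l \<sigma>' \<mu>' ab uv lin_closed)
  next
    have one: "\<sigma> \<one> = \<one>" using s by (simp add: semilinear_aut_def)
    show "?\<sigma> \<one> = \<one>" by (rule \<sigma>_inj) (simp_all only: one \<sigma>' one_closed)
  qed
qed

lemma semilinear_aut_compose:
  assumes "\<mu>' ` V \<subseteq> V" "\<sigma>' ` carrier F \<subseteq> carrier F" "semilinear_aut \<sigma> \<mu>" "semilinear_aut \<sigma>' \<mu>'"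
  shows "semilinear_aut (compose (carrier F) \<sigma> \<sigma>') (compose V \<mu> \<mu>')"
  using assms unfolding semilinear_aut_def semilinear_iff by (simp add: compose_def image_subset_iff lin_closed)

lemma group_GSL: "group (GSL F (degree_of D))"
proof -
  let ?B = "BijGroup V \<times>\<times> BijGroup (carrier F)"
  interpret B: group ?B by (intro DirProd_group group_BijGroup)
  let ?C = "carrier (GSL F (degree_of D))"
  have "subgroup ?C ?B"
  proof (rule B.subgroupI)
    show "?C \<subseteq> carrier ?B" using carrier_GSL by (auto simp: BijGroup_sel)
    have id: "(\<lambda>v\<in>V. v) \<in> Bij V" "(\<lambda>a\<in>carrier F. a) \<in> Bij (carrier F)" by (rule id_Bij)+
    have tid: "transport c S (\<lambda>x\<in>S. x) = (\<lambda>x. if x \<in> c ` S then x else 0)" if "inj_on c S" for c :: "'x \<Rightarrow> nat" and S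
      using transport_app[OF that] by (auto simp: fun_eq_iff transport_outside)
    have "fun_degree vcode V (\<lambda>v\<in>V. v) \<le> degree_of D"
      unfolding fun_degree_le_iff[OF inj_vcode dec_in_vcode Bij_image[OF id(1)]] tid[OF inj_vcode]
      by (intro computable dec_in_comp[OF dec_in_vcode])
    moreover have "fun_degree (\<lambda>a. a) (carrier F) (\<lambda>a\<in>carrier F. a) \<le> degree_of D"
      unfolding fun_degree_le_iff[OF inj_on_id2 dec_in_id_image Bij_image[OF id(2)]] tid[OF inj_on_id2]
      by (intro computable dec_in_comp[OF dec_in_id_image])
    moreover have "semilinear_aut (\<lambda>a\<in>carrier F. a) (\<lambda>v\<in>V. v)"
      unfolding semilinear_aut_def semilinear_iff by (simp add: lin_closed)
    ultimately have "(\<lambda>v\<in>V. v, \<lambda>a\<in>carrier F. a) \<in> ?C" using id by (simp add: carrier_GSL)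
    then show "?C \<noteq> {}" by blast
    fix f assume f: "f \<in> ?C"
    obtain \<mu> \<sigma> where fe: "f = (\<mu>, \<sigma>)" by (cases f)
    note f' = f[unfolded fe carrier_GSL]
    have "inv\<^bsub>?B\<^esub> f = (\<lambda>v\<in>V. inv_into V \<mu> v, \<lambda>a\<in>carrier F. inv_into (carrier F) \<sigma> a)"
      unfolding fe using f' by (subst inv_DirProd) (auto simp: group_BijGroup BijGroup_sel inv_BijGroup)
    then show "inv\<^bsub>?B\<^esub> f \<in> ?C"
      using f' semilinear_aut_inverse[of \<mu> \<sigma>] fun_degree_inverse[OF inj_vcode dec_in_vcode, of \<mu> D]
        fun_degree_inverse[OF inj_on_id2 dec_in_id_image, of \<sigma> D] restrict_inv_into_Bij[of \<mu> V] restrict_inv_into_Bij[of \<sigma> "carrier F"]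
      by (simp add: carrier_GSL)
    fix g assume g: "g \<in> ?C"
    obtain \<mu>' \<sigma>' where ge: "g = (\<mu>', \<sigma>')" by (cases g)
    note g' = g[unfolded ge carrier_GSL]
    have "f \<otimes>\<^bsub>?B\<^esub> g = (compose V \<mu> \<mu>', compose (carrier F) \<sigma> \<sigma>')"
      unfolding fe ge using f' g' by (simp add: BijGroup_sel)
    then show "f \<otimes>\<^bsub>?B\<^esub> g \<in> ?C"
      using f' g' semilinear_aut_compose[OF Bij_image Bij_image, of \<mu>' \<sigma>' \<sigma> \<mu>] compose_Bij[of \<mu> V \<mu>'] compose_Bij[of \<sigma> "carrier F" \<sigma>']
        fun_degree_compose[OF inj_vcode dec_in_vcode, of \<mu> \<mu>' D]
        fun_degree_compose[OF inj_on_id2 dec_in_id_image, of \<sigma> \<sigma>' D]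
      by (simp add: carrier_GSL)
  qed
  then have "group (?B\<lparr>carrier := ?C\<rparr>)" by (rule B.subgroup_imp_group)
  then show ?thesis by (simp add: GSL_def)
qed

section \<open>Vectors and scalars on one set of numbers\<close>

definition GSL_codes :: "nat set" where
  "GSL_codes = {x. if even x then x div 2 \<in> vcode ` V else x div 2 \<in> carrier F}"

text \<open>A map on vectors (even numbers) and one on scalars (odd numbers) become a single
  function, as \<open>comp_perm_group\<close> expects.\<close>

definition join :: "(nat \<Rightarrow> nat) \<Rightarrow> (nat \<Rightarrow> nat) \<Rightarrow> nat \<Rightarrow> nat" where
  "join p q x = (if x \<in> GSL_codes then if even x then 2 * p (x div 2) else Suc (2 * q (x div 2)) else 0)"

lemma GSL_codes_iff [simp]: "2 * n \<in> GSL_codes \<longleftrightarrow> n \<in> vcode ` V" "Suc (2 * a) \<in> GSL_codes \<longleftrightarrow> a \<in> carrier F"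
  by (simp_all add: GSL_codes_def)

lemma GSL_codes_cases:
  assumes "x \<in> GSL_codes" obtains n where "x = 2 * n" "n \<in> vcode ` V" | a where "x = Suc (2 * a)" "a \<in> carrier F"
proof (cases "even x")
  case True
  then have "x = 2 * (x div 2)" by simp
  then show ?thesis using that(1)[of "x div 2"] assms True by (simp add: GSL_codes_def)
next
  case False
  then have "x = Suc (2 * (x div 2))" by simp
  then show ?thesis using that(2)[of "x div 2"] assms False by (simp add: GSL_codes_def)
qed

lemma dec_in_GSL_codes: "dec_in A (\<lambda>x. x \<in> GSL_codes)"
  unfolding GSL_codes_def mem_Collect_eq by (intro computable dec_in_comp[OF dec_in_vcode])

lemma join_app [simp]:
  "n \<in> vcode ` V \<Longrightarrow> join p q (2 * n) = 2 * p n" "a \<in> carrier F \<Longrightarrow> join p q (Suc (2 * a)) = Suc (2 * q a)"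
  by (simp_all add: join_def)

lemma comp_bij_on_join:
  assumes p: "comp_bij_on D (vcode ` V) p" and q: "comp_bij_on D (carrier F) q"
  shows "comp_bij_on D GSL_codes (join p q)"
  unfolding comp_bij_on_def
proof (intro conjI)
  have cp: "comp_in D p" "comp_in D q" using p q by (auto simp: comp_bij_on_def)
  show "comp_in D (join p q)" unfolding join_def[abs_def]
    by (intro computable dec_in_GSL_codes comp_in_comp[OF cp(1)] comp_in_comp[OF cp(2)])
  have b: "inj_on p (vcode ` V)" "p ` vcode ` V = vcode ` V" "inj_on q (carrier F)" "q ` carrier F = carrier F"
    using p q by (auto simp: comp_bij_on_def bij_betw_def)
  show "bij_betw (join p q) GSL_codes GSL_codes"
  proof (rule bij_betw_imageI)
    show "inj_on (join p q) GSL_codes"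
    proof (rule inj_onI)
      fix x y assume xy: "x \<in> GSL_codes" "y \<in> GSL_codes" and eq: "join p q x = join p q y"
      have ev: "even (join p q z) = even z" if "z \<in> GSL_codes" for z using that by (simp add: join_def)
      have par: "even x = even y" using ev[OF xy(1)] ev[OF xy(2)] eq by simp
      have "x div 2 = y div 2"
      proof (cases "even x")
        case True
        then have "p (x div 2) = p (y div 2)" using eq par xy by (simp add: join_def)
        then show ?thesis by (rule inj_onD[OF b(1)]) (use xy True par in \<open>simp_all add: GSL_codes_def\<close>)
      next
        case False
        then have "q (x div 2) = q (y div 2)" using eq par xy by (simp add: join_def)
        then show ?thesis by (rule inj_onD[OF b(3)]) (use xy False par in \<open>simp_all add: GSL_codes_def\<close>)
      qed
      then show "x = y" using par by (metis odd_two_times_div_two_succ dvd_mult_div_cancel)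
    qed
    show "join p q ` GSL_codes = GSL_codes"
    proof (intro subset_antisym subsetI)
      fix y assume "y \<in> join p q ` GSL_codes"
      then obtain x where "x \<in> GSL_codes" "y = join p q x" by (elim imageE)
      have pin: "p n \<in> vcode ` V" if "n \<in> vcode ` V" for n using b(2) imageI[OF that, of p] by simp
      have qin: "q a \<in> carrier F" if "a \<in> carrier F" for a using b(4) imageI[OF that, of q] by simp
      from \<open>x \<in> GSL_codes\<close> show "y \<in> GSL_codes" unfolding \<open>y = join p q x\<close>
        by (cases rule: GSL_codes_cases) (simp_all only: join_app GSL_codes_iff pin qin)
    next
      fix y assume "y \<in> GSL_codes"
      then show "y \<in> join p q ` GSL_codes"
      proof (cases rule: GSL_codes_cases)
        case (1 n)
        then obtain m where m: "m \<in> vcode ` V" "n = p m" using b(2) by blast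
        have "y = join p q (2 * m)" using join_app(1)[OF m(1)] 1 m(2) by simp
        then show ?thesis using m(1) GSL_codes_iff(1) by blast
      next
        case (2 a)
        then obtain m where m: "m \<in> carrier F" "a = q m" using b(4) by blast
        have "y = join p q (Suc (2 * m))" using join_app(2)[OF m(1)] 2 m(2) by simp
        then show ?thesis using m(1) GSL_codes_iff(2) by blast
      qed
    qed
  qed
qed (simp add: join_def)

text \<open>Preservation of parity keeps vectors and scalars apart, so the even and the odd half can
  be read off separately and inherit bijectivity.\<close>

lemma comp_bij_on_split:
  assumes \<pi>: "comp_bij_on D GSL_codes \<pi>" and even: "\<And>x. x \<in> GSL_codes \<Longrightarrow> even (\<pi> x) = even x"
  shows "\<exists>p q. comp_bij_on D (vcode ` V) p \<and> comp_bij_on D (carrier F) q \<and> \<pi> = join p q"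
proof -
  define p where "p n = (if n \<in> vcode ` V then \<pi> (2 * n) div 2 else 0)" for n
  define q where "q a = (if a \<in> carrier F then \<pi> (Suc (2 * a)) div 2 else 0)" for a
  have c: "comp_in D \<pi>" and im: "\<pi> ` GSL_codes = GSL_codes" and inj: "inj_on \<pi> GSL_codes" and out: "\<And>x. x \<notin> GSL_codes \<Longrightarrow> \<pi> x = 0"
    using \<pi> by (auto simp: comp_bij_on_def bij_betw_def)
  have p: "\<pi> (2 * n) = 2 * p n" if "n \<in> vcode ` V" for n
    using even[of "2 * n"] that by (simp add: p_def)
  have q: "\<pi> (Suc (2 * a)) = Suc (2 * q a)" if "a \<in> carrier F" for a
    using even[of "Suc (2 * a)"] that by (simp add: q_def)
  have p_in: "p n \<in> vcode ` V" if n: "n \<in> vcode ` V" for n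
  proof -
    have "\<pi> (2 * n) \<in> GSL_codes" using im GSL_codes_iff(1)[THEN iffD2, OF n] by blast
    then show ?thesis unfolding p[OF n] GSL_codes_iff(1) .
  qed
  have q_in: "q a \<in> carrier F" if a: "a \<in> carrier F" for a
  proof -
    have "\<pi> (Suc (2 * a)) \<in> GSL_codes" using im GSL_codes_iff(2)[THEN iffD2, OF a] by blast
    then show ?thesis unfolding q[OF a] GSL_codes_iff(2) .
  qed
  have eq: "\<pi> x = join p q x" for x
  proof (cases "x \<in> GSL_codes")
    case True
    then show ?thesis by (cases rule: GSL_codes_cases) (simp_all only: p q join_app)
  next
    case False
    then show ?thesis using out by (simp add: join_def)
  qed
  have "comp_bij_on D (vcode ` V) p"
    unfolding comp_bij_on_def
  proof (intro conjI)
    show "comp_in D p" unfolding p_def[abs_def] by (intro computable dec_in_vcode comp_in_comp[OF c])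
    show "bij_betw p (vcode ` V) (vcode ` V)"
    proof (rule bij_betw_imageI)
      show "inj_on p (vcode ` V)"
      proof (rule inj_onI)
        fix m n assume *: "m \<in> vcode ` V" "n \<in> vcode ` V" "p m = p n"
        then have "\<pi> (2 * m) = \<pi> (2 * n)" by (simp only: p)
        from inj_onD[OF inj this] * show "m = n" by simp
      qed
      show "p ` vcode ` V = vcode ` V"
      proof (intro subset_antisym subsetI)
        fix n assume n: "n \<in> vcode ` V"
        then obtain x where x: "x \<in> GSL_codes" "\<pi> x = 2 * n" using im GSL_codes_iff(1) by (metis imageE)
        from x(1) show "n \<in> p ` vcode ` V"
        proof (cases rule: GSL_codes_cases)
          case (1 m)
          then have "p m = n" using p[of m] x(2) by simp
          then show ?thesis using 1(2) by blast
        next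
          case (2 a)
          then have "even (Suc (2 * a)) = even (2 * n)" using even[OF x(1)] x(2) by simp
          then show ?thesis by simp
        qed
      qed (use p_in in blast)
    qed
  qed (simp add: p_def)
  moreover have "comp_bij_on D (carrier F) q"
    unfolding comp_bij_on_def
  proof (intro conjI)
    show "comp_in D q" unfolding q_def[abs_def] by (intro computable comp_in_comp[OF c])
    show "bij_betw q (carrier F) (carrier F)"
    proof (rule bij_betw_imageI)
      show "inj_on q (carrier F)"
      proof (rule inj_onI)
        fix m n assume *: "m \<in> carrier F" "n \<in> carrier F" "q m = q n"
        then have "\<pi> (Suc (2 * m)) = \<pi> (Suc (2 * n))" by (simp only: q)
        from inj_onD[OF inj this] * show "m = n" by simp
      qed
      show "q ` carrier F = carrier F"
      proof (intro subset_antisym subsetI)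
        fix n assume n: "n \<in> carrier F"
        then obtain x where x: "x \<in> GSL_codes" "\<pi> x = Suc (2 * n)" using im GSL_codes_iff(2) by (metis imageE)
        from x(1) show "n \<in> q ` carrier F"
        proof (cases rule: GSL_codes_cases)
          case (2 a)
          then have "q a = n" using q[of a] x(2) by simp
          then show ?thesis using 2(2) by blast
        next
          case (1 m)
          then have "even (2 * m) = even (Suc (2 * n))" using even[OF x(1)] x(2) by simp
          then show ?thesis by simp
        qed
      qed (use q_in in blast)
    qed
  qed (simp add: q_def)
  ultimately show ?thesis using eq by blast
qed

text \<open>Beyond the sum of the three lengths all entries are zero and the equation of vectors
  holds by itself, so a bounded quantifier expresses it.\<close>

definition is_lin :: "nat \<Rightarrow> nat \<Rightarrow> nat \<Rightarrow> nat \<Rightarrow> nat \<Rightarrow> bool" where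
  "is_lin a u b v w \<longleftrightarrow> (\<forall>i<length (list_decode u) + length (list_decode v) + length (list_decode w).
     entry (list_decode w) i = fadd (fmult a (entry (list_decode u) i)) (fmult b (entry (list_decode v) i)))"

lemma is_lin_iff:
  assumes "a \<in> carrier F" "b \<in> carrier F" "u \<in> V" "v \<in> V" "w \<in> V"
  shows "is_lin a (vcode u) b (vcode v) (vcode w) \<longleftrightarrow> w = lin a u b v"
proof -
  have lin: "fadd (fmult a (u i)) (fmult b (v i)) = lin a u b v i" for i
    using assms by (simp add: fadd_def fmult_def lin_def V_closed)
  have "w i = lin a u b v i" if "\<not> i < vlen u + vlen v + vlen w" for i
  proof -
    from that have "vlen u \<le> i" "vlen v \<le> i" "vlen w \<le> i" by linarith+
    then have "u i = \<zero>" "v i = \<zero>" "w i = \<zero>" using assms vlen_zero by blast+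
    then show ?thesis using assms by (simp add: lin_def)
  qed
  then have "(\<forall>i<vlen u + vlen v + vlen w. w i = lin a u b v i) \<longleftrightarrow> (\<forall>i. w i = lin a u b v i)" by blast
  then show ?thesis
    unfolding is_lin_def entry_vcode[OF assms(3)] entry_vcode[OF assms(4)] entry_vcode[OF assms(5)] lin
    by (simp add: list_decode_vcode fun_eq_iff)
qed

text \<open>Length five is what the semilinear law takes: two scalars and three vectors. The parity
  clause, applied to every possible first entry, forces vectors to go to vectors and scalars to
  scalars.\<close>

definition GSL_relation :: "nat list \<Rightarrow> nat list \<Rightarrow> bool" where
  "GSL_relation xs ys \<longleftrightarrow> (5 \<le> length xs \<longrightarrow> even (nthd xs 0) = even (nthd ys 0) \<and>
     (odd (nthd xs 0) \<and> odd (nthd xs 1) \<and> odd (nthd xs 2) \<and>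
        nthd xs 2 div 2 = fadd (nthd xs 0 div 2) (nthd xs 1 div 2) \<longrightarrow>
        nthd ys 2 div 2 = fadd (nthd ys 0 div 2) (nthd ys 1 div 2)) \<and>
     (odd (nthd xs 0) \<and> odd (nthd xs 1) \<and> odd (nthd xs 2) \<and>
        nthd xs 2 div 2 = fmult (nthd xs 0 div 2) (nthd xs 1 div 2) \<longrightarrow>
        nthd ys 2 div 2 = fmult (nthd ys 0 div 2) (nthd ys 1 div 2)) \<and>
     (nthd xs 0 = Suc (2 * \<one>) \<longrightarrow> nthd ys 0 = Suc (2 * \<one>)) \<and>
     (odd (nthd xs 0) \<and> even (nthd xs 1) \<and> odd (nthd xs 2) \<and> even (nthd xs 3) \<and> even (nthd xs 4) \<and>
        is_lin (nthd xs 0 div 2) (nthd xs 1 div 2) (nthd xs 2 div 2) (nthd xs 3 div 2) (nthd xs 4 div 2) \<longrightarrow>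
        is_lin (nthd ys 0 div 2) (nthd ys 1 div 2) (nthd ys 2 div 2) (nthd ys 3 div 2) (nthd ys 4 div 2)))"

lemma dec_in_is_lin [computable]:
  assumes "comp_in A a" "comp_in A u" "comp_in A b" "comp_in A v" "comp_in A w"
  shows "dec_in A (\<lambda>x. is_lin (a x) (u x) (b x) (v x) (w x))"
proof -
  have "dec_in A (\<lambda>z. is_lin (pfst z) (pfst (psnd z)) (pfst (psnd (psnd z))) (pfst (psnd (psnd (psnd z)))) (psnd (psnd (psnd (psnd z)))))"
    unfolding is_lin_def by (intro computable)
  from dec_in_comp[OF this, of "\<lambda>x. prod_encode (a x, prod_encode (u x, prod_encode (b x, prod_encode (v x, w x))))"] assms
  show ?thesis by (simp add: comp_in_pair)
qed

lemma dec_in_GSL_relation: "dec_in A (\<lambda>z. GSL_relation (list_decode (pfst z)) (list_decode (psnd z)))"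
  unfolding GSL_relation_def by (intro computable)

definition GSL_action :: "((nat \<Rightarrow> nat) \<Rightarrow> (nat \<Rightarrow> nat)) \<times> (nat \<Rightarrow> nat) \<Rightarrow> nat \<Rightarrow> nat" where
  "GSL_action f = join (vec_action (fst f)) (scalar_action (snd f))"

lemma GSL_action_app: "v \<in> V \<Longrightarrow> GSL_action (\<mu>, \<sigma>) (2 * vcode v) = 2 * vcode (\<mu> v)" "a \<in> carrier F \<Longrightarrow> GSL_action (\<mu>, \<sigma>) (Suc (2 * a)) = Suc (2 * \<sigma> a)"
  by (simp_all add: GSL_action_def transport_app[OF inj_vcode] scalar_action_app)

lemma GSL_codes_vec_cases:
  assumes "x \<in> GSL_codes" obtains v where "x = 2 * vcode v" "v \<in> V" | a where "x = Suc (2 * a)" "a \<in> carrier F"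
  using assms by (cases rule: GSL_codes_cases) (use that in blast)+

lemma GSL_relation_iff:
  assumes \<mu>: "\<mu> \<in> Bij V" and \<sigma>: "\<sigma> \<in> Bij (carrier F)"
  shows "(\<forall>xs. set xs \<subseteq> GSL_codes \<longrightarrow> GSL_relation xs (map (GSL_action (\<mu>, \<sigma>)) xs)) \<longleftrightarrow> semilinear_aut \<sigma> \<mu>"
proof -
  let ?\<rho> = "GSL_action (\<mu>, \<sigma>)"
  have clV: "\<mu> v \<in> V" if "v \<in> V" for v using Bij_image[OF \<mu>] that by blast
  have clF: "\<sigma> a \<in> carrier F" if "a \<in> carrier F" for a using Bij_image[OF \<sigma>] that by blast
  have fops: "fadd a b = a \<oplus> b" "fmult a b = a \<otimes> b" if "a \<in> carrier F" "b \<in> carrier F" for a b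
    using that by (simp_all add: fadd_def fmult_def)
  show ?thesis
  proof
    assume L: "\<forall>xs. set xs \<subseteq> GSL_codes \<longrightarrow> GSL_relation xs (map ?\<rho> xs)"
    have K: "GSL_relation [x, y, z, s, t] [?\<rho> x, ?\<rho> y, ?\<rho> z, ?\<rho> s, ?\<rho> t]"
      if "x \<in> GSL_codes" "y \<in> GSL_codes" "z \<in> GSL_codes" "s \<in> GSL_codes" "t \<in> GSL_codes" for x y z s t
      using L[rule_format, of "[x, y, z, s, t]"] that by simp
    show "semilinear_aut \<sigma> \<mu>"
      unfolding semilinear_aut_def semilinear_iff
    proof (intro conjI ballI)
      fix a b assume ab: "a \<in> carrier F" "b \<in> carrier F"
      note n = nthd_def
      \<comment> \<open>The last two entries only fill the tuple up to length five.\<close>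
      show "\<sigma> (a \<oplus> b) = \<sigma> a \<oplus> \<sigma> b"
        using K[of "Suc (2 * a)" "Suc (2 * b)" "Suc (2 * (a \<oplus> b))" "Suc (2 * a)" "Suc (2 * a)"] ab
        unfolding GSL_relation_def by (simp add: n GSL_action_app fops clF)
      show "\<sigma> (a \<otimes> b) = \<sigma> a \<otimes> \<sigma> b"
        using K[of "Suc (2 * a)" "Suc (2 * b)" "Suc (2 * (a \<otimes> b))" "Suc (2 * a)" "Suc (2 * a)"] ab
        unfolding GSL_relation_def by (simp add: n GSL_action_app fops clF)
      fix u v assume uv: "u \<in> V" "v \<in> V"
      have "is_lin (\<sigma> a) (vcode (\<mu> u)) (\<sigma> b) (vcode (\<mu> v)) (vcode (\<mu> (lin a u b v)))"
        using K[of "Suc (2 * a)" "2 * vcode u" "Suc (2 * b)" "2 * vcode v" "2 * vcode (lin a u b v)"] ab uv lin_closed[OF ab uv]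
          is_lin_iff[OF ab uv lin_closed[OF ab uv]]
        unfolding GSL_relation_def by (simp add: n GSL_action_app)
      then show "\<mu> (lin a u b v) = lin (\<sigma> a) (\<mu> u) (\<sigma> b) (\<mu> v)"
        unfolding is_lin_iff[OF clF[OF ab(1)] clF[OF ab(2)] clV[OF uv(1)] clV[OF uv(2)] clV[OF lin_closed[OF ab uv]]] .
    next
      show "\<sigma> \<one> = \<one>"
        using K[of "Suc (2 * \<one>)" "Suc (2 * \<one>)" "Suc (2 * \<one>)" "Suc (2 * \<one>)" "Suc (2 * \<one>)"]
        unfolding GSL_relation_def by (simp add: nthd_def GSL_action_app)
    qed
  next
    assume s: "semilinear_aut \<sigma> \<mu>"
    show "\<forall>xs. set xs \<subseteq> GSL_codes \<longrightarrow> GSL_relation xs (map ?\<rho> xs)"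
    proof (intro allI impI)
      fix xs assume xs: "set xs \<subseteq> GSL_codes"
      define x where "x i = nthd xs i" for i
      have K: "GSL_relation xs (map ?\<rho> xs)" if len: "5 \<le> length xs"
      proof -
        have x: "x i \<in> GSL_codes" "nthd (map ?\<rho> xs) i = ?\<rho> (x i)" if "i < 5" for i
          using xs len that nth_mem[of i xs] by (auto simp: nthd_def x_def)
        have odd: "\<exists>a\<in>carrier F. x i = Suc (2 * a) \<and> ?\<rho> (x i) = Suc (2 * \<sigma> a)" if "odd (x i)" "i < 5" for i
          using x(1)[OF that(2)] that(1) by (cases rule: GSL_codes_vec_cases) (simp_all add: GSL_action_app)
        have even: "\<exists>v\<in>V. x i = 2 * vcode v \<and> ?\<rho> (x i) = 2 * vcode (\<mu> v)" if "even (x i)" "i < 5" for i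
          using x(1)[OF that(2)] that(1) by (cases rule: GSL_codes_vec_cases) (auto simp add: GSL_action_app)
        have 1: "even (x 0) = even (?\<rho> (x 0))"
          using odd[of 0] even[of 0] by (cases "even (x 0)") auto
        have 2: "?\<rho> (x 2) div 2 = fadd (?\<rho> (x 0) div 2) (?\<rho> (x 1) div 2)"
          if h: "odd (x 0) \<and> odd (x 1) \<and> odd (x 2) \<and> x 2 div 2 = fadd (x 0 div 2) (x 1 div 2)"
        proof -
          obtain a b c where abc: "a \<in> carrier F" "x 0 = Suc (2 * a)" "?\<rho> (x 0) = Suc (2 * \<sigma> a)"
            "b \<in> carrier F" "x 1 = Suc (2 * b)" "?\<rho> (x 1) = Suc (2 * \<sigma> b)"
            "c \<in> carrier F" "x 2 = Suc (2 * c)" "?\<rho> (x 2) = Suc (2 * \<sigma> c)"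
            using odd[of 0] odd[of 1] odd[of 2] h by auto
          have "c = a \<oplus> b" using h abc(1,4) unfolding abc(2,5,8) by (simp add: fops)
          then have "\<sigma> c = \<sigma> a \<oplus> \<sigma> b" using s abc(1,4) by (simp add: semilinear_aut_def)
          then show ?thesis unfolding abc(3,6,9) using abc(1,4) by (simp add: fops clF)
        qed
        have 3: "?\<rho> (x 2) div 2 = fmult (?\<rho> (x 0) div 2) (?\<rho> (x 1) div 2)"
          if h: "odd (x 0) \<and> odd (x 1) \<and> odd (x 2) \<and> x 2 div 2 = fmult (x 0 div 2) (x 1 div 2)"
        proof -
          obtain a b c where abc: "a \<in> carrier F" "x 0 = Suc (2 * a)" "?\<rho> (x 0) = Suc (2 * \<sigma> a)"
            "b \<in> carrier F" "x 1 = Suc (2 * b)" "?\<rho> (x 1) = Suc (2 * \<sigma> b)"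
            "c \<in> carrier F" "x 2 = Suc (2 * c)" "?\<rho> (x 2) = Suc (2 * \<sigma> c)"
            using odd[of 0] odd[of 1] odd[of 2] h by auto
          have "c = a \<otimes> b" using h abc(1,4) unfolding abc(2,5,8) by (simp add: fops)
          then have "\<sigma> c = \<sigma> a \<otimes> \<sigma> b" using s abc(1,4) by (simp add: semilinear_aut_def)
          then show ?thesis unfolding abc(3,6,9) using abc(1,4) by (simp add: fops clF)
        qed
        have 4: "?\<rho> (x 0) = Suc (2 * \<one>)" if "x 0 = Suc (2 * \<one>)"
          unfolding that using s by (simp add: GSL_action_app semilinear_aut_def)
        have 5: "is_lin (?\<rho> (x 0) div 2) (?\<rho> (x 1) div 2) (?\<rho> (x 2) div 2) (?\<rho> (x 3) div 2) (?\<rho> (x 4) div 2)"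
          if h: "odd (x 0) \<and> even (x 1) \<and> odd (x 2) \<and> even (x 3) \<and> even (x 4) \<and>
            is_lin (x 0 div 2) (x 1 div 2) (x 2 div 2) (x 3 div 2) (x 4 div 2)"
        proof -
          obtain a b where ab: "a \<in> carrier F" "x 0 = Suc (2 * a)" "?\<rho> (x 0) = Suc (2 * \<sigma> a)"
            "b \<in> carrier F" "x 2 = Suc (2 * b)" "?\<rho> (x 2) = Suc (2 * \<sigma> b)"
            using odd[of 0] odd[of 2] h by auto
          obtain u v w where uv: "u \<in> V" "x 1 = 2 * vcode u" "?\<rho> (x 1) = 2 * vcode (\<mu> u)"
            "v \<in> V" "x 3 = 2 * vcode v" "?\<rho> (x 3) = 2 * vcode (\<mu> v)"
            "w \<in> V" "x 4 = 2 * vcode w" "?\<rho> (x 4) = 2 * vcode (\<mu> w)"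
            using even[of 1] even[of 3] even[of 4] h by auto
          have "is_lin a (vcode u) b (vcode v) (vcode w)" using h unfolding ab(2,5) uv(2,5,8) by simp
          then have "w = lin a u b v" unfolding is_lin_iff[OF ab(1,4) uv(1,4,7)] .
          then have "\<mu> w = lin (\<sigma> a) (\<mu> u) (\<sigma> b) (\<mu> v)"
            using s ab(1,4) uv(1,4) by (simp add: semilinear_aut_def semilinear_iff)
          then have "is_lin (\<sigma> a) (vcode (\<mu> u)) (\<sigma> b) (vcode (\<mu> v)) (vcode (\<mu> w))"
            unfolding is_lin_iff[OF clF[OF ab(1)] clF[OF ab(4)] clV[OF uv(1)] clV[OF uv(4)] clV[OF uv(7)]] .
          then show ?thesis unfolding ab(3,6) uv(3,6,9) by simp
        qed
        have y: "nthd (map ?\<rho> xs) 0 = ?\<rho> (x 0)" "nthd (map ?\<rho> xs) 1 = ?\<rho> (x 1)" "nthd (map ?\<rho> xs) 2 = ?\<rho> (x 2)"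
          "nthd (map ?\<rho> xs) 3 = ?\<rho> (x 3)" "nthd (map ?\<rho> xs) 4 = ?\<rho> (x 4)"
          by (simp_all add: x(2))
        show ?thesis unfolding GSL_relation_def y x_def[symmetric] using 1 2 3 4 5 by (intro impI conjI) blast+
      qed
      then show "GSL_relation xs (map ?\<rho> xs)" by (cases "5 \<le> length xs") (simp_all add: GSL_relation_def)
    qed
  qed
qed

lemma comp_perm_group_GSL:
  "comp_perm_group (GSL F (degree_of D)) D GSL_codes GSL_relation GSL_action"
proof -
  let ?G = "GSL F (degree_of D)"
  have KG_even: "even (\<pi> x) = even x" if "\<forall>xs. set xs \<subseteq> GSL_codes \<longrightarrow> GSL_relation xs (map \<pi> xs)" "x \<in> GSL_codes" for \<pi> x
    using that(1)[rule_format, of "[x, x, x, x, x]"] that(2) by (simp add: GSL_relation_def nthd_def)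
  have tV_eq: "\<mu> = \<mu>'" if "\<mu> \<in> Bij V" "\<mu>' \<in> Bij V" "vec_action \<mu> = vec_action \<mu>'" for \<mu> \<mu>'
    using transport_eq_iff[OF inj_vcode that] .
  have tF_eq: "\<sigma> = \<sigma>'" if "\<sigma> \<in> Bij (carrier F)" "\<sigma>' \<in> Bij (carrier F)" "scalar_action \<sigma> = scalar_action \<sigma>'" for \<sigma> \<sigma>'
    using transport_eq_iff[OF inj_on_id2 that] .
  show ?thesis
  proof (intro comp_perm_group.intro comp_perm_group_axioms.intro)
    show "group ?G" by (rule group_GSL)
    show "dec_in D (\<lambda>x. x \<in> GSL_codes)" by (rule dec_in_GSL_codes)
    show "dec_in (turing_jump D) (\<lambda>z. GSL_relation (list_decode (pfst z)) (list_decode (psnd z)))" by (rule dec_in_GSL_relation)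
    show "inj_on GSL_action (carrier ?G)"
    proof (rule inj_onI)
      fix f g assume fg: "f \<in> carrier ?G" "g \<in> carrier ?G" "GSL_action f = GSL_action g"
      obtain \<mu> \<sigma> \<mu>' \<sigma>' where e: "f = (\<mu>, \<sigma>)" "g = (\<mu>', \<sigma>')" by (cases f, cases g)
      note f' = fg(1)[unfolded e carrier_GSL] and g' = fg(2)[unfolded e carrier_GSL]
      have "vec_action \<mu> n = vec_action \<mu>' n" for n
      proof (cases "n \<in> vcode ` V")
        case True
        then show ?thesis using fun_cong[OF fg(3), of "2 * n"] by (simp add: GSL_action_def e)
      qed (simp add: transport_outside)
      moreover have "scalar_action \<sigma> a = scalar_action \<sigma>' a" for a
      proof (cases "a \<in> carrier F")
        case True
        then show ?thesis using fun_cong[OF fg(3), of "Suc (2 * a)"] by (simp add: GSL_action_def e)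
      qed (simp add: transport_outside)
      ultimately show "f = g" unfolding e using f' g' tV_eq[of \<mu> \<mu>'] tF_eq[of \<sigma> \<sigma>'] by (simp add: fun_eq_iff)
    qed
    show "GSL_action ` carrier ?G = {\<pi>. comp_bij_on D GSL_codes \<pi> \<and> (\<forall>xs. set xs \<subseteq> GSL_codes \<longrightarrow> GSL_relation xs (map \<pi> xs))}" (is "_ = ?S")
    proof (intro subset_antisym subsetI)
      fix \<pi> assume "\<pi> \<in> GSL_action ` carrier ?G"
      then obtain \<mu> \<sigma> where f: "(\<mu>, \<sigma>) \<in> carrier ?G" and \<pi>: "\<pi> = GSL_action (\<mu>, \<sigma>)" by auto
      note f' = f[unfolded carrier_GSL]
      have b: "\<mu> \<in> Bij V" "\<sigma> \<in> Bij (carrier F)" using f' by auto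
      have "comp_bij_on D (vcode ` V) (vec_action \<mu>)"
        using f' fun_degree_le_iff[OF inj_vcode dec_in_vcode Bij_image[OF b(1)]] transport_bij_betw[OF inj_vcode Bij_bij[OF b(1)]]
        by (simp add: comp_bij_on_def transport_outside)
      moreover have "comp_bij_on D (carrier F) (scalar_action \<sigma>)"
        using f' fun_degree_le_iff[OF inj_on_id2 dec_in_id_image Bij_image[OF b(2)]]
          transport_bij_betw[OF inj_on_id2 Bij_bij[OF b(2)]]
        by (simp add: comp_bij_on_def transport_outside)
      ultimately have "comp_bij_on D GSL_codes \<pi>" unfolding \<pi> GSL_action_def by (simp add: comp_bij_on_join)
      then show "\<pi> \<in> ?S" using GSL_relation_iff[OF b] f' \<pi> by simp
    next
      fix \<pi> assume \<pi>: "\<pi> \<in> ?S"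
      then obtain p q where pq: "comp_bij_on D (vcode ` V) p" "comp_bij_on D (carrier F) q" "\<pi> = join p q"
        using comp_bij_on_split[of D \<pi>] KG_even[of \<pi>] by blast
      obtain \<mu> where \<mu>: "\<mu> \<in> Bij V" "fun_degree vcode V \<mu> \<le> degree_of D" "vec_action \<mu> = p"
        using comp_bij_on_transport[OF inj_vcode dec_in_vcode pq(1)] by blast
      have "comp_bij_on D ((\<lambda>a. a) ` carrier F) q" using pq(2) by simp
      then obtain \<sigma> where \<sigma>: "\<sigma> \<in> Bij (carrier F)" "fun_degree (\<lambda>a. a) (carrier F) \<sigma> \<le> degree_of D" "scalar_action \<sigma> = q"
        using comp_bij_on_transport[OF inj_on_id2 dec_in_id_image] by blast
      have \<pi>_eq: "\<pi> = GSL_action (\<mu>, \<sigma>)" using pq(3) \<mu>(3) \<sigma>(3) by (simp add: GSL_action_def)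
      have "semilinear_aut \<sigma> \<mu>" using GSL_relation_iff[OF \<mu>(1) \<sigma>(1)] \<pi> \<pi>_eq by simp
      then have "(\<mu>, \<sigma>) \<in> carrier ?G" using \<mu> \<sigma> by (simp add: carrier_GSL)
      then show "\<pi> \<in> GSL_action ` carrier ?G" using \<pi>_eq by blast
    qed
    fix f g x assume fg: "f \<in> carrier ?G" "g \<in> carrier ?G" and x: "x \<in> GSL_codes"
    obtain \<mu> \<sigma> \<mu>' \<sigma>' where e: "f = (\<mu>, \<sigma>)" "g = (\<mu>', \<sigma>')" by (cases f, cases g)
    have b: "\<mu>' \<in> Bij V" "\<sigma>' \<in> Bij (carrier F)" using fg(2) by (auto simp: e carrier_GSL)
    have m: "f \<otimes>\<^bsub>?G\<^esub> g = (compose V \<mu> \<mu>', compose (carrier F) \<sigma> \<sigma>')"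
      unfolding e by (rule GSL_mult[OF fg[unfolded e]])
    from x show "GSL_action (f \<otimes>\<^bsub>?G\<^esub> g) x = GSL_action f (GSL_action g x)"
    proof (cases rule: GSL_codes_vec_cases)
      case (1 v)
      then have "\<mu>' v \<in> V" using Bij_image[OF b(1)] by blast
      then show ?thesis unfolding m unfolding e using 1 by (simp add: GSL_action_app compose_def)
    next
      case (2 a)
      then have "\<sigma>' a \<in> carrier F" using Bij_image[OF b(2)] by blast
      then show ?thesis unfolding m unfolding e using 2 by (simp add: GSL_action_app compose_def)
    qed
  qed
qed

section \<open>Permutations of the standard basis\<close>

definition perm_map :: "(nat \<Rightarrow> nat) \<Rightarrow> ((nat \<Rightarrow> nat) \<Rightarrow> (nat \<Rightarrow> nat)) \<times> (nat \<Rightarrow> nat)" where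
  "perm_map \<pi> = (\<lambda>v\<in>V. v \<circ> the_inv \<pi>, \<lambda>a\<in>carrier F. a)"

lemma V_comp_bij: assumes "bij \<pi>" "v \<in> V" shows "v \<circ> \<pi> \<in> V"
proof -
  have "{i. (v \<circ> \<pi>) i \<noteq> \<zero>} = \<pi> -` {i. v i \<noteq> \<zero>}" by auto
  then show ?thesis using assms finite_vimageI[of "{i. v i \<noteq> \<zero>}" \<pi>] unfolding V_iff by (simp add: bij_def)
qed

lemma the_inv_comp: "bij \<pi> \<Longrightarrow> the_inv \<pi> (\<pi> i) = i" "bij \<pi> \<Longrightarrow> \<pi> (the_inv \<pi> i) = i" for \<pi> :: "nat \<Rightarrow> nat"
  by (auto simp: bij_def the_inv_f_f f_the_inv_into_f)

lemma bij_the_inv: "bij \<pi> \<Longrightarrow> bij (the_inv \<pi>)" for \<pi> :: "nat \<Rightarrow> nat"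
  using bij_betw_the_inv_into by force

lemma perm_map_Bij: assumes "bij \<pi>" shows "fst (perm_map \<pi>) \<in> Bij V"
proof -
  note i = bij_the_inv[OF assms]
  have "bij_betw (\<lambda>v. v \<circ> the_inv \<pi>) V V"
    by (rule bij_betw_byWitness[where f' = "\<lambda>v. v \<circ> \<pi>"])
      (auto simp: comp_def fun_eq_iff the_inv_comp[OF assms] intro: V_comp_bij[OF assms, unfolded comp_def] V_comp_bij[OF i, unfolded comp_def])
  then have "bij_betw (fst (perm_map \<pi>)) V V"
    by (rule bij_betw_cong[THEN iffD1, rotated]) (simp add: perm_map_def)
  then show ?thesis by (simp add: Bij_def perm_map_def)
qed

lemma perm_map_carrier:
  assumes \<pi>: "comp_perm D \<pi>" shows "perm_map \<pi> \<in> carrier (GSL F (degree_of D))"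
proof -
  have b: "bij \<pi>" and c: "comp_in D \<pi>" using \<pi> by (auto simp: comp_perm_def)
  have c': "comp_in D (the_inv \<pi>)" using comp_perm_inv[OF \<pi>] by (simp add: comp_perm_def)
  let ?\<mu> = "fst (perm_map \<pi>)" and ?\<sigma> = "snd (perm_map \<pi>)"
  have \<mu>: "?\<mu> \<in> Bij V" by (rule perm_map_Bij[OF b])
  have \<mu>_app: "?\<mu> v = v \<circ> the_inv \<pi>" if "v \<in> V" for v using that by (simp add: perm_map_def)
  have id: "(\<lambda>a\<in>carrier F. a) \<in> Bij (carrier F)" by (rule id_Bij)
  have "semilinear_aut ?\<sigma> ?\<mu>"
    unfolding semilinear_aut_def semilinear_iff by (auto simp: perm_map_def lin_closed) (auto simp: lin_def comp_def)
  moreover have "fun_degree (\<lambda>a. a) (carrier F) ?\<sigma> \<le> degree_of D"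
  proof -
    have "transport (\<lambda>a. a) (carrier F) (\<lambda>a\<in>carrier F. a) = (\<lambda>x. if x \<in> carrier F then x else 0)"
      using scalar_action_app by (auto simp: fun_eq_iff transport_outside)
    then show ?thesis
      unfolding perm_map_def snd_conv fun_degree_le_iff[OF inj_on_id2 dec_in_id_image Bij_image[OF id]]
      by (simp add: computable)
  qed
  moreover have "fun_degree vcode V ?\<mu> \<le> degree_of D"
    unfolding fun_degree_le_iff[OF inj_vcode dec_in_vcode Bij_image[OF \<mu>]]
  proof -
    \<comment> \<open>The two bounded conditions together determine all of \<open>y\<close>: the
      first covers the images of positions in \<open>x\<close>, the second the positions in
      \<open>y\<close>, and at all others both vectors vanish.\<close>
    define R where "R x y \<longleftrightarrow> (if x \<in> vcode ` V then y \<in> vcode ` V \<and>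
      (\<forall>i<length (list_decode x). entry (list_decode y) (\<pi> i) = entry (list_decode x) i) \<and>
      (\<forall>j<length (list_decode y). entry (list_decode x) (the_inv \<pi> j) = entry (list_decode y) j) else y = 0)" for x y
    have R: "R x y \<longleftrightarrow> y = vec_action ?\<mu> x" for x y
    proof (cases "x \<in> vcode ` V")
      case True
      then obtain v where v: "v \<in> V" "x = vcode v" by blast
      have t: "vec_action ?\<mu> x = vcode (v \<circ> the_inv \<pi>)" using v \<mu>_app by (simp add: transport_app[OF inj_vcode])
      have v': "v \<circ> the_inv \<pi> \<in> V" by (rule V_comp_bij[OF bij_the_inv[OF b] v(1)])
      show ?thesis
      proof
        assume "R x y"
        then obtain w where w: "w \<in> V" "y = vcode w" and
          1: "\<forall>i<vlen v. w (\<pi> i) = v i" and 2: "\<forall>j<vlen w. v (the_inv \<pi> j) = w j"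
          using True v by (auto simp: R_def entry_vcode) (simp add: list_decode_vcode)
        have "w j = v (the_inv \<pi> j)" for j
        proof (cases "j < vlen w")
          case False
          then have wj: "w j = \<zero>" using vlen_zero[OF w(1)] by simp
          show ?thesis
          proof (cases "the_inv \<pi> j < vlen v")
            case True
            then show ?thesis using 1 the_inv_comp(2)[OF b] by metis
          next
            case False
            then show ?thesis using wj vlen_zero[OF v(1)] by simp
          qed
        qed (use 2 in simp)
        then have "w = v \<circ> the_inv \<pi>" by (simp add: fun_eq_iff)
        then show "y = vec_action ?\<mu> x" using w(2) t by simp
      next
        assume "y = vec_action ?\<mu> x"
        then show "R x y" using True v v' t by (simp add: R_def entry_vcode the_inv_comp[OF b])
      qed
    qed (simp add: R_def transport_outside)
    have "comp_in D (\<lambda>x. LEAST y. R x y)"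
    proof (rule comp_in_Least)
      show "dec_in D (\<lambda>z. R (pfst z) (psnd z))"
        unfolding R_def by (intro computable dec_in_comp[OF dec_in_vcode] comp_in_comp[OF c] comp_in_comp[OF c'])
    qed (simp add: R)
    moreover have "(LEAST y. R x y) = vec_action ?\<mu> x" for x unfolding R by (rule Least_equality) simp_all
    ultimately show "comp_in D (vec_action ?\<mu>)" by simp
  qed
  ultimately have "(?\<mu>, ?\<sigma>) \<in> carrier (GSL F (degree_of D))"
    using \<mu> id unfolding carrier_GSL by (simp add: perm_map_def)
  then show ?thesis by simp
qed

text \<open>The inverse in \<open>perm_map\<close> is essential here: composing vectors with
  \<open>\<pi>\<close> itself on the right would reverse products.\<close>

lemma perm_map_hom:
  assumes "comp_perm D \<pi>" "comp_perm D \<rho>"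
  shows "perm_map (\<pi> \<circ> \<rho>) = perm_map \<pi> \<otimes>\<^bsub>GSL F (degree_of D)\<^esub> perm_map \<rho>"
proof -
  have b: "bij \<pi>" "bij \<rho>" using assms by (auto simp: comp_perm_def)
  have inv: "the_inv (\<pi> \<circ> \<rho>) = the_inv \<rho> \<circ> the_inv \<pi>"
    by (rule the_inv_eq_of_inverse) (auto simp: fun_eq_iff the_inv_comp b)
  have "perm_map \<pi> \<otimes>\<^bsub>GSL F (degree_of D)\<^esub> perm_map \<rho> =
    (compose V (fst (perm_map \<pi>)) (fst (perm_map \<rho>)), compose (carrier F) (snd (perm_map \<pi>)) (snd (perm_map \<rho>)))"
    using GSL_mult[of "fst (perm_map \<pi>)" "snd (perm_map \<pi>)" "degree_of D" "fst (perm_map \<rho>)" "snd (perm_map \<rho>)"]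
      perm_map_carrier assms by simp
  also have "\<dots> = perm_map (\<pi> \<circ> \<rho>)"
    using V_comp_bij[OF bij_the_inv[OF b(2)]]
    by (auto simp: perm_map_def compose_def inv fun_eq_iff comp_assoc)
  finally show ?thesis by simp
qed

definition unit :: "nat \<Rightarrow> nat \<Rightarrow> nat" where
  "unit n = (\<lambda>i. if i = n then \<one> else \<zero>)"

lemma unit_V: "unit n \<in> V"
  unfolding V_iff unit_def by (auto intro: finite_subset[of _ "{n}"])

lemma unit_perm: "bij \<pi> \<Longrightarrow> unit n \<circ> the_inv \<pi> = unit (\<pi> n)"
  using the_inv_comp[of \<pi>] by (auto simp: unit_def fun_eq_iff)

lemma unit_inj: "unit m = unit n \<Longrightarrow> m = n"
  by (metis one_not_zero unit_def)

lemma perm_map_inj: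
  assumes "comp_perm D \<pi>" "perm_map \<pi> = \<one>\<^bsub>GSL F (degree_of D)\<^esub>" shows "\<pi> = (\<lambda>x. x)"
proof
  fix n
  have b: "bij \<pi>" using assms by (simp add: comp_perm_def)
  have "fst (perm_map \<pi>) (unit n) = unit n" using assms(2) unit_V by (simp add: GSL_one)
  then have "unit (\<pi> n) = unit n" using unit_V unit_perm[OF b] by (simp add: perm_map_def)
  then show "\<pi> n = n" by (rule unit_inj)
qed

lemma add_idem_zero: "a \<in> carrier F \<Longrightarrow> a = a \<oplus> a \<Longrightarrow> a = \<zero>"
  using r_neg1[of a a] l_neg[of a] by simp

text \<open>Induction on \<open>S\<close> splits off one coordinate as a multiple of a unit vector,
  whose image contributes its own support. With empty support, \<open>y = y + y\<close> forces the
  image of \<open>y\<close> to be zero.\<close>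

lemma semilinear_aut_finite_support:
  assumes \<mu>: "\<mu> ` V \<subseteq> V" and \<sigma>: "\<sigma> ` carrier F \<subseteq> carrier F" and s: "semilinear_aut \<sigma> \<mu>" and S: "finite S"
  shows "y \<in> V \<Longrightarrow> {i. y i \<noteq> \<zero>} \<subseteq> S \<Longrightarrow> {j. \<mu> y j \<noteq> \<zero>} \<subseteq> (\<Union>i\<in>S. {j. \<mu> (unit i) j \<noteq> \<zero>})"
  using S
proof (induction S arbitrary: y)
  case empty
  have z: "\<mu> y \<in> V" using \<mu> empty by blast
  have "\<mu> (lin \<one> y \<one> y) = lin (\<sigma> \<one>) (\<mu> y) (\<sigma> \<one>) (\<mu> y)"
    using s empty.prems(1) unfolding semilinear_aut_def semilinear_iff by blast
  moreover have "lin \<one> y \<one> y = y" using empty by (auto simp: lin_def)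
  moreover have "\<sigma> \<one> = \<one>" using s by (simp add: semilinear_aut_def)
  ultimately have eq: "\<mu> y = lin \<one> (\<mu> y) \<one> (\<mu> y)" by (simp only:)
  have "\<mu> y i = \<zero>" for i
  proof (rule add_idem_zero)
    show "\<mu> y i = \<mu> y i \<oplus> \<mu> y i" using fun_cong[OF eq, of i] V_closed[OF z, of i] by (simp only: lin_def l_one)
  qed (rule V_closed[OF z])
  then show ?case by simp
next
  case (insert n S)
  let ?y = "y(n := \<zero>)"
  have y: "?y \<in> V" using insert.prems(1) unfolding V_iff by (auto intro: finite_subset[of _ "{i. y i \<noteq> \<zero>}"])
  have c: "y i \<in> carrier F" for i using insert.prems(1) by (rule V_closed)
  have eq: "y = lin \<one> ?y (y n) (unit n)"
    by (rule ext) (simp add: lin_def unit_def c)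
  have l: "\<mu> y = lin (\<sigma> \<one>) (\<mu> ?y) (\<sigma> (y n)) (\<mu> (unit n))"
    using s y unit_V c by (subst eq) (simp add: semilinear_aut_def semilinear_iff)
  have "{j. \<mu> ?y j \<noteq> \<zero>} \<subseteq> (\<Union>i\<in>S. {j. \<mu> (unit i) j \<noteq> \<zero>})"
    by (rule insert.IH[OF y]) (use insert.prems(2) in auto)
  moreover have "\<sigma> (y n) \<in> carrier F" "\<sigma> \<one> \<in> carrier F" using \<sigma> c one_closed by blast+
  then have "{j. \<mu> y j \<noteq> \<zero>} \<subseteq> {j. \<mu> ?y j \<noteq> \<zero>} \<union> {j. \<mu> (unit n) j \<noteq> \<zero>}"
    unfolding l by (auto simp: lin_def)
  ultimately show ?case by blast
qed

text \<open>If \<open>w\<close> has finite support, the range of \<open>w - 1\<close> is spanned by finitely many unit vectors.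
  Its image under a semilinear map is spanned by finitely many vectors, so all its members vanish
  outside a fixed finite set. But the range of \<open>r - 1\<close> contains the difference of the unit
  vectors at \<open>r x\<close> and \<open>x\<close>.\<close>

lemma perm_map_not_conj:
  assumes r: "comp_perm D r" and w: "comp_perm D w"
    and inf: "infinite {x. r x \<noteq> x}" and fin: "finite {x. w x \<noteq> x}"
    and h: "h \<in> carrier (GSL F (degree_of D))"
  shows "h \<otimes>\<^bsub>GSL F (degree_of D)\<^esub> perm_map r \<noteq> perm_map w \<otimes>\<^bsub>GSL F (degree_of D)\<^esub> h"
proof
  let ?G = "GSL F (degree_of D)"
  assume eq: "h \<otimes>\<^bsub>?G\<^esub> perm_map r = perm_map w \<otimes>\<^bsub>?G\<^esub> h"
  obtain \<mu> \<sigma> where he: "h = (\<mu>, \<sigma>)" by (cases h)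
  note h' = h[unfolded he carrier_GSL]
  have b: "bij r" "bij w" using r w by (auto simp: comp_perm_def)
  have \<mu>B: "\<mu> \<in> Bij V" and \<sigma>B: "\<sigma> \<in> Bij (carrier F)" and s: "semilinear_aut \<sigma> \<mu>" using h' by auto
  have \<mu>V: "\<mu> v \<in> V" if "v \<in> V" for v using Bij_image[OF \<mu>B] that by blast
  have "compose V \<mu> (fst (perm_map r)) = compose V (fst (perm_map w)) \<mu>"
    using eq GSL_mult[of \<mu> \<sigma> "degree_of D" "fst (perm_map r)" "snd (perm_map r)"]
      GSL_mult[of "fst (perm_map w)" "snd (perm_map w)" "degree_of D" \<mu> \<sigma>]
      perm_map_carrier[OF r] perm_map_carrier[OF w] h unfolding he by simp
  from fun_cong[OF this] have conj: "\<mu> (v \<circ> the_inv r) = \<mu> v \<circ> the_inv w" if "v \<in> V" for v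
    using that \<mu>V[OF that] by (metis (no_types, lifting) compose_eq perm_map_def fst_conv restrict_apply')
  let ?\<sigma> = "\<lambda>a\<in>carrier F. inv_into (carrier F) \<sigma> a" and ?\<mu> = "\<lambda>v\<in>V. inv_into V \<mu> v"
  have s': "semilinear_aut ?\<sigma> ?\<mu>" by (rule semilinear_aut_inverse[OF \<mu>B \<sigma>B s])
  \<comment> \<open>\<open>T\<close> contains all coordinates that the inverse map can reach from
    vectors supported on the moved points of \<open>w\<close>.\<close>
  define T where "T = (\<Union>i\<in>{x. w x \<noteq> x}. {j. ?\<mu> (unit i) j \<noteq> \<zero>})"
  have T: "finite T" unfolding T_def
  proof (rule finite_UN_I[OF fin])
    fix i
    have "?\<mu> (unit i) \<in> V" using Bij_image[OF restrict_inv_into_Bij[OF \<mu>B]] unit_V by blast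
    then show "finite {j. ?\<mu> (unit i) j \<noteq> \<zero>}" unfolding V_iff by blast
  qed
  have "r x \<in> T" if x: "r x \<noteq> x" for x
  proof -
    \<comment> \<open>\<open>?v\<close> is the image of the unit vector at \<open>x\<close> under
      \<open>r - 1\<close>; the conjugacy turns its image under \<open>\<mu>\<close> into a value of
      \<open>w - 1\<close>.\<close>
    let ?v = "lin \<one> (unit (r x)) (\<ominus> \<one>) (unit x)"
    have v: "?v \<in> V" using unit_V by (intro lin_closed) auto
    have s1: "\<sigma> \<one> = \<one>" and sm: "\<sigma> (\<ominus> \<one>) \<in> carrier F" using s Bij_image[OF \<sigma>B] by (auto simp: semilinear_aut_def)
    have s0: "\<sigma> (\<ominus> \<one>) = \<ominus> \<one>"
    proof -
      have hom: "\<sigma> (a \<oplus> b) = \<sigma> a \<oplus> \<sigma> b" if "a \<in> carrier F" "b \<in> carrier F" for a b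
        using s that by (simp add: semilinear_aut_def)
      have "\<sigma> \<zero> \<in> carrier F" "\<sigma> \<zero> = \<sigma> \<zero> \<oplus> \<sigma> \<zero>" using Bij_image[OF \<sigma>B] hom[of \<zero> \<zero>] by auto
      then have "\<sigma> \<zero> = \<zero>" by (rule add_idem_zero)
      then have "\<sigma> (\<ominus> \<one>) \<oplus> \<one> = \<zero>" using hom[of "\<ominus> \<one>" \<one>] s1 by (simp add: l_neg)
      then show ?thesis using sm by (metis minus_equality one_closed)
    qed
    have \<mu>v: "\<mu> ?v = lin \<one> (\<mu> (unit x) \<circ> the_inv w) (\<ominus> \<one>) (\<mu> (unit x))"
    proof -
      have "\<mu> ?v = lin (\<sigma> \<one>) (\<mu> (unit (r x))) (\<sigma> (\<ominus> \<one>)) (\<mu> (unit x))"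
        using s unit_V by (simp add: semilinear_aut_def semilinear_iff)
      moreover have "\<mu> (unit (r x)) = \<mu> (unit x) \<circ> the_inv w"
        using conj[OF unit_V[of x]] unfolding unit_perm[OF b(1)] .
      ultimately show ?thesis by (simp only: s1 s0)
    qed
    have supp: "{i. \<mu> ?v i \<noteq> \<zero>} \<subseteq> {x. w x \<noteq> x}"
    proof (intro subsetI, unfold mem_Collect_eq, rule notI)
      fix i assume i: "\<mu> ?v i \<noteq> \<zero>" "w i = i"
      then have "the_inv w i = i" using the_inv_comp(1)[OF b(2)] by metis
      then have "\<mu> ?v i = \<one> \<otimes> \<mu> (unit x) i \<oplus> (\<ominus> \<one>) \<otimes> \<mu> (unit x) i" unfolding \<mu>v by (simp add: lin_def)
      also have "\<dots> = \<zero>" using V_closed[OF \<mu>V[OF unit_V], of x i] by (simp add: l_minus r_neg)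
      finally show False using i(1) by simp
    qed
    have "{j. ?\<mu> (\<mu> ?v) j \<noteq> \<zero>} \<subseteq> T"
      unfolding T_def
      by (rule semilinear_aut_finite_support[OF Bij_image[OF restrict_inv_into_Bij[OF \<mu>B]] Bij_image[OF restrict_inv_into_Bij[OF \<sigma>B]] s' fin \<mu>V[OF v] supp])
    moreover have "?\<mu> (\<mu> ?v) = ?v"
      using \<mu>V[OF v] Bij_bij[OF \<mu>B] v by (simp add: bij_betw_def inv_into_f_f)
    \<comment> \<open>As \<open>r x\<close> differs from \<open>x\<close>, the coordinate of
      \<open>?v\<close> at \<open>r x\<close> is \<open>\<one>\<close>, which puts
      \<open>r x\<close> into \<open>T\<close>.\<close>
    moreover have "?v (r x) \<noteq> \<zero>" using x by (simp add: lin_def unit_def)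
    ultimately show "r x \<in> T" by auto
  qed
  then have "r ` {x. r x \<noteq> x} \<subseteq> T" by blast
  then have "finite (r ` {x. r x \<noteq> x})" using T by (rule finite_subset)
  then show False using inf b(1) finite_imageD[of r "{x. r x \<noteq> x}"] by (auto simp: bij_def intro: inj_on_subset)
qed

lemma iso_type_GSL: "iso_type_has_degree (GSL F (degree_of D)) (degree_of (turing_jump (turing_jump D)))"
  using comp_perm_group_GSL[of D]
  by (rule comp_perm_group.iso_type_has_degreeI[where \<iota> = perm_map])
    (simp_all add: perm_map_carrier perm_map_hom perm_map_inj perm_map_not_conj)

end

theorem theorem3p5:
  fixes d :: turing_degree and D :: "nat set" and F :: "nat ring"
  assumes "degree_of D = d"
    and "computable_field F"
  shows "iso_type_has_degree (GSL F d) (degree_of (turing_jump (turing_jump D)))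
    \<and> iso_type_has_degree (Aut_B_eta d) (degree_of (turing_jump (turing_jump D)))"
proof -
  interpret comp_field F by unfold_locales (rule assms(2))
  show ?thesis unfolding assms(1)[symmetric] using iso_type_GSL iso_type_Aut_B_eta by blast
qed

end
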